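(* For every $\mathbf{q}\in\mathbb{N}^{n-1}$ one has $d_1^{\mathbf{q}}>c_1^{\mathbf{q}}$, and $d_1^{\mathbf{q}}$ is a critical value of $I_1^{\mathbf{q}}$ on $\Lambda_1^{\mathbf{q}}$ with a corresponding critical point $u_{\mathbf{q}}\in\mathcal{G}_1^{\mathbf{q}}$ (i.e. $(I_1^{\mathbf{q}})'(u_{\mathbf{q}})=0$ and $I_1^{\mathbf{q}}(u_{\mathbf{q}})=d_1^{\mathbf{q}}$) such that $v_1<u_{\mathbf{q}}+v_1<w_1$ and $u_{\mathbf{q}}+v_1$ is a solution of $(E)$.
   Context: Let $n,r\in\mathbb{N}=\{1,2,\dots\}$. For $\mathbf{i}\in\mathbb{Z}^n$ put $\|\mathbf{i}\|=\sum_{j=1}^n|\mathbf{i}_j|$ and $B=\{\mathbf{k}\in\mathbb{Z}^n:\|\mathbf{k}\|\le r\}$. Let $s\in C^2(\mathbb{R}^B,\mathbb{R})$ satisfy: (S1) $s(u+1_B)=s(u)$, $1_B$ being the constant function $1$ on $B$; (S2) $s$ is bounded from below and $\lim_{|u(\mathbf{k})-u(\mathbf{j})|\to\infty}s(u)=\infty$ for all $\mathbf{k},\mathbf{j}\in B$ with $\|\mathbf{k}-\mathbf{j}\|=1$; (S3) $\partial_{\mathbf{k},\mathbf{j}}s\le 0$ for $\mathbf{k},\mathbf{j}\in B$, $\mathbf{k}\ne\mathbf{j}$, and $\partial_{\mathbf{0},\mathbf{j}}s<0$ for $\|\mathbf{j}\|=1$; (S4) there is a constant $C$ with $|\partial_{\mathbf{i},\mathbf{k}}s|\le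 C$ for all $\mathbf{i},\mathbf{k}\in B$. For $u:\mathbb{Z}^n\to\mathbb{R}$ and $\mathbf{j}\in\mathbb{Z}^n$ let $S_{\mathbf{j}}(u)=s\big((u(\mathbf{j}+\mathbf{k}))_{\mathbf{k}\in B}\big)$, and let $\partial_{\mathbf{i}}S_{\mathbf{j}}$ be the partial derivative with respect to $u(\mathbf{i})$. A solution of $(E)$ is a function $u:\mathbb{Z}^n\to\mathbb{R}$ with $\sum_{\mathbf{j}:\|\mathbf{j}-\mathbf{i}\|\le r}\partial_{\mathbf{i}}S_{\mathbf{j}}(u)=0$ for all $\mathbf{i}\in\mathbb{Z}^n$. Inequalities $<,\le$ between functions are pointwise at every point of $\mathbb{Z}^n$. Let $c_0$ be the infimum of $S_{\mathbf{0}}$ over the constant functions on $\mathbb{Z}^n$ and $\mathcal{M}_0$ the set of constant functions $u$ with $S_{\mathbf{0}}(u)=c_0$. Assume there are $v_0,w_0\in\mathcal{M}_0$ with $v_0<w_0$ that are adjacent, i.e. there is no $u\in\mathcal{M}_0$ with $v_0<u<w_0$; fix such $v_0,w_0$. Let $\Gamma_1(v_0,w_0)$ be the set of $u:\mathbb{Z}^n\to\mathbb{R}$ that depend only on $\mathbf{i}_1$, satisfy $v_0\le u\le w_0$, and satisfy $|(u-v_0)(i\mathbf{e}_1)|\to0$ as $i\to-\infty$, $|(u-w_0)(i\mathbf{e}_1)|\to 0$ as $i\to\infty$. For such $u$ let $J_1(u)=\liminf_{m\to-\infty,\,l\to\infty}\sum_{i=m}^{l}[S_{i\mathbf{e}_1}(u)-c_0]$,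 $c_1=\inf_{\Gamma_1(v_0,w_0)}J_1$, and $\mathcal{M}_1(v_0,w_0)=\{u\in\Gamma_1(v_0,w_0):J_1(u)=c_1\}$ (this is known to be a nonempty set, totally ordered by $<$, consisting of solutions of $(E)$). Assume there are $v_1,w_1\in\mathcal{M}_1(v_0,w_0)$ with $v_1<w_1$ that are adjacent, i.e. no $u\in\mathcal{M}_1(v_0,w_0)$ satisfies $v_1<u<w_1$; fix such $v_1,w_1$. For $\mathbf{q}=(\mathbf{q}_2,\dots,\mathbf{q}_n)\in\mathbb{N}^{n-1}$ let $\mathbb{T}_1^{\mathbf{q}}=\prod_{j=2}^n\{0,\dots,\mathbf{q}_j-1\}$ (for $n=1$, $\mathbf{q}$ is empty and $\mathbb{Z}\times\mathbb{T}_1^{\mathbf{q}}=\mathbb{Z}$). Let $\Gamma_1^{\mathbf{q}}(v_0,w_0)$ be the set of $u:\mathbb{Z}^n\to\mathbb{R}$, $\mathbf{q}_j$-periodic in $\mathbf{i}_j$ for $2\le j\le n$, with $v_0\le u\le w_0$, $\sum_{\mathbf{j}\in\{i\}\times\mathbb{T}_1^{\mathbf{q}}}|(u-v_0)(\mathbf{j})|\to0$ as $i\to-\infty$ and $\sum_{\mathbf{j}\in\{i\}\times\mathbb{T}_1^{\mathbf{q}}}|(u-w_0)(\mathbf{j})|\to0$ as $i\to\infty$. Put $J_1^{\mathbf{q}}(u)=\liminf_{m\to-\infty,\,l\to\infty}\sum_{i=m}^{l}\sum_{\mathbf{j}\in\{i\}\times\mathbb{T}_1^{\mathbf{q}}}[S_{\mathbf{j}}(u)-c_0]$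 and $c_1^{\mathbf{q}}=\inf_{\Gamma_1^{\mathbf{q}}(v_0,w_0)}J_1^{\mathbf{q}}$. Let $\Lambda_1^{\mathbf{q}}$ be the Banach space of $u:\mathbb{Z}^n\to\mathbb{R}$, $\mathbf{q}_j$-periodic in $\mathbf{i}_j$ for $2\le j\le n$, with $\|u\|_{\Lambda_1^{\mathbf{q}}}=\sum_{\mathbf{j}\in\mathbb{Z}\times\mathbb{T}_1^{\mathbf{q}}}|u(\mathbf{j})|+\big(\sum_{\mathbf{j}\in\mathbb{Z}\times\mathbb{T}_1^{\mathbf{q}}}|u(\mathbf{j})|^2\big)^{1/2}<\infty$. For $u\in\Lambda_1^{\mathbf{q}}$ put $I_1^{\mathbf{q}}(u)=\liminf_{m\to-\infty,\,l\to\infty}\sum_{i=m}^{l}\sum_{\mathbf{j}\in\{i\}\times\mathbb{T}_1^{\mathbf{q}}}[S_{\mathbf{j}}(u+v_1)-c_0]$; it is a $C^1$ real-valued functional on $\Lambda_1^{\mathbf{q}}$, with Fréchet derivative $(I_1^{\mathbf{q}})'$. Let $\mathcal{G}_1^{\mathbf{q}}=\{u\in\Lambda_1^{\mathbf{q}}:0\le u\le w_1-v_1\}$, $\mathcal{H}_1^{\mathbf{q}}=\{h\in C([0,1],\mathcal{G}_1^{\mathbf{q}}):h(0)=0,\ h(1)=w_1-v_1\}$ and $d_1^{\mathbf{q}}=\inf_{h\in\mathcal{H}_1^{\mathbf{q}}}\max_{\theta\in[0,1]}I_1^{\mathbf{q}}(h(\theta))$. *)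

theory Defs
  imports "HOL-Analysis.Analysis"
begin

text \<open>
  The lattice is \<open>int ^ 'n\<close>, with dimension \<open>CARD('n)\<close> (arbitrary, at least 1).  The first
  coordinate is an arbitrary index \<open>\<iota> :: 'n\<close>; the remaining coordinates are all \<open>k \<noteq> \<iota>\<close>.
  The space of real functions on a finite set \<open>A\<close> of lattice points is \<open>A \<rightarrow>\<^sub>E UNIV\<close>, so
  nothing is required of \<open>s\<close> outside that carrier.
\<close>

type_synonym 'n lattice = "(int, 'n) vec"

definition l1norm :: "'n::finite lattice \<Rightarrow> int" where
  "l1norm i = (\<Sum>k\<in>UNIV. \<bar>i $ k\<bar>)"

definition B :: "nat \<Rightarrow> 'n::finite lattice set" where
  "B r = {k. l1norm k \<le> int r}"

abbreviation RB :: "nat \<Rightarrow> ('n::finite lattice \<Rightarrow> real) set" where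
  "RB r \<equiv> B r \<rightarrow>\<^sub>E UNIV"

text \<open>The order \<open><\<close> on functions in HOL means \<open>\<le>\<close> and \<open>\<noteq>\<close>; here strictness is required at every point.\<close>

definition pt_less :: "('a \<Rightarrow> real) \<Rightarrow> ('a \<Rightarrow> real) \<Rightarrow> bool" (infix "\<lless>" 50) where
  "u \<lless> v \<longleftrightarrow> (\<forall>i. u i < v i)"

definition adjacent :: "('a \<Rightarrow> real) set \<Rightarrow> ('a \<Rightarrow> real) \<Rightarrow> ('a \<Rightarrow> real) \<Rightarrow> bool" where
  "adjacent M v w \<longleftrightarrow> v \<in> M \<and> w \<in> M \<and> v \<lless> w \<and> \<not> (\<exists>u\<in>M. v \<lless> u \<and> u \<lless> w)"


subsection \<open>Partial derivatives and the class of potentials\<close>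

definition pderiv_at :: "'a \<Rightarrow> (('a \<Rightarrow> real) \<Rightarrow> real) \<Rightarrow> ('a \<Rightarrow> real) \<Rightarrow> real" where
  "pderiv_at k f u = deriv (\<lambda>t. f (u(k := t))) (u k)"

definition C1_RA :: "'a set \<Rightarrow> (('a \<Rightarrow> real) \<Rightarrow> real) \<Rightarrow> bool" where
  "C1_RA A f \<longleftrightarrow> (\<forall>k\<in>A.
     (\<forall>u \<in> A \<rightarrow>\<^sub>E UNIV. (\<lambda>t. f (u(k := t))) field_differentiable at (u k)) \<and>
     continuous_on (A \<rightarrow>\<^sub>E UNIV) (pderiv_at k f))"

definition C2_RA :: "'a set \<Rightarrow> (('a \<Rightarrow> real) \<Rightarrow> real) \<Rightarrow> bool" where
  "C2_RA A f \<longleftrightarrow> C1_RA A f \<and> (\<forall>k\<in>A. C1_RA A (pderiv_at k f))"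

definition S1 :: "nat \<Rightarrow> (('n::finite lattice \<Rightarrow> real) \<Rightarrow> real) \<Rightarrow> bool" where
  "S1 r s \<longleftrightarrow> (\<forall>u \<in> RB r. s (\<lambda>k\<in>B r. u k + 1) = s u)"

definition S2 :: "nat \<Rightarrow> (('n::finite lattice \<Rightarrow> real) \<Rightarrow> real) \<Rightarrow> bool" where
  "S2 r s \<longleftrightarrow> bdd_below (s ` RB r) \<and>
     (\<forall>k\<in>B r. \<forall>j\<in>B r. l1norm (k - j) = 1 \<longrightarrow>
        filterlim s at_top (inf (filtercomap (\<lambda>u. \<bar>u k - u j\<bar>) at_top) (principal (RB r))))"

definition S3 :: "nat \<Rightarrow> (('n::finite lattice \<Rightarrow> real) \<Rightarrow> real) \<Rightarrow> bool" where
  "S3 r s \<longleftrightarrow>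
     (\<forall>k\<in>B r. \<forall>j\<in>B r. k \<noteq> j \<longrightarrow> (\<forall>u \<in> RB r. pderiv_at k (pderiv_at j s) u \<le> 0)) \<and>
     (\<forall>j. l1norm j = 1 \<longrightarrow> (\<forall>u \<in> RB r. pderiv_at 0 (pderiv_at j s) u < 0))"

definition S4 :: "nat \<Rightarrow> (('n::finite lattice \<Rightarrow> real) \<Rightarrow> real) \<Rightarrow> bool" where
  "S4 r s \<longleftrightarrow>
     (\<exists>C. \<forall>i\<in>B r. \<forall>k\<in>B r. \<forall>u \<in> RB r. \<bar>pderiv_at i (pderiv_at k s) u\<bar> \<le> C)"


subsection \<open>Local energies and the equation (E)\<close>

definition S :: "nat \<Rightarrow> (('n::finite lattice \<Rightarrow> real) \<Rightarrow> real) \<Rightarrow> 'n lattice \<Rightarrow> ('n lattice \<Rightarrow> real) \<Rightarrow> real" where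
  "S r s j u = s (\<lambda>k\<in>B r. u (j + k))"

definition solution :: "nat \<Rightarrow> (('n::finite lattice \<Rightarrow> real) \<Rightarrow> real) \<Rightarrow> ('n lattice \<Rightarrow> real) \<Rightarrow> bool" where
  "solution r s u \<longleftrightarrow> (\<forall>i. (\<Sum>j | l1norm (j - i) \<le> int r. pderiv_at i (S r s j) u) = 0)"


subsection \<open>Constant minimizers\<close>

definition constants :: "('n::finite lattice \<Rightarrow> real) set" where
  "constants = {u. \<exists>x. u = (\<lambda>_. x)}"

definition c0 :: "nat \<Rightarrow> (('n::finite lattice \<Rightarrow> real) \<Rightarrow> real) \<Rightarrow> real" where
  "c0 r s = (INF u\<in>constants. S r s 0 u)"

definition M0 :: "nat \<Rightarrow> (('n::finite lattice \<Rightarrow> real) \<Rightarrow> real) \<Rightarrow> ('n lattice \<Rightarrow> real) set" where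
  "M0 r s = {u \<in> constants. S r s 0 u = c0 r s}"


subsection \<open>Heteroclinics depending on the first coordinate only\<close>

definition Gamma1 :: "'n::finite \<Rightarrow> ('n lattice \<Rightarrow> real) \<Rightarrow> ('n lattice \<Rightarrow> real) \<Rightarrow> ('n lattice \<Rightarrow> real) set" where
  "Gamma1 \<iota> v0 w0 = {u.
     (\<forall>i j. i $ \<iota> = j $ \<iota> \<longrightarrow> u i = u j) \<and> v0 \<le> u \<and> u \<le> w0 \<and>
     ((\<lambda>i. \<bar>u (axis \<iota> i) - v0 (axis \<iota> i)\<bar>) \<longlongrightarrow> 0) at_bot \<and>
     ((\<lambda>i. \<bar>u (axis \<iota> i) - w0 (axis \<iota> i)\<bar>) \<longlongrightarrow> 0) at_top}"

definition J1 :: "nat \<Rightarrow> (('n::finite lattice \<Rightarrow> real) \<Rightarrow> real) \<Rightarrow> 'n \<Rightarrow> ('n lattice \<Rightarrow> real) \<Rightarrow> ereal" where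
  "J1 r s \<iota> u = Liminf (at_bot \<times>\<^sub>F at_top)
     (\<lambda>(m, l). ereal (\<Sum>i=m..l. S r s (axis \<iota> i) u - c0 r s))"

definition c1 :: "nat \<Rightarrow> (('n::finite lattice \<Rightarrow> real) \<Rightarrow> real) \<Rightarrow> 'n \<Rightarrow>
    ('n lattice \<Rightarrow> real) \<Rightarrow> ('n lattice \<Rightarrow> real) \<Rightarrow> ereal" where
  "c1 r s \<iota> v0 w0 = (INF u \<in> Gamma1 \<iota> v0 w0. J1 r s \<iota> u)"

definition M1 :: "nat \<Rightarrow> (('n::finite lattice \<Rightarrow> real) \<Rightarrow> real) \<Rightarrow> 'n \<Rightarrow>
    ('n lattice \<Rightarrow> real) \<Rightarrow> ('n lattice \<Rightarrow> real) \<Rightarrow> ('n lattice \<Rightarrow> real) set" where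
  "M1 r s \<iota> v0 w0 = {u \<in> Gamma1 \<iota> v0 w0. J1 r s \<iota> u = c1 r s \<iota> v0 w0}"


subsection \<open>Periodic heteroclinics\<close>

text \<open>Periods are given by \<open>q :: 'n \<Rightarrow> nat\<close>; the value \<open>q \<iota>\<close> is never used.\<close>

definition cylinder :: "'n::finite \<Rightarrow> ('n \<Rightarrow> nat) \<Rightarrow> 'n lattice set" where
  "cylinder \<iota> q = {j. \<forall>k. k \<noteq> \<iota> \<longrightarrow> 0 \<le> j $ k \<and> j $ k < int (q k)}"

definition slice :: "'n::finite \<Rightarrow> ('n \<Rightarrow> nat) \<Rightarrow> int \<Rightarrow> 'n lattice set" where
  "slice \<iota> q i = {j \<in> cylinder \<iota> q. j $ \<iota> = i}"

definition periodic :: "'n::finite \<Rightarrow> ('n \<Rightarrow> nat) \<Rightarrow> ('n lattice \<Rightarrow> real) \<Rightarrow> bool" where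
  "periodic \<iota> q u \<longleftrightarrow> (\<forall>k. k \<noteq> \<iota> \<longrightarrow> (\<forall>i. u (i + axis k (int (q k))) = u i))"

definition Gamma1q :: "'n::finite \<Rightarrow> ('n \<Rightarrow> nat) \<Rightarrow>
    ('n lattice \<Rightarrow> real) \<Rightarrow> ('n lattice \<Rightarrow> real) \<Rightarrow> ('n lattice \<Rightarrow> real) set" where
  "Gamma1q \<iota> q v0 w0 = {u.
     periodic \<iota> q u \<and> v0 \<le> u \<and> u \<le> w0 \<and>
     ((\<lambda>i. \<Sum>j\<in>slice \<iota> q i. \<bar>u j - v0 j\<bar>) \<longlongrightarrow> 0) at_bot \<and>
     ((\<lambda>i. \<Sum>j\<in>slice \<iota> q i. \<bar>u j - w0 j\<bar>) \<longlongrightarrow> 0) at_top}"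

definition J1q :: "nat \<Rightarrow> (('n::finite lattice \<Rightarrow> real) \<Rightarrow> real) \<Rightarrow> 'n \<Rightarrow> ('n \<Rightarrow> nat) \<Rightarrow>
    ('n lattice \<Rightarrow> real) \<Rightarrow> ereal" where
  "J1q r s \<iota> q u = Liminf (at_bot \<times>\<^sub>F at_top)
     (\<lambda>(m, l). ereal (\<Sum>i=m..l. \<Sum>j\<in>slice \<iota> q i. S r s j u - c0 r s))"

definition c1q :: "nat \<Rightarrow> (('n::finite lattice \<Rightarrow> real) \<Rightarrow> real) \<Rightarrow> 'n \<Rightarrow> ('n \<Rightarrow> nat) \<Rightarrow>
    ('n lattice \<Rightarrow> real) \<Rightarrow> ('n lattice \<Rightarrow> real) \<Rightarrow> ereal" where
  "c1q r s \<iota> q v0 w0 = (INF u \<in> Gamma1q \<iota> q v0 w0. J1q r s \<iota> q u)"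


subsection \<open>The space \<open>\<Lambda>\<close>, the functional, and its mountain pass level\<close>

definition Lambda1q :: "'n::finite \<Rightarrow> ('n \<Rightarrow> nat) \<Rightarrow> ('n lattice \<Rightarrow> real) set" where
  "Lambda1q \<iota> q = {u. periodic \<iota> q u \<and>
     (\<lambda>j. \<bar>u j\<bar>) summable_on cylinder \<iota> q \<and> (\<lambda>j. \<bar>u j\<bar>\<^sup>2) summable_on cylinder \<iota> q}"

definition norm1q :: "'n::finite \<Rightarrow> ('n \<Rightarrow> nat) \<Rightarrow> ('n lattice \<Rightarrow> real) \<Rightarrow> real" where
  "norm1q \<iota> q u =
     (\<Sum>\<^sub>\<infinity>j\<in>cylinder \<iota> q. \<bar>u j\<bar>) + sqrt (\<Sum>\<^sub>\<infinity>j\<in>cylinder \<iota> q. \<bar>u j\<bar>\<^sup>2)"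

definition I1q :: "nat \<Rightarrow> (('n::finite lattice \<Rightarrow> real) \<Rightarrow> real) \<Rightarrow> 'n \<Rightarrow> ('n \<Rightarrow> nat) \<Rightarrow>
    ('n lattice \<Rightarrow> real) \<Rightarrow> ('n lattice \<Rightarrow> real) \<Rightarrow> ereal" where
  "I1q r s \<iota> q v1 u = Liminf (at_bot \<times>\<^sub>F at_top)
     (\<lambda>(m, l). ereal (\<Sum>i=m..l. \<Sum>j\<in>slice \<iota> q i. S r s j (\<lambda>k. u k + v1 k) - c0 r s))"

text \<open>
  Frechet derivative at \<open>u\<close> of a functional \<open>F\<close> on a function space \<open>X\<close> with norm \<open>N\<close>.
  As \<open>F\<close> is extended-real valued, it is required to be finite near \<open>u\<close>.
\<close>

definition has_frechet_derivative :: "('a \<Rightarrow> real) set \<Rightarrow> (('a \<Rightarrow> real) \<Rightarrow> real) \<Rightarrow>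
    (('a \<Rightarrow> real) \<Rightarrow> ereal) \<Rightarrow> (('a \<Rightarrow> real) \<Rightarrow> real) \<Rightarrow> ('a \<Rightarrow> real) \<Rightarrow> bool" where
  "has_frechet_derivative X N F D u \<longleftrightarrow>
     (\<forall>h\<in>X. \<forall>g\<in>X. D (\<lambda>j. h j + g j) = D h + D g) \<and>
     (\<forall>c. \<forall>h\<in>X. D (\<lambda>j. c * h j) = c * D h) \<and>
     (\<exists>K. \<forall>h\<in>X. \<bar>D h\<bar> \<le> K * N h) \<and>
     (\<exists>\<delta>>0. \<forall>h\<in>X. N h < \<delta> \<longrightarrow> \<bar>F (\<lambda>j. u j + h j)\<bar> \<noteq> \<infinity>) \<and>
     (\<forall>\<epsilon>>0. \<exists>\<delta>>0. \<forall>h\<in>X. N h < \<delta> \<longrightarrow>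
        \<bar>real_of_ereal (F (\<lambda>j. u j + h j)) - real_of_ereal (F u) - D h\<bar> \<le> \<epsilon> * N h)"

definition G1q :: "'n::finite \<Rightarrow> ('n \<Rightarrow> nat) \<Rightarrow> ('n lattice \<Rightarrow> real) \<Rightarrow> ('n lattice \<Rightarrow> real) \<Rightarrow>
    ('n lattice \<Rightarrow> real) set" where
  "G1q \<iota> q v1 w1 = {u \<in> Lambda1q \<iota> q. \<forall>j. 0 \<le> u j \<and> u j \<le> w1 j - v1 j}"

definition H1q :: "'n::finite \<Rightarrow> ('n \<Rightarrow> nat) \<Rightarrow> ('n lattice \<Rightarrow> real) \<Rightarrow> ('n lattice \<Rightarrow> real) \<Rightarrow>
    (real \<Rightarrow> 'n lattice \<Rightarrow> real) set" where
  "H1q \<iota> q v1 w1 = {h.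
     (\<forall>\<theta>\<in>{0..1}. h \<theta> \<in> G1q \<iota> q v1 w1) \<and>
     (\<forall>\<theta>\<in>{0..1}. ((\<lambda>t. norm1q \<iota> q (\<lambda>j. h t j - h \<theta> j)) \<longlongrightarrow> 0) (at \<theta> within {0..1})) \<and>
     h 0 = (\<lambda>_. 0) \<and> h 1 = (\<lambda>j. w1 j - v1 j)}"

definition d1q :: "nat \<Rightarrow> (('n::finite lattice \<Rightarrow> real) \<Rightarrow> real) \<Rightarrow> 'n \<Rightarrow> ('n \<Rightarrow> nat) \<Rightarrow>
    ('n lattice \<Rightarrow> real) \<Rightarrow> ('n lattice \<Rightarrow> real) \<Rightarrow> ereal" where
  "d1q r s \<iota> q v1 w1 = (INF h \<in> H1q \<iota> q v1 w1. SUP \<theta>\<in>{0..1}. I1q r s \<iota> q v1 (h \<theta>))"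

end

theory Submission
  imports Defs
begin

text \<open>
  The proof is a mountain pass argument on the order interval \<open>G1q\<close> between the two chains, in which
  a single explicit map replaces the gradient flow and compactness comes for free.

  Condition \<open>S3\<close> says that the formal gradient \<open>grad u i\<close> of the total energy is nonincreasing in
  the values of \<open>u\<close> away from \<open>i\<close>, and \<open>S4\<close> bounds its growth in the value at \<open>i\<close>.  Hence for small
  \<open>\<eta>\<close> the descent step \<open>u \<mapsto> u - \<eta> * grad u\<close> preserves the pointwise order (\<open>step_mono\<close>).  Its fixed
  points are the solutions of the equation, and it lowers the energy by at least a multiple of the
  squared length of the step (\<open>descent\<close>).  Two further consequences of \<open>S3\<close> are used throughout:
  ordered solutions that touch coincide (\<open>strong_maximum\<close>), and the energy is submodular, so that
  the maximum and minimum of two minimizers are minimizers (\<open>s_submodular\<close>).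

  For functions of the first coordinate only, submodularity allows the windows of a periodic chain
  to be sorted into constants, so that no periodic chain has smaller mean energy than \<open>c0\<close>
  (\<open>periodic_energy\<close>).  By cutting and periodic repetition the partial sums in the definition of
  \<open>J1\<close> are bounded below, and for minimal chains they converge (\<open>cut_energy\<close>, \<open>E_tendsto\<close>).
  It follows that minimal chains are solutions and that they are totally ordered together with their
  translates (\<open>minimal_solution\<close>, \<open>minimal_ordered\<close>).  In particular \<open>w1\<close> lies below the translate of
  \<open>v1\<close> by one, so the gap \<open>w1 - v1\<close> is summable by telescoping (\<open>D_Lambda\<close>).

  Therefore \<open>G1q\<close> is an order interval with summable width.  It is compact for pointwise convergence,
  and the energy \<open>F\<close> relative to \<open>v1\<close> is continuous there (\<open>compact_G\<close>, \<open>continuous_F\<close>).  The step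
  maps \<open>G1q\<close> into itself, because \<open>v1\<close> and \<open>w1\<close> are solutions.  A minimizer of \<open>F\<close> is a fixed point
  of the step; comparison with its transversal translates shows that it depends on the first
  coordinate only, and adjacency leaves only the two ends of the interval (\<open>ground_states\<close>).  A path
  from one end to the other takes half the value of the gap at the origin, where \<open>F\<close> is bounded
  away from \<open>0\<close> by compactness; so \<open>d1q\<close> exceeds the energy of the ends, hence also \<open>c1q\<close>
  (\<open>d_bounds\<close>, \<open>c1q_le\<close>).  Finally the step turns a nearly optimal path into an admissible path, which
  still reaches the level \<open>d1q\<close> nearly.  Where it does, the step has hardly lowered the energy, and
  compactness yields a point of energy \<open>d1q\<close> fixed by the step (\<open>critical_point_exists\<close>).  It is
  neither end, so it lies strictly between them by the strong maximum principle.
\<close>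

section \<open>Coordinatewise calculus on functions over a finite set\<close>

lemma mvt_between:
  fixes g g' :: "real \<Rightarrow> real"
  assumes "\<And>t. (g has_real_derivative g' t) (at t)"
  shows "\<exists>t. min a b \<le> t \<and> t \<le> max a b \<and> g b - g a = g' t * (b - a)"
proof (cases a b rule: linorder_cases)
  case less
  from MVT2[OF less, of g g'] assms obtain z where "a < z" "z < b" "g b - g a = (b - a) * g' z"
    by auto
  then show ?thesis using less by (intro exI[of _ z]) auto
next
  case greater
  from MVT2[OF greater, of g g'] assms obtain z where "b < z" "z < a" "g a - g b = (a - b) * g' z"
    by auto
  then show ?thesis using greater by (intro exI[of _ z]) (auto simp: algebra_simps)
qed auto

lemma C1_RA_deriv:
  assumes "C1_RA A f" "k \<in> A" "x \<in> A \<rightarrow>\<^sub>E UNIV"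
  shows "((\<lambda>t. f (x(k := t))) has_real_derivative pderiv_at k f (x(k := t0))) (at t0)"
proof -
  have "x(k := t0) \<in> A \<rightarrow>\<^sub>E UNIV" using assms by (auto simp: PiE_iff extensional_def)
  with assms have "(\<lambda>t. f ((x(k := t0))(k := t))) field_differentiable at ((x(k := t0)) k)"
    unfolding C1_RA_def by blast
  then have "(\<lambda>t. f (x(k := t))) field_differentiable at t0" by simp
  then show ?thesis by (simp add: pderiv_at_def field_differentiable_derivI)
qed

text \<open>
  Walking from \<open>x\<close> to \<open>y\<close> one coordinate at a time turns partial differentiability alone into a
  mean value formula, with a separate intermediate point for every coordinate.  All estimates on
  the potential below are read off from it.
\<close>

lemma C1_RA_mvt:
  fixes f :: "('a \<Rightarrow> real) \<Rightarrow> real"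
  assumes f: "C1_RA A f" and fin: "finite A" and x: "x \<in> A \<rightarrow>\<^sub>E UNIV" and y: "y \<in> A \<rightarrow>\<^sub>E UNIV"
  shows "\<exists>\<xi>. (\<forall>k\<in>A. \<xi> k \<in> A \<rightarrow>\<^sub>E UNIV \<and> (\<forall>i. min (x i) (y i) \<le> \<xi> k i \<and> \<xi> k i \<le> max (x i) (y i))) \<and>
    f y - f x = (\<Sum>k\<in>A. pderiv_at k f (\<xi> k) * (y k - x k))"
proof -
  have walk: "\<exists>\<xi>. (\<forall>k\<in>F. \<xi> k \<in> A \<rightarrow>\<^sub>E UNIV \<and>
        (\<forall>i. min (x i) (y i) \<le> \<xi> k i \<and> \<xi> k i \<le> max (x i) (y i))) \<and>
      f (override_on x y F) - f x = (\<Sum>k\<in>F. pderiv_at k f (\<xi> k) * (y k - x k))"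
    if "F \<subseteq> A" for F
    using finite_subset[OF that fin] that
  proof (induction F rule: finite_induct)
    case empty
    show ?case by (simp add: override_on_def)
  next
    case (insert k F)
    then obtain \<xi> where \<xi>: "\<forall>k\<in>F. \<xi> k \<in> A \<rightarrow>\<^sub>E UNIV \<and>
        (\<forall>i. min (x i) (y i) \<le> \<xi> k i \<and> \<xi> k i \<le> max (x i) (y i))"
      and sum: "f (override_on x y F) - f x = (\<Sum>k\<in>F. pderiv_at k f (\<xi> k) * (y k - x k))"
      by auto
    let ?z = "override_on x y F"
    have z: "?z \<in> A \<rightarrow>\<^sub>E UNIV" using x y by (auto simp: PiE_iff extensional_def override_on_def)
    have kA: "k \<in> A" using insert by auto
    have zx: "?z(k := x k) = ?z" using insert by (auto simp: override_on_def)
    have zy: "?z(k := y k) = override_on x y (insert k F)"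
      by (auto simp: override_on_def fun_eq_iff)
    obtain t where t: "min (x k) (y k) \<le> t" "t \<le> max (x k) (y k)"
      and ft: "f (?z(k := y k)) - f (?z(k := x k)) = pderiv_at k f (?z(k := t)) * (y k - x k)"
      using mvt_between[OF C1_RA_deriv[OF f kA z], of "x k" "y k"] by auto
    define \<xi>' where "\<xi>' = \<xi>(k := ?z(k := t))"
    have "f (override_on x y (insert k F)) - f x =
        pderiv_at k f (\<xi>' k) * (y k - x k) + (\<Sum>j\<in>F. pderiv_at j f (\<xi> j) * (y j - x j))"
      using ft sum zx zy by (simp add: \<xi>'_def)
    also have "(\<Sum>j\<in>F. pderiv_at j f (\<xi> j) * (y j - x j)) =
        (\<Sum>j\<in>F. pderiv_at j f (\<xi>' j) * (y j - x j))"
      using insert by (intro sum.cong) (auto simp: \<xi>'_def)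
    finally have "f (override_on x y (insert k F)) - f x =
        (\<Sum>j\<in>insert k F. pderiv_at j f (\<xi>' j) * (y j - x j))"
      using insert by simp
    moreover have "?z(k := t) \<in> A \<rightarrow>\<^sub>E UNIV" using z kA by (auto simp: PiE_iff extensional_def)
    then have "\<forall>j\<in>insert k F. \<xi>' j \<in> A \<rightarrow>\<^sub>E UNIV \<and>
        (\<forall>i. min (x i) (y i) \<le> \<xi>' j i \<and> \<xi>' j i \<le> max (x i) (y i))"
      using \<xi> t by (auto simp: \<xi>'_def override_on_def)
    ultimately show ?case by blast
  qed
  have "override_on x y A = y"
    using x y by (auto simp: override_on_def fun_eq_iff PiE_iff extensional_def)
  then show ?thesis using walk[OF order_refl] by simp
qed


section \<open>The lattice ball\<close>

lemma l1norm_zero [simp]: "l1norm 0 = 0"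
  by (simp add: l1norm_def)

lemma l1norm_minus [simp]: "l1norm (- i) = l1norm i"
  by (simp add: l1norm_def)

lemma component_le_l1norm: "\<bar>i $ k\<bar> \<le> l1norm i"
  unfolding l1norm_def by (rule member_le_sum) auto

lemma l1norm_axis [simp]: "l1norm (axis k a) = \<bar>a\<bar>"
proof -
  have "l1norm (axis k a) = (\<Sum>i\<in>UNIV. if i = k then \<bar>a\<bar> else 0)"
    unfolding l1norm_def by (rule sum.cong) (auto simp: axis_def)
  then show ?thesis by simp
qed

lemma finite_B [simp]: "finite (B r :: 'n::finite lattice set)"
proof -
  have "B r \<subseteq> vec_lambda ` (Pi\<^sub>E (UNIV :: 'n set) (\<lambda>_. {- int r..int r}))"
  proof
    fix k :: "'n lattice" assume "k \<in> B r"
    then have "\<bar>k $ i\<bar> \<le> int r" for i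
      using component_le_l1norm[of k i] by (simp add: B_def)
    then have "(\<lambda>i. k $ i) \<in> Pi\<^sub>E UNIV (\<lambda>_. {- int r..int r})"
      by (auto simp: abs_le_iff) (metis minus_le_iff)
    then show "k \<in> vec_lambda ` (Pi\<^sub>E (UNIV :: 'n set) (\<lambda>_. {- int r..int r}))"
      by (metis image_eqI vec_nth_inverse)
  qed
  then show ?thesis by (rule finite_subset) (intro finite_imageI finite_PiE, auto)
qed

lemma zero_in_B [simp]: "0 \<in> B r"
  by (simp add: B_def)

lemma card_B_ge_1: "1 \<le> card (B r :: 'n::finite lattice set)"
proof -
  have "(B r :: 'n lattice set) \<noteq> {}" using zero_in_B by blast
  then show ?thesis by (simp add: Suc_le_eq card_gt_0_iff)
qed

lemma lattice_connected:
  fixes P :: "'n::finite lattice \<Rightarrow> bool"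
  assumes "P a" and step: "\<And>i e. P i \<Longrightarrow> l1norm e = 1 \<Longrightarrow> P (i + e)"
  shows "P b"
proof (induction "nat (l1norm (b - a))" arbitrary: b rule: less_induct)
  case less
  show ?case
  proof (cases "b = a")
    case False
    then obtain k where k: "(b - a) $ k \<noteq> 0" by (metis eq_iff_diff_eq_0 vec_eq_iff zero_index)
    define e where "e = axis k (sgn ((b - a) $ k))"
    have e: "l1norm e = 1" using k by (simp add: e_def abs_sgn_eq)
    have "l1norm (b - e - a) = (\<Sum>i\<in>UNIV. \<bar>(b - a) $ i\<bar> - (if i = k then 1 else 0))"
      unfolding l1norm_def using k
      by (intro sum.cong) (auto simp: e_def axis_def sgn_if)
    also have "\<dots> = l1norm (b - a) - 1" by (simp add: sum_subtractf l1norm_def)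
    finally have *: "l1norm (b - e - a) = l1norm (b - a) - 1" .
    have "l1norm (b - a) > 0" using component_le_l1norm[of "b - a" k] k by linarith
    then have "P (b - e)" using * by (intro less) linarith
    from step[OF this e] show ?thesis by simp
  qed (use assms in simp)
qed

section \<open>The potential\<close>

locale potential =
  fixes r :: nat and s :: "('n::finite lattice \<Rightarrow> real) \<Rightarrow> real" and C cB :: real
  assumes C2: "C2_RA (B r) s" and S3: "S3 r s"
    and hessian_bound: "\<And>i k x. i \<in> B r \<Longrightarrow> k \<in> B r \<Longrightarrow> x \<in> RB r \<Longrightarrow>
      \<bar>pderiv_at i (pderiv_at k s) x\<bar> \<le> C"
    and cB: "cB = real (card (B r :: 'n lattice set))"
begin

abbreviation ds :: "'n lattice \<Rightarrow> ('n lattice \<Rightarrow> real) \<Rightarrow> real" where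
  "ds k \<equiv> pderiv_at k s"

lemma cB_ge_1: "1 \<le> cB"
  using card_B_ge_1[of r, where 'n='n] by (simp add: cB)

lemma C_nonneg: "0 \<le> C"
proof -
  have "\<bar>pderiv_at 0 (ds 0) (\<lambda>k\<in>B r. 0)\<bar> \<le> C" by (rule hessian_bound) auto
  then show ?thesis by linarith
qed

lemma C1: "C1_RA (B r) s" and C1_ds: "k \<in> B r \<Longrightarrow> C1_RA (B r) (ds k)"
  using C2 by (auto simp: C2_RA_def)

lemma hessian_offdiag: "k \<in> B r \<Longrightarrow> j \<in> B r \<Longrightarrow> k \<noteq> j \<Longrightarrow> x \<in> RB r \<Longrightarrow> pderiv_at k (ds j) x \<le> 0"
  using S3 by (auto simp: S3_def)

lemma hessian_neighbour: "l1norm j = 1 \<Longrightarrow> x \<in> RB r \<Longrightarrow> pderiv_at 0 (ds j) x < 0"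
  using S3 by (auto simp: S3_def)

lemma ds_mvt:
  assumes j: "j \<in> B r" and x: "x \<in> RB r" and y: "y \<in> RB r"
  shows "\<exists>\<xi>. (\<forall>k\<in>B r. \<xi> k \<in> RB r) \<and>
    ds j y - ds j x = (\<Sum>k\<in>B r. pderiv_at k (ds j) (\<xi> k) * (y k - x k))"
  using C1_RA_mvt[OF C1_ds[OF j] finite_B x y] by (rule ex_forward) simp

lemma ds_lipschitz:
  assumes j: "j \<in> B r" and x: "x \<in> RB r" and y: "y \<in> RB r"
  shows "\<bar>ds j y - ds j x\<bar> \<le> C * (\<Sum>k\<in>B r. \<bar>y k - x k\<bar>)"
proof -
  obtain \<xi> where
    \<xi>: "\<And>k. k \<in> B r \<Longrightarrow> \<xi> k \<in> RB r"
    and eq: "ds j y - ds j x = (\<Sum>k\<in>B r. pderiv_at k (ds j) (\<xi> k) * (y k - x k))"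
    using ds_mvt[OF j x y] by auto
  have "\<bar>ds j y - ds j x\<bar> \<le> (\<Sum>k\<in>B r. \<bar>pderiv_at k (ds j) (\<xi> k) * (y k - x k)\<bar>)"
    unfolding eq by (rule sum_abs)
  also have "\<dots> \<le> (\<Sum>k\<in>B r. C * \<bar>y k - x k\<bar>)"
    unfolding abs_mult using hessian_bound \<xi> j by (intro sum_mono mult_right_mono) auto
  finally show ?thesis by (simp add: sum_distrib_left)
qed

lemma ds_increase_le:
  assumes j: "j \<in> B r" and x: "x \<in> RB r" and y: "y \<in> RB r" and le: "\<And>k. k \<in> B r \<Longrightarrow> x k \<le> y k"
  shows "ds j y - ds j x \<le> C * (y j - x j)"
proof -
  obtain \<xi> where
    \<xi>: "\<And>k. k \<in> B r \<Longrightarrow> \<xi> k \<in> RB r"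
    and eq: "ds j y - ds j x = (\<Sum>k\<in>B r. pderiv_at k (ds j) (\<xi> k) * (y k - x k))"
    using ds_mvt[OF j x y] by auto
  have "ds j y - ds j x \<le> (\<Sum>k\<in>(B r :: 'n lattice set). if k = j then C * (y j - x j) else 0)"
    unfolding eq
  proof (rule sum_mono)
    fix k :: "'n lattice" assume k: "k \<in> B r"
    show "pderiv_at k (ds j) (\<xi> k) * (y k - x k) \<le> (if k = j then C * (y j - x j) else 0)"
    proof (cases "k = j")
      case True
      have "pderiv_at j (ds j) (\<xi> k) \<le> C" using hessian_bound[OF j j \<xi>[OF k]] by linarith
      then show ?thesis using True le[OF k] by (simp add: mult_right_mono)
    next
      case False
      with hessian_offdiag[OF k j False \<xi>[OF k]] le[OF k] show ?thesis
        by (simp add: mult_nonpos_nonneg)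
    qed
  qed
  then show ?thesis using j by simp
qed

lemma ds_strict_decrease:
  assumes j: "j \<in> B r" "l1norm j = 1" and x: "x \<in> RB r" and y: "y \<in> RB r"
    and le: "\<And>k. k \<in> B r \<Longrightarrow> x k \<le> y k" and eqj: "x j = y j" and less: "x 0 < y 0"
  shows "ds j y < ds j x"
proof -
  obtain \<xi> where
    \<xi>: "\<And>k. k \<in> B r \<Longrightarrow> \<xi> k \<in> RB r"
    and eq: "ds j y - ds j x = (\<Sum>k\<in>B r. pderiv_at k (ds j) (\<xi> k) * (y k - x k))"
    using ds_mvt[OF j(1) x y] by auto
  have "(\<Sum>k\<in>B r. pderiv_at k (ds j) (\<xi> k) * (y k - x k)) < (\<Sum>k\<in>(B r :: 'n lattice set). 0)"
  proof (rule sum_strict_mono_ex1)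
    show "\<forall>k\<in>B r. pderiv_at k (ds j) (\<xi> k) * (y k - x k) \<le> 0"
    proof
      fix k :: "'n lattice" assume k: "k \<in> B r"
      show "pderiv_at k (ds j) (\<xi> k) * (y k - x k) \<le> 0"
      proof (cases "k = j")
        case False
        with hessian_offdiag[OF k j(1) False \<xi>[OF k]] le[OF k] show ?thesis
          by (simp add: mult_nonpos_nonneg)
      qed (use eqj in simp)
    qed
    have "pderiv_at 0 (ds j) (\<xi> 0) * (y 0 - x 0) < 0"
      using hessian_neighbour[OF j(2) \<xi>[OF zero_in_B]] less by (simp add: mult_neg_pos)
    then show "\<exists>k\<in>B r. pderiv_at k (ds j) (\<xi> k) * (y k - x k) < 0" using zero_in_B by blast
  qed simp
  then show ?thesis using eq by simp
qed

lemma s_second_order: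
  assumes x: "x \<in> RB r" and y: "y \<in> RB r"
  shows "\<bar>s y - s x - (\<Sum>k\<in>B r. ds k x * (y k - x k))\<bar> \<le> C * cB * (\<Sum>k\<in>B r. (y k - x k)\<^sup>2)"
proof -
  let ?N = "\<Sum>k\<in>B r. \<bar>y k - x k\<bar>"
  obtain \<xi> where \<xi>: "\<forall>k\<in>B r. \<xi> k \<in> RB r \<and>
      (\<forall>i. min (x i) (y i) \<le> \<xi> k i \<and> \<xi> k i \<le> max (x i) (y i))"
    and eq: "s y - s x = (\<Sum>k\<in>B r. ds k (\<xi> k) * (y k - x k))"
    using C1_RA_mvt[OF C1 finite_B x y] by (elim exE conjE)
  have "\<bar>s y - s x - (\<Sum>k\<in>B r. ds k x * (y k - x k))\<bar>
      = \<bar>\<Sum>k\<in>B r. (ds k (\<xi> k) - ds k x) * (y k - x k)\<bar>"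
    unfolding eq by (simp add: sum_subtractf left_diff_distrib)
  also have "\<dots> \<le> (\<Sum>k\<in>B r. \<bar>ds k (\<xi> k) - ds k x\<bar> * \<bar>y k - x k\<bar>)"
    using sum_abs[of "\<lambda>k. (ds k (\<xi> k) - ds k x) * (y k - x k)"] by (simp add: abs_mult)
  also have "\<dots> \<le> (\<Sum>k\<in>B r. (C * ?N) * \<bar>y k - x k\<bar>)"
  proof (intro sum_mono mult_right_mono)
    fix k :: "'n lattice" assume k: "k \<in> B r"
    have "\<bar>ds k (\<xi> k) - ds k x\<bar> \<le> C * (\<Sum>i\<in>B r. \<bar>\<xi> k i - x i\<bar>)"
      using \<xi> k by (intro ds_lipschitz x) auto
    also have "\<dots> \<le> C * ?N"
    proof (intro mult_left_mono sum_mono C_nonneg)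
      fix i :: "'n lattice"
      show "\<bar>\<xi> k i - x i\<bar> \<le> \<bar>y i - x i\<bar>" using bspec[OF \<xi> k, THEN conjunct2, rule_format, of i] by linarith
    qed
    finally show "\<bar>ds k (\<xi> k) - ds k x\<bar> \<le> C * ?N" .
  qed auto
  also have "\<dots> = C * (?N * ?N)" by (simp flip: sum_distrib_left)
  also have "?N * ?N \<le> cB * (\<Sum>k\<in>B r. (y k - x k)\<^sup>2)"
    using sum_squared_le_sum_of_squares[of "\<lambda>k. \<bar>y k - x k\<bar>" "B r"]
    by (simp add: power2_eq_square cB mult.commute)
  finally show ?thesis using C_nonneg by (simp add: mult_left_mono mult.assoc)
qed

lemma s_submodular:
  assumes x: "x \<in> RB r" and y: "y \<in> RB r"
  shows "s (\<lambda>k\<in>B r. max (x k) (y k)) + s (\<lambda>k\<in>B r. min (x k) (y k)) \<le> s x + s y"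
proof -
  define z where "z = (\<lambda>k\<in>B r. min (x k) (y k))"
  define D where "D = {k \<in> B r. y k < x k}"
  have zRB: "z \<in> RB r" by (simp add: z_def)
  \<comment> \<open>Raising the coordinates in \<open>D\<close> to the level of \<open>x\<close> costs less from \<open>y\<close> than from \<open>min x y\<close>,
    since the two points agree on \<open>D\<close> and \<open>ds k\<close> decreases in the other coordinates.\<close>
  have "s (override_on y x F) - s y \<le> s (override_on z x F) - s z" if "F \<subseteq> D" for F
    using finite_subset[OF that] that
  proof (induction F rule: infinite_finite_induct)
    case (insert k F)
    let ?y = "override_on y x F" and ?z = "override_on z x F"
    have k: "k \<in> B r" "y k < x k" "k \<notin> F" using insert by (auto simp: D_def)
    have RBy: "?y \<in> RB r" and RBz: "?z \<in> RB r"
      using x y zRB by (auto simp: PiE_iff extensional_def override_on_def)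
    let ?g = "\<lambda>t. s (?y(k := t)) - s (?z(k := t))"
    have "?g (x k) \<le> ?g (y k)"
    proof (rule DERIV_nonpos_imp_nonincreasing[of "y k" "x k"])
      fix t
      have RB': "?y(k := t) \<in> RB r" "?z(k := t) \<in> RB r"
        using RBy RBz k by (auto simp: PiE_iff extensional_def)
      have "(?g has_real_derivative ds k (?y(k := t)) - ds k (?z(k := t))) (at t)"
        by (intro DERIV_diff C1_RA_deriv[OF C1 k(1) RBy] C1_RA_deriv[OF C1 k(1) RBz])
      moreover have "ds k (?y(k := t)) - ds k (?z(k := t)) \<le> 0"
        using ds_increase_le[OF k(1) RB'(2,1)] by (auto simp: override_on_def z_def)
      ultimately show "\<exists>d. (?g has_real_derivative d) (at t) \<and> d \<le> 0" by blast
    qed (use k in simp)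
    moreover have "?y(k := x k) = override_on y x (insert k F)"
      "?z(k := x k) = override_on z x (insert k F)" "?y(k := y k) = ?y"
      "?z(k := y k) = ?z"
      using k by (auto simp: override_on_def fun_eq_iff z_def)
    ultimately show ?case using insert by auto
  qed (auto simp: D_def)
  from this[OF order_refl]
  have "s (override_on y x D) - s y \<le> s (override_on z x D) - s z" .
  moreover have "override_on y x D = (\<lambda>k\<in>B r. max (x k) (y k))"
    using x y by (auto simp: override_on_def fun_eq_iff D_def PiE_iff extensional_def)
  moreover have "override_on z x D = x"
    using x by (auto simp: override_on_def fun_eq_iff D_def z_def PiE_iff extensional_def)
  ultimately show ?thesis by (simp add: z_def)
qed


section \<open>The gradient, the monotone descent step and the strong maximum principle\<close>

definition win :: "'n lattice \<Rightarrow> ('n lattice \<Rightarrow> real) \<Rightarrow> 'n lattice \<Rightarrow> real" where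
  "win j u = (\<lambda>k\<in>B r. u (j + k))"

lemma win_RB [simp]: "win j u \<in> RB r"
  by (simp add: win_def)

lemma win_apply [simp]: "k \<in> B r \<Longrightarrow> win j u k = u (j + k)"
  by (simp add: win_def)

lemma S_eq: "S r s j u = s (win j u)"
  by (simp add: S_def win_def)

definition grad :: "('n lattice \<Rightarrow> real) \<Rightarrow> 'n lattice \<Rightarrow> real" where
  "grad u i = (\<Sum>k\<in>B r. ds k (win (i - k) u))"

lemma pderiv_S:
  assumes "i - j \<in> B r"
  shows "pderiv_at i (S r s j) u = ds (i - j) (win j u)"
proof -
  have "win j (u(i := t)) = (win j u)(i - j := t)" for t
    using assms by (auto simp: win_def fun_eq_iff algebra_simps)
  then show ?thesis using assms by (simp add: pderiv_at_def S_eq)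
qed

lemma solution_iff: "solution r s u \<longleftrightarrow> (\<forall>i. grad u i = 0)"
proof -
  have "(\<Sum>j | l1norm (j - i) \<le> int r. pderiv_at i (S r s j) u) = grad u i" for i
    unfolding grad_def
  proof (rule sum.reindex_bij_witness[of _ "\<lambda>k. i - k" "\<lambda>j. i - j"])
    fix j assume "j \<in> {j. l1norm (j - i) \<le> int r}"
    then show "i - j \<in> B r" using l1norm_minus[of "j - i"] by (simp add: B_def)
    then show "ds (i - j) (win (i - (i - j)) u) = pderiv_at i (S r s j) u"
      by (simp add: pderiv_S)
  qed (auto simp: B_def)
  then show ?thesis by (simp add: solution_def)
qed

lemma grad_increase_le:
  assumes "u \<le> v"
  shows "grad v i - grad u i \<le> C * cB * (v i - u i)"
proof -
  have "grad v i - grad u i = (\<Sum>k\<in>B r. ds k (win (i - k) v) - ds k (win (i - k) u))"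
    by (simp add: grad_def sum_subtractf)
  also have "\<dots> \<le> (\<Sum>k\<in>(B r :: 'n lattice set). C * (v i - u i))"
  proof (rule sum_mono)
    fix k :: "'n lattice" assume k: "k \<in> B r"
    have "ds k (win (i - k) v) - ds k (win (i - k) u) \<le>
        C * (win (i - k) v k - win (i - k) u k)"
      using assms by (intro ds_increase_le[OF k]) (auto simp: le_fun_def)
    then show "ds k (win (i - k) v) - ds k (win (i - k) u) \<le> C * (v i - u i)"
      using k by simp
  qed
  finally show ?thesis by (simp add: algebra_simps cB)
qed

text \<open>
  A fixed descent rate, small enough for both purposes of the step \<open>u \<mapsto> u - \<eta> * grad u\<close>: it is
  monotone because \<open>\<eta> * C * cB \<le> 1\<close>, and it lowers the energy because the second order remainder
  (with constant \<open>C * cB\<^sup>2\<close> after summation over the lattice) is absorbed.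
\<close>

definition \<eta> :: real where
  "\<eta> = 1 / (2 * (C * cB\<^sup>2 + 1))"

lemma eta_pos: "0 < \<eta>" and eta_C2: "\<eta> * (C * cB\<^sup>2) \<le> 1 / 2" and eta_C1: "\<eta> * (C * cB) \<le> 1"
proof -
  have *: "0 \<le> C * cB\<^sup>2" using C_nonneg by simp
  show pos: "0 < \<eta>" using * by (simp add: \<eta>_def)
  show le: "\<eta> * (C * cB\<^sup>2) \<le> 1 / 2" using * by (simp add: \<eta>_def divide_simps)
  have "C * cB \<le> C * cB\<^sup>2"
    using cB_ge_1 C_nonneg self_le_power[of cB 2] by (intro mult_left_mono) auto
  then have "\<eta> * (C * cB) \<le> \<eta> * (C * cB\<^sup>2)" using pos by simp
  with le show "\<eta> * (C * cB) \<le> 1" by linarith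
qed

lemma step_mono:
  assumes "u \<le> v"
  shows "u i - \<eta> * grad u i \<le> v i - \<eta> * grad v i"
proof -
  have "\<eta> * (grad v i - grad u i) \<le> \<eta> * (C * cB * (v i - u i))"
    using grad_increase_le[OF assms] eta_pos by (intro mult_left_mono) auto
  also have "\<dots> = (\<eta> * (C * cB)) * (v i - u i)" by (simp add: algebra_simps)
  also have "\<dots> \<le> 1 * (v i - u i)"
    using assms eta_C1 by (intro mult_right_mono) (auto simp: le_fun_def)
  finally show ?thesis by (simp add: algebra_simps)
qed

text \<open>
  If ordered solutions touch at \<open>i\<close>, every summand of \<open>grad v i - grad u i = 0\<close> is nonpositive, and
  the one that couples \<open>i\<close> to a neighbour is strictly negative unless they touch there as well.
\<close>

theorem strong_maximum:
  assumes r: "1 \<le> r" and le: "u \<le> v" and sol: "solution r s u" "solution r s v" and touch: "u a = v a"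
  shows "u = v"
proof
  fix b
  show "u b = v b"
  proof (rule lattice_connected[of "\<lambda>i. u i = v i" a b])
    fix i e :: "'n lattice" assume i: "u i = v i" and "l1norm e = 1"
    define d where "d = - e"
    have d: "l1norm d = 1" "d \<in> B r" using \<open>l1norm e = 1\<close> r by (auto simp: d_def B_def)
    have "u (i - d) = v (i - d)"
    proof (rule ccontr)
      assume "u (i - d) \<noteq> v (i - d)"
      then have less: "u (i - d) < v (i - d)" using le by (auto simp: le_fun_def less_le)
      have "grad v i < grad u i"
        unfolding grad_def
      proof (rule sum_strict_mono_ex1)
        show "\<forall>k\<in>B r. ds k (win (i - k) v) \<le> ds k (win (i - k) u)"
        proof
          fix k :: "'n lattice" assume k: "k \<in> B r"
          have "ds k (win (i - k) v) - ds k (win (i - k) u) \<le>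
              C * (win (i - k) v k - win (i - k) u k)"
            using le by (intro ds_increase_le[OF k]) (auto simp: le_fun_def)
          then show "ds k (win (i - k) v) \<le> ds k (win (i - k) u)" using k i by simp
        qed
        have "ds d (win (i - d) v) < ds d (win (i - d) u)"
          using le less i d by (intro ds_strict_decrease) (auto simp: le_fun_def)
        then show "\<exists>k\<in>B r. ds k (win (i - k) v) < ds k (win (i - k) u)" using d by blast
      qed simp
      then show False using sol by (simp add: solution_iff)
    qed
    then show "u (i + e) = v (i + e)" by (simp add: d_def)
  qed (rule touch)
qed

lemma S_submodular:
  "S r s j (\<lambda>i. max (u i) (v i)) + S r s j (\<lambda>i. min (u i) (v i)) \<le> S r s j u + S r s j v"
proof -
  have "win j (\<lambda>i. max (u i) (v i)) = (\<lambda>k\<in>B r. max (win j u k) (win j v k))"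
    "win j (\<lambda>i. min (u i) (v i)) = (\<lambda>k\<in>B r. min (win j u k) (win j v k))"
    by (auto simp: win_def fun_eq_iff)
  then show ?thesis unfolding S_eq using s_submodular[of "win j u" "win j v"] by simp
qed

lemma S_shift: "S r s j (\<lambda>i. u (i + c)) = S r s (j + c) u"
proof -
  have "win j (\<lambda>i. u (i + c)) = win (j + c) u" by (auto simp: win_def fun_eq_iff algebra_simps)
  then show ?thesis by (simp add: S_eq)
qed

end

section \<open>Summation over the periodic cylinder\<close>

locale strip =
  fixes \<iota> :: "'n::finite" and q :: "'n \<Rightarrow> nat"
  assumes q_pos: "k \<noteq> \<iota> \<Longrightarrow> 0 < q k"
begin

abbreviation cyl :: "'n lattice set" where
  "cyl \<equiv> cylinder \<iota> q"

definition wrap :: "'n set \<Rightarrow> 'n lattice \<Rightarrow> 'n lattice" where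
  "wrap A j = (\<chi> k. if k \<in> A then j $ k mod int (q k) else j $ k)"

lemma periodic_shift: "periodic \<iota> q f \<Longrightarrow> periodic \<iota> q (\<lambda>j. f (j + c))"
  by (auto simp: periodic_def add.assoc) (metis add.assoc add.commute)

lemma periodic_multiple:
  assumes f: "periodic \<iota> q f" and k: "k \<noteq> \<iota>"
  shows "f (i + axis k (c * int (q k))) = f i"
proof -
  have axis_add: "axis k (x + y) = axis k x + axis k y" for x y :: int
    by (simp add: vec_eq_iff axis_def)
  have nat: "f (i + axis k (int n * int (q k))) = f i" for n i
  proof (induction n)
    case 0
    have "axis k 0 = (0 :: 'n lattice)" by (simp add: vec_eq_iff axis_def)
    then have "i + axis k (int 0 * int (q k)) = i" by (metis add.right_neutral mult_zero_left of_nat_0)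
    then show ?case by metis
  next
    case (Suc n)
    have "f (i + axis k (int (Suc n) * int (q k)))
        = f ((i + axis k (int n * int (q k))) + axis k (int (q k)))"
      by (simp add: distrib_right axis_add add_ac)
    also have "\<dots> = f i" using f k Suc by (simp add: periodic_def)
    finally show ?case .
  qed
  show ?thesis
  proof (cases "0 \<le> c")
    case True
    then show ?thesis using nat[of i "nat c"] by simp
  next
    case False
    have "axis k (c * int (q k)) + axis k (- c * int (q k)) = (0 :: 'n lattice)"
      by (simp flip: axis_add)
    then show ?thesis
      using nat[of "i + axis k (c * int (q k))" "nat (- c)"] False by (simp add: add.assoc)
  qed
qed

lemma periodic_wrap:
  assumes f: "periodic \<iota> q f" and "\<iota> \<notin> A"
  shows "f (wrap A j) = f j"
proof -
  have "finite A" by simp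
  then show ?thesis using assms(2)
  proof (induction A rule: finite_induct)
    case empty
    have "wrap {} j = j" by (simp add: wrap_def vec_eq_iff)
    then show ?case by simp
  next
    case (insert k A)
    have "wrap (insert k A) j = wrap A j + axis k (- (j $ k div int (q k)) * int (q k))"
      using insert by (auto simp: wrap_def vec_eq_iff axis_def minus_div_mult_eq_mod [symmetric])
    then show ?case using periodic_multiple[OF f, of k "wrap A j" "- (j $ k div int (q k))"] insert by auto
  qed
qed

lemma wrap_in_cyl: "wrap (- {\<iota>}) j \<in> cyl"
  using q_pos by (auto simp: wrap_def cylinder_def)

lemma wrap_shift_bij: "bij_betw (\<lambda>j. wrap (- {\<iota>}) (j + c)) cyl cyl"
proof (rule bij_betw_byWitness[where f' = "\<lambda>j. wrap (- {\<iota>}) (j - c)"])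
  show "\<forall>j\<in>cyl. wrap (- {\<iota>}) (wrap (- {\<iota>}) (j + c) - c) = j"
    by (auto simp: wrap_def cylinder_def vec_eq_iff mod_diff_left_eq)
  show "\<forall>j\<in>cyl. wrap (- {\<iota>}) (wrap (- {\<iota>}) (j - c) + c) = j"
    by (auto simp: wrap_def cylinder_def vec_eq_iff mod_add_left_eq)
qed (auto intro: wrap_in_cyl)

text \<open>
  A translation followed by reduction modulo the periods permutes the cylinder, and the reduction is
  invisible to a periodic summand.
\<close>

lemma cyl_has_sum_shift:
  fixes f :: "'n lattice \<Rightarrow> real"
  assumes "periodic \<iota> q f"
  shows "((\<lambda>j. f (j + c)) has_sum x) cyl \<longleftrightarrow> (f has_sum x) cyl"
  using has_sum_reindex_bij_betw[OF wrap_shift_bij, of f c x] periodic_wrap[OF assms] by simp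

lemma cyl_summable_shift:
  fixes f :: "'n lattice \<Rightarrow> real"
  shows "periodic \<iota> q f \<Longrightarrow> (\<lambda>j. f (j + c)) summable_on cyl \<longleftrightarrow> f summable_on cyl"
  by (simp add: summable_on_def cyl_has_sum_shift)

lemma cyl_infsum_shift:
  fixes f :: "'n lattice \<Rightarrow> real"
  shows "periodic \<iota> q f \<Longrightarrow> (\<Sum>\<^sub>\<infinity>j\<in>cyl. f (j + c)) = (\<Sum>\<^sub>\<infinity>j\<in>cyl. f j)"
  by (metis cyl_has_sum_shift cyl_summable_shift has_sum_infsum infsumI infsum_not_exists)

lemma finite_slice [simp]: "finite (slice \<iota> q i)"
proof -
  have "slice \<iota> q i \<subseteq> vec_lambda ` (Pi\<^sub>E UNIV (\<lambda>k. if k = \<iota> then {i} else {0..<int (q k)}))"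
  proof
    fix j assume "j \<in> slice \<iota> q i"
    then have "(\<lambda>k. j $ k) \<in> Pi\<^sub>E UNIV (\<lambda>k. if k = \<iota> then {i} else {0..<int (q k)})"
      by (auto simp: slice_def cylinder_def)
    then show "j \<in> vec_lambda ` (Pi\<^sub>E UNIV (\<lambda>k. if k = \<iota> then {i} else {0..<int (q k)}))"
      using image_eqI[of j vec_lambda "\<lambda>k. j $ k"] by (simp add: vec_lambda_eta)
  qed
  then show ?thesis by (rule finite_subset) (intro finite_imageI finite_PiE, auto)
qed

lemma axis_in_slice: "axis \<iota> i \<in> slice \<iota> q i"
  using q_pos by (auto simp: slice_def cylinder_def axis_def)

lemma zero_in_cyl: "0 \<in> cyl"
  using q_pos by (auto simp: cylinder_def)

lemma card_slice: "card (slice \<iota> q i) = card (slice \<iota> q 0)"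
proof -
  have "bij_betw (\<lambda>j. j + axis \<iota> i) (slice \<iota> q 0) (slice \<iota> q i)"
    by (rule bij_betw_byWitness[where f' = "\<lambda>j. j - axis \<iota> i"])
      (auto simp: slice_def cylinder_def axis_def)
  then show ?thesis by (simp add: bij_betw_same_card)
qed

lemma card_slice_pos: "0 < card (slice \<iota> q i)"
  using axis_in_slice by (auto simp: card_gt_0_iff)

definition box :: "int \<times> int \<Rightarrow> 'n lattice set" where
  "box = (\<lambda>(m, l). {j \<in> cyl. m \<le> j $ \<iota> \<and> j $ \<iota> \<le> l})"

lemma box_eq: "box (m, l) = (\<Union>i\<in>{m..l}. slice \<iota> q i)"
  by (auto simp: box_def slice_def)

lemma sum_box: "sum f (box (m, l)) = (\<Sum>i=m..l. sum f (slice \<iota> q i))"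
  unfolding box_eq by (intro sum.UNION_disjoint ballI finite_slice finite_atLeastAtMost_int) (auto simp: slice_def)

lemma finite_box: "finite (box p)"
  by (cases p) (simp add: box_eq)

lemma filterlim_box: "filterlim box (finite_subsets_at_top cyl) (at_bot \<times>\<^sub>F at_top)"
  unfolding filterlim_finite_subsets_at_top
proof (intro allI impI, elim conjE)
  fix X assume X: "finite X" "X \<subseteq> cyl"
  have "eventually (\<lambda>m. \<forall>j\<in>X. m \<le> j $ \<iota>) at_bot" "eventually (\<lambda>l. \<forall>j\<in>X. j $ \<iota> \<le> l) at_top"
    using X by (auto simp: eventually_ball_finite_distrib eventually_le_at_bot eventually_ge_at_top)
  then have "eventually (\<lambda>p. (\<forall>j\<in>X. fst p \<le> j $ \<iota>) \<and> (\<forall>j\<in>X. j $ \<iota> \<le> snd p)) (at_bot \<times>\<^sub>F at_top)"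
    by (rule eventually_prodI)
  then show "\<forall>\<^sub>F p in at_bot \<times>\<^sub>F at_top. finite (box p) \<and> X \<subseteq> box p \<and> box p \<subseteq> cyl"
    by eventually_elim (use X finite_box in \<open>auto simp: box_def\<close>)
qed

lemma box_sums_tendsto:
  assumes "(f has_sum x) cyl"
  shows "((\<lambda>(m, l). \<Sum>i=m..l. sum f (slice \<iota> q i)) \<longlongrightarrow> x) (at_bot \<times>\<^sub>F at_top)"
proof -
  have "(sum f \<longlongrightarrow> x) (finite_subsets_at_top cyl)" using assms by (simp add: has_sum_def)
  from filterlim_compose[OF this filterlim_box]
  have "((\<lambda>p. sum f (box p)) \<longlongrightarrow> x) (at_bot \<times>\<^sub>F at_top)" .
  moreover have "(\<lambda>p. sum f (box p)) = (\<lambda>(m, l). \<Sum>i=m..l. sum f (slice \<iota> q i))"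
    by (auto simp: fun_eq_iff sum_box)
  ultimately show ?thesis by simp
qed


section \<open>The space of summable periodic functions\<close>

abbreviation \<Lambda> :: "('n lattice \<Rightarrow> real) set" where
  "\<Lambda> \<equiv> Lambda1q \<iota> q"

lemma abs_le_infsum:
  fixes u :: "'n lattice \<Rightarrow> real"
  assumes "(\<lambda>j. \<bar>u j\<bar>) summable_on cyl" "j \<in> cyl"
  shows "\<bar>u j\<bar> \<le> (\<Sum>\<^sub>\<infinity>j\<in>cyl. \<bar>u j\<bar>)"
proof -
  have "(\<Sum>\<^sub>\<infinity>j\<in>{j}. \<bar>u j\<bar>) \<le> (\<Sum>\<^sub>\<infinity>j\<in>cyl. \<bar>u j\<bar>)"
    using assms by (intro infsum_mono_neutral) auto
  then show ?thesis by simp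
qed

lemma square_summable:
  fixes u :: "'n lattice \<Rightarrow> real"
  assumes "(\<lambda>j. \<bar>u j\<bar>) summable_on cyl"
  shows "(\<lambda>j. (u j)\<^sup>2) summable_on cyl"
    and "(\<Sum>\<^sub>\<infinity>j\<in>cyl. (u j)\<^sup>2) \<le> (\<Sum>\<^sub>\<infinity>j\<in>cyl. \<bar>u j\<bar>)\<^sup>2"
proof -
  let ?N = "\<Sum>\<^sub>\<infinity>j\<in>cyl. \<bar>u j\<bar>"
  have le: "(u j)\<^sup>2 \<le> ?N * \<bar>u j\<bar>" if "j \<in> cyl" for j
    using mult_right_mono[OF abs_le_infsum[OF assms that], of "\<bar>u j\<bar>"]
    by (simp add: power2_eq_square)
  have sm: "(\<lambda>j. ?N * \<bar>u j\<bar>) summable_on cyl" using assms by (rule summable_on_cmult_right)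
  show s2: "(\<lambda>j. (u j)\<^sup>2) summable_on cyl"
    by (rule summable_on_comparison_test[OF sm]) (use le in auto)
  have "(\<Sum>\<^sub>\<infinity>j\<in>cyl. (u j)\<^sup>2) \<le> (\<Sum>\<^sub>\<infinity>j\<in>cyl. ?N * \<bar>u j\<bar>)"
    using s2 sm le by (rule infsum_mono)
  also have "\<dots> = ?N\<^sup>2" using assms by (simp add: infsum_cmult_right power2_eq_square)
  finally show "(\<Sum>\<^sub>\<infinity>j\<in>cyl. (u j)\<^sup>2) \<le> ?N\<^sup>2" .
qed

lemma Lambda_iff: "u \<in> \<Lambda> \<longleftrightarrow> periodic \<iota> q u \<and> (\<lambda>j. \<bar>u j\<bar>) summable_on cyl"
  using square_summable(1)[of u] by (auto simp: Lambda1q_def)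

lemma square_le_infsum:
  assumes "u \<in> \<Lambda>" "j \<in> cyl"
  shows "(u j)\<^sup>2 \<le> (\<Sum>\<^sub>\<infinity>j\<in>cyl. (u j)\<^sup>2)"
proof -
  have "(\<Sum>\<^sub>\<infinity>i\<in>{j}. (u i)\<^sup>2) \<le> (\<Sum>\<^sub>\<infinity>j\<in>cyl. (u j)\<^sup>2)"
    using assms square_summable(1)[of u] by (intro infsum_mono_neutral) (auto simp: Lambda_iff)
  then show ?thesis by simp
qed

lemma Lambda_dominated:
  assumes "periodic \<iota> q u" "v \<in> \<Lambda>" "\<And>j. j \<in> cyl \<Longrightarrow> \<bar>u j\<bar> \<le> \<bar>v j\<bar>"
  shows "u \<in> \<Lambda>"
  using assms summable_on_comparison_test[of "\<lambda>j. \<bar>v j\<bar>" cyl "\<lambda>j. \<bar>u j\<bar>"]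
  by (auto simp: Lambda_iff)

lemma Lambda_lin:
  assumes "u \<in> \<Lambda>" "v \<in> \<Lambda>"
  shows Lambda_add: "(\<lambda>j. u j + v j) \<in> \<Lambda>" and Lambda_diff: "(\<lambda>j. u j - v j) \<in> \<Lambda>"
proof -
  have sm: "(\<lambda>j. \<bar>u j\<bar> + \<bar>v j\<bar>) summable_on cyl"
    using assms by (auto simp: Lambda_iff intro: summable_on_add)
  have "(\<lambda>j. \<bar>u j + v j\<bar>) summable_on cyl" "(\<lambda>j. \<bar>u j - v j\<bar>) summable_on cyl"
    by (rule summable_on_comparison_test[OF sm]; simp)+
  then show "(\<lambda>j. u j + v j) \<in> \<Lambda>" "(\<lambda>j. u j - v j) \<in> \<Lambda>"
    using assms by (auto simp: Lambda_iff periodic_def)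
qed

lemma norm1q_bounds:
  assumes "u \<in> \<Lambda>"
  shows "(\<Sum>\<^sub>\<infinity>j\<in>cyl. \<bar>u j\<bar>) \<le> norm1q \<iota> q u" and "norm1q \<iota> q u \<le> 2 * (\<Sum>\<^sub>\<infinity>j\<in>cyl. \<bar>u j\<bar>)"
    and "(\<Sum>\<^sub>\<infinity>j\<in>cyl. (u j)\<^sup>2) \<le> (norm1q \<iota> q u)\<^sup>2"
proof -
  have sm: "(\<lambda>j. \<bar>u j\<bar>) summable_on cyl" using assms by (simp add: Lambda_iff)
  have N: "0 \<le> (\<Sum>\<^sub>\<infinity>j\<in>cyl. \<bar>u j\<bar>)" by (rule infsum_nonneg) simp
  have Q: "0 \<le> (\<Sum>\<^sub>\<infinity>j\<in>cyl. (u j)\<^sup>2)" by (rule infsum_nonneg) simp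
  show le: "(\<Sum>\<^sub>\<infinity>j\<in>cyl. \<bar>u j\<bar>) \<le> norm1q \<iota> q u"
    using Q by (simp add: norm1q_def)
  have "sqrt (\<Sum>\<^sub>\<infinity>j\<in>cyl. (u j)\<^sup>2) \<le> (\<Sum>\<^sub>\<infinity>j\<in>cyl. \<bar>u j\<bar>)"
    using square_summable(2)[OF sm] N by (simp add: real_le_lsqrt)
  then show "norm1q \<iota> q u \<le> 2 * (\<Sum>\<^sub>\<infinity>j\<in>cyl. \<bar>u j\<bar>)" by (simp add: norm1q_def)
  show "(\<Sum>\<^sub>\<infinity>j\<in>cyl. (u j)\<^sup>2) \<le> (norm1q \<iota> q u)\<^sup>2"
    using square_summable(2)[OF sm] power_mono[OF le N, of 2] by linarith
qed

end

section \<open>Energy differences of summable perturbations\<close>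

lemma has_sum_sum_real:
  fixes f :: "'k \<Rightarrow> 'a \<Rightarrow> real"
  assumes "finite K" "\<And>k. k \<in> K \<Longrightarrow> (f k has_sum x k) A"
  shows "((\<lambda>j. \<Sum>k\<in>K. f k j) has_sum (\<Sum>k\<in>K. x k)) A"
  using assms by (induction K rule: finite_induct) (auto intro: has_sum_add)

lemma has_sum_diff_real:
  fixes f g :: "'a \<Rightarrow> real"
  assumes "(f has_sum x) A" "(g has_sum y) A"
  shows "((\<lambda>j. f j - g j) has_sum (x - y)) A"
  using has_sum_add[OF assms(1) has_sum_cmult_right[OF assms(2), of "-1"]] by simp

lemma summable_dominated_real:
  fixes f g :: "'a \<Rightarrow> real"
  assumes "g summable_on A" "\<And>j. j \<in> A \<Longrightarrow> \<bar>f j\<bar> \<le> g j"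
  shows "f summable_on A"
proof -
  have "(\<lambda>j. norm (f j)) summable_on A"
    by (rule Infinite_Sum.abs_summable_on_comparison_test'[OF assms(1)]) (use assms(2) in simp)
  then show ?thesis by (rule Infinite_Sum.abs_summable_summable)
qed

context potential
begin

lemma bounded_ds:
  "\<exists>M\<ge>0. \<forall>k\<in>B r. \<forall>x\<in>RB r. (\<forall>i\<in>B r. \<alpha> \<le> x i \<and> x i \<le> \<beta>) \<longrightarrow> \<bar>ds k x\<bar> \<le> M"
proof -
  let ?a = "\<lambda>i\<in>B r. \<alpha>"
  let ?M = "(\<Sum>k\<in>B r. \<bar>ds k ?a\<bar>) + C * (cB * \<bar>\<beta> - \<alpha>\<bar>)"
  have "\<bar>ds k x\<bar> \<le> ?M"
    if k: "k \<in> B r" and x: "x \<in> RB r" and bd: "\<forall>i\<in>B r. \<alpha> \<le> x i \<and> x i \<le> \<beta>" for k x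
  proof -
    have "\<bar>ds k x - ds k ?a\<bar> \<le> C * (\<Sum>i\<in>B r. \<bar>x i - ?a i\<bar>)"
      by (rule ds_lipschitz[OF k _ x]) simp
    also have "\<dots> \<le> C * (\<Sum>i\<in>(B r :: 'n lattice set). \<bar>\<beta> - \<alpha>\<bar>)"
      using bd by (intro mult_left_mono sum_mono C_nonneg) fastforce
    finally have 1: "\<bar>ds k x - ds k ?a\<bar> \<le> C * (cB * \<bar>\<beta> - \<alpha>\<bar>)" by (simp add: cB)
    have 2: "\<bar>ds k ?a\<bar> \<le> (\<Sum>k\<in>B r. \<bar>ds k ?a\<bar>)"
      using k by (intro member_le_sum) auto
    from 1 2 show ?thesis by linarith
  qed
  moreover have "0 \<le> ?M" using C_nonneg cB_ge_1 by (intro add_nonneg_nonneg sum_nonneg) auto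
  ultimately show ?thesis by blast
qed

text \<open>
  The estimates below need one bound on the first derivatives for all functions with values in
  \<open>[\<alpha>, \<beta>]\<close>; which one does not matter, so one is chosen.
\<close>

definition dsb :: "real \<Rightarrow> real \<Rightarrow> real" where
  "dsb \<alpha> \<beta> = (SOME M. 0 \<le> M \<and>
     (\<forall>k\<in>B r. \<forall>x\<in>RB r. (\<forall>i\<in>B r. \<alpha> \<le> x i \<and> x i \<le> \<beta>) \<longrightarrow> \<bar>ds k x\<bar> \<le> M))"

lemma dsb_nonneg: "0 \<le> dsb \<alpha> \<beta>"
  and ds_le_dsb: "k \<in> B r \<Longrightarrow> x \<in> RB r \<Longrightarrow> (\<And>i. i \<in> B r \<Longrightarrow> \<alpha> \<le> x i \<and> x i \<le> \<beta>) \<Longrightarrow>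
    \<bar>ds k x\<bar> \<le> dsb \<alpha> \<beta>"
  using someI_ex[OF bounded_ds[of \<alpha> \<beta>]] unfolding dsb_def by blast+

lemma S_lipschitz:
  assumes "\<And>i. \<alpha> \<le> u i \<and> u i \<le> \<beta>" "\<And>i. \<alpha> \<le> v i \<and> v i \<le> \<beta>"
  shows "\<bar>S r s j v - S r s j u\<bar> \<le> dsb \<alpha> \<beta> * (\<Sum>k\<in>B r. \<bar>v (j + k) - u (j + k)\<bar>)"
proof -
  obtain \<xi> where \<xi>: "\<forall>k\<in>B r. \<xi> k \<in> RB r \<and>
      (\<forall>i. min (win j u i) (win j v i) \<le> \<xi> k i \<and> \<xi> k i \<le> max (win j u i) (win j v i))"
    and eq: "s (win j v) - s (win j u) = (\<Sum>k\<in>B r. ds k (\<xi> k) * (win j v k - win j u k))"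
    using C1_RA_mvt[OF C1 finite_B win_RB win_RB, of j u j v] by (elim exE conjE)
  have "\<bar>S r s j v - S r s j u\<bar> \<le> (\<Sum>k\<in>B r. \<bar>ds k (\<xi> k) * (win j v k - win j u k)\<bar>)"
    unfolding S_eq eq by (rule sum_abs)
  also have "\<dots> \<le> (\<Sum>k\<in>B r. dsb \<alpha> \<beta> * \<bar>v (j + k) - u (j + k)\<bar>)"
  proof (rule sum_mono)
    fix k :: "'n lattice" assume k: "k \<in> B r"
    have "\<bar>ds k (\<xi> k)\<bar> \<le> dsb \<alpha> \<beta>"
    proof (rule ds_le_dsb[OF k])
      fix i :: "'n lattice" assume i: "i \<in> B r"
      have "min (u (j + i)) (v (j + i)) \<le> \<xi> k i \<and> \<xi> k i \<le> max (u (j + i)) (v (j + i))"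
        using bspec[OF \<xi> k, THEN conjunct2, rule_format, of i] i by simp
      then show "\<alpha> \<le> \<xi> k i \<and> \<xi> k i \<le> \<beta>"
        using assms(1)[of "j + i"] assms(2)[of "j + i"] by linarith
    qed (use \<xi> k in blast)
    then show "\<bar>ds k (\<xi> k) * (win j v k - win j u k)\<bar> \<le> dsb \<alpha> \<beta> * \<bar>v (j + k) - u (j + k)\<bar>"
      using k by (simp add: abs_mult mult_right_mono)
  qed
  finally show ?thesis by (simp add: sum_distrib_left)
qed

lemma grad_lipschitz:
  "\<bar>grad v i - grad u i\<bar> \<le> C * (\<Sum>k\<in>B r. \<Sum>l\<in>B r. \<bar>v (i - k + l) - u (i - k + l)\<bar>)"
proof -
  have "\<bar>grad v i - grad u i\<bar> \<le> (\<Sum>k\<in>B r. \<bar>ds k (win (i - k) v) - ds k (win (i - k) u)\<bar>)"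
    unfolding grad_def sum_subtractf [symmetric] by (rule sum_abs)
  also have "\<dots> \<le> (\<Sum>k\<in>B r. C * (\<Sum>l\<in>B r. \<bar>v (i - k + l) - u (i - k + l)\<bar>))"
  proof (rule sum_mono)
    fix k :: "'n lattice" assume k: "k \<in> B r"
    show "\<bar>ds k (win (i - k) v) - ds k (win (i - k) u)\<bar> \<le>
        C * (\<Sum>l\<in>B r. \<bar>v (i - k + l) - u (i - k + l)\<bar>)"
      using ds_lipschitz[OF k win_RB win_RB, of "i - k" v "i - k" u] by simp
  qed
  finally show ?thesis by (simp add: sum_distrib_left)
qed

end

locale potential_strip = potential r s C cB + strip \<iota> q
  for r :: nat and s :: "('n::finite lattice \<Rightarrow> real) \<Rightarrow> real" and C cB :: real
    and \<iota> :: 'n and q :: "'n \<Rightarrow> nat"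
begin

definition dE :: "('n lattice \<Rightarrow> real) \<Rightarrow> ('n lattice \<Rightarrow> real) \<Rightarrow> real" where
  "dE b h = (\<Sum>\<^sub>\<infinity>j\<in>cyl. S r s j (\<lambda>i. b i + h i) - S r s j b)"

lemma periodic_win: "periodic \<iota> q u \<Longrightarrow> k \<noteq> \<iota> \<Longrightarrow> win (j + axis k (int (q k))) u = win j u"
proof -
  assume u: "periodic \<iota> q u" "k \<noteq> \<iota>"
  have "u (j + axis k (int (q k)) + i) = u (j + i)" for i
    using u unfolding periodic_def by (metis add.assoc add.commute)
  then show ?thesis by (simp add: win_def)
qed

lemma periodic_grad:
  assumes "periodic \<iota> q u"
  shows "periodic \<iota> q (grad u)"
  unfolding periodic_def
proof (intro allI impI)
  fix k i assume "k \<noteq> \<iota>"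
  then have "win (i + axis k (int (q k)) - l) u = win (i - l) u" for l
    using periodic_win[OF assms, of k "i - l"] by (simp add: algebra_simps)
  then show "grad u (i + axis k (int (q k))) = grad u i" by (simp add: grad_def)
qed

lemma has_sum_neighbourhoods:
  fixes f :: "'n lattice \<Rightarrow> real"
  assumes "periodic \<iota> q f" "(f has_sum x) cyl"
  shows "((\<lambda>j. \<Sum>k\<in>B r. f (j + k)) has_sum (cB * x)) cyl"
proof -
  have "((\<lambda>j. \<Sum>k\<in>B r. f (j + k)) has_sum (\<Sum>k\<in>(B r :: 'n lattice set). x)) cyl"
    using assms by (intro has_sum_sum_real) (simp_all add: cyl_has_sum_shift)
  then show ?thesis by (simp add: cB)
qed

text \<open>
  Summation by parts: distributing the derivative of \<open>S j\<close> over the sites it depends on and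
  collecting at each site turns the linear part of the energy difference into \<open>grad\<close>.
\<close>

lemma energy_expansion:
  assumes b: "periodic \<iota> q b" and bd: "\<And>i. \<alpha> \<le> b i \<and> b i \<le> \<beta>" and h: "h \<in> \<Lambda>"
  shows "(\<lambda>j. S r s j (\<lambda>i. b i + h i) - S r s j b) summable_on cyl"
    and "(\<lambda>j. grad b j * h j) summable_on cyl"
    and "\<bar>dE b h - (\<Sum>\<^sub>\<infinity>j\<in>cyl. grad b j * h j)\<bar> \<le> C * cB\<^sup>2 * (\<Sum>\<^sub>\<infinity>j\<in>cyl. (h j)\<^sup>2)"
proof -
  let ?M = "dsb \<alpha> \<beta>"
  define e where "e j = S r s j (\<lambda>i. b i + h i) - S r s j b" for j
  define lin where "lin j = (\<Sum>k\<in>B r. ds k (win j b) * h (j + k))" for j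
  define rem where "rem j = C * cB * (\<Sum>k\<in>B r. (h (j + k))\<^sup>2)" for j
  have hp: "periodic \<iota> q h" and hs: "(\<lambda>j. \<bar>h j\<bar>) summable_on cyl" using h by (auto simp: Lambda_iff)
  have rem: "(rem has_sum (C * cB\<^sup>2 * (\<Sum>\<^sub>\<infinity>j\<in>cyl. (h j)\<^sup>2))) cyl"
  proof -
    have "periodic \<iota> q (\<lambda>j. (h j)\<^sup>2)" using hp by (simp add: periodic_def)
    from has_sum_cmult_right[OF has_sum_neighbourhoods[OF this
          has_sum_infsum[OF square_summable(1)[OF hs]]], of "C * cB"]
    show ?thesis by (simp add: rem_def [abs_def] power2_eq_square mult.assoc)
  qed
  have e_lin: "\<bar>e j - lin j\<bar> \<le> rem j" for j
  proof -
    have "win j (\<lambda>i. b i + h i) k - win j b k = h (j + k)" if "k \<in> B r" for k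
      using that by simp
    then show ?thesis
      using s_second_order[OF win_RB win_RB, of j "\<lambda>i. b i + h i" j b]
      by (simp add: e_def lin_def rem_def S_eq)
  qed
  define \<phi> where "\<phi> k j = ds k (win (j - k) b) * h j" for k j
  have \<phi>p: "periodic \<iota> q (\<phi> k)" for k
    unfolding periodic_def
  proof (intro allI impI)
    fix l i assume l: "l \<noteq> \<iota>"
    have "win (i + axis l (int (q l)) - k) b = win (i - k) b"
      using periodic_win[OF b l, of "i - k"] by (simp add: algebra_simps)
    then show "\<phi> k (i + axis l (int (q l))) = \<phi> k i" using hp l by (simp add: \<phi>_def periodic_def)
  qed
  have \<phi>s: "\<phi> k summable_on cyl" if k: "k \<in> B r" for k
  proof (rule summable_dominated_real[OF summable_on_cmult_right[OF hs, of ?M]])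
    fix j
    have "\<bar>ds k (win (j - k) b)\<bar> \<le> ?M" using bd by (intro ds_le_dsb k) auto
    then show "\<bar>\<phi> k j\<bar> \<le> ?M * \<bar>h j\<bar>" by (simp add: \<phi>_def abs_mult mult_right_mono)
  qed
  define X where "X = (\<Sum>k\<in>B r. infsum (\<phi> k) cyl)"
  have gr: "((\<lambda>j. grad b j * h j) has_sum X) cyl"
  proof -
    have "((\<lambda>j. \<Sum>k\<in>B r. \<phi> k j) has_sum X) cyl"
      unfolding X_def using \<phi>s by (intro has_sum_sum_real) auto
    then show ?thesis by (simp add: \<phi>_def grad_def sum_distrib_right)
  qed
  have lin: "(lin has_sum X) cyl"
  proof -
    have "((\<lambda>j. \<Sum>k\<in>B r. \<phi> k (j + k)) has_sum X) cyl"
      unfolding X_def using \<phi>s \<phi>p by (intro has_sum_sum_real) (auto simp: cyl_has_sum_shift)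
    then show ?thesis by (simp add: \<phi>_def lin_def [abs_def])
  qed
  have "(\<lambda>j. e j - lin j) summable_on cyl"
    by (rule summable_dominated_real[OF has_sum_imp_summable[OF rem] e_lin])
  from summable_on_add[OF this has_sum_imp_summable[OF lin]]
  have es: "e summable_on cyl" by simp
  then show "(\<lambda>j. S r s j (\<lambda>i. b i + h i) - S r s j b) summable_on cyl" by (simp add: e_def [abs_def])
  show "(\<lambda>j. grad b j * h j) summable_on cyl" using gr by (rule has_sum_imp_summable)
  have dE: "dE b h = infsum e cyl" by (simp add: dE_def e_def [abs_def])
  have "norm (infsum e cyl - X) \<le> C * cB\<^sup>2 * (\<Sum>\<^sub>\<infinity>j\<in>cyl. (h j)\<^sup>2)"
    using e_lin by (intro norm_infsum_le[OF has_sum_diff_real[OF has_sum_infsum[OF es] lin] rem]) simp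
  then show "\<bar>dE b h - (\<Sum>\<^sub>\<infinity>j\<in>cyl. grad b j * h j)\<bar> \<le> C * cB\<^sup>2 * (\<Sum>\<^sub>\<infinity>j\<in>cyl. (h j)\<^sup>2)"
    by (simp add: dE infsumI[OF gr])
qed

text \<open>
  Where a descent step is made the linear part of the energy change is \<open>- h\<^sup>2 / \<eta>\<close>, and \<open>\<eta>\<close> was chosen so
  that the second order remainder eats up at most half of it.  Sites may be left out, because a
  single layer has to be moved when the chain is only known to minimize among heteroclinic chains.
\<close>

lemma descent:
  assumes b: "periodic \<iota> q b" and bd: "\<And>i. \<alpha> \<le> b i \<and> b i \<le> \<beta>" and h: "h \<in> \<Lambda>"
    and step: "\<And>j. h j = 0 \<or> h j = - \<eta> * grad b j"
  shows "dE b h \<le> - (\<Sum>\<^sub>\<infinity>j\<in>cyl. (h j)\<^sup>2) / (2 * \<eta>)"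
proof -
  let ?Q = "\<Sum>\<^sub>\<infinity>j\<in>cyl. (h j)\<^sup>2"
  have Q: "0 \<le> ?Q" by (rule infsum_nonneg) simp
  have "grad b j * h j = (- 1 / \<eta>) * (h j)\<^sup>2" for j
    using step[of j] eta_pos by (auto simp: power2_eq_square field_simps)
  then have "(\<Sum>\<^sub>\<infinity>j\<in>cyl. grad b j * h j) = (- 1 / \<eta>) * ?Q"
    by (simp only: infsum_cmult_right')
  then have "(\<Sum>\<^sub>\<infinity>j\<in>cyl. grad b j * h j) = - ?Q / \<eta>" by simp
  moreover have "C * cB\<^sup>2 \<le> 1 / (2 * \<eta>)" using eta_C2 eta_pos by (simp add: field_simps)
  then have "C * cB\<^sup>2 * ?Q \<le> 1 / (2 * \<eta>) * ?Q" using Q by (rule mult_right_mono)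
  moreover have "1 / (2 * \<eta>) * ?Q - ?Q / \<eta> = - ?Q / (2 * \<eta>)" using eta_pos by (simp add: field_simps)
  ultimately show ?thesis using energy_expansion(3)[OF b bd h] by linarith
qed

lemma dE_zero [simp]: "dE b (\<lambda>_. 0) = 0"
  by (simp add: dE_def)

lemma dE_add:
  assumes b: "periodic \<iota> q b" and bd: "\<And>i. \<alpha> \<le> b i \<and> b i \<le> \<beta>"
    and h: "h \<in> \<Lambda>" and bd': "\<And>i. \<alpha> \<le> b i + h i \<and> b i + h i \<le> \<beta>" and g: "g \<in> \<Lambda>"
  shows "dE b (\<lambda>i. h i + g i) = dE b h + dE (\<lambda>i. b i + h i) g"
proof -
  have bh: "periodic \<iota> q (\<lambda>i. b i + h i)" using b h by (auto simp: Lambda_iff periodic_def)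
  show ?thesis unfolding dE_def
    using infsum_add[OF energy_expansion(1)[OF b bd h] energy_expansion(1)[OF bh bd' g]]
    by (simp add: add.assoc)
qed

definition P :: "('n lattice \<Rightarrow> real) \<Rightarrow> int \<times> int \<Rightarrow> real" where
  "P u = (\<lambda>(m, l). \<Sum>i=m..l. \<Sum>j\<in>slice \<iota> q i. S r s j u - c0 r s)"

lemma P_perturbed:
  assumes b: "periodic \<iota> q b" and bd: "\<And>i. \<alpha> \<le> b i \<and> b i \<le> \<beta>" and h: "h \<in> \<Lambda>"
    and lim: "(P b \<longlongrightarrow> a) (at_bot \<times>\<^sub>F at_top)"
  shows "(P (\<lambda>i. b i + h i) \<longlongrightarrow> a + dE b h) (at_bot \<times>\<^sub>F at_top)"
proof -
  let ?e = "\<lambda>j. S r s j (\<lambda>i. b i + h i) - S r s j b"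
  have "(?e has_sum dE b h) cyl"
    unfolding dE_def using energy_expansion(1)[OF b bd h] by (rule has_sum_infsum)
  from tendsto_add[OF lim box_sums_tendsto[OF this]] show ?thesis
    by (rule Lim_transform_eventually)
      (auto simp: P_def sum.distrib [symmetric] sum_subtractf intro!: always_eventually)
qed

lemma Liminf_P:
  assumes "(P b \<longlongrightarrow> a) (at_bot \<times>\<^sub>F at_top)"
  shows "Liminf (at_bot \<times>\<^sub>F at_top) (\<lambda>p. ereal (P b p)) = ereal a"
  using assms by (intro lim_imp_Liminf) (auto simp: prod_filter_eq_bot intro: tendsto_ereal)

lemma J1q_eq: "J1q r s \<iota> q u = Liminf (at_bot \<times>\<^sub>F at_top) (\<lambda>p. ereal (P u p))"
  by (simp add: J1q_def P_def case_prod_unfold)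

end

section \<open>Rearrangement, and the mean energy of periodic chains\<close>

context potential
begin

text \<open>
  Submodularity lets a function be merged into an ordered list by replacing pairs by their minimum and
  maximum, as in insertion sort.  Every coordinate is sorted this way, and the energy drops.
\<close>

lemma insert_into_chain:
  assumes "x \<in> RB r" "set ys \<subseteq> RB r" "sorted_wrt (\<lambda>y z. \<forall>k\<in>B r. y k \<le> z k) ys"
  shows "\<exists>zs. set zs \<subseteq> RB r \<and> sorted_wrt (\<lambda>y z. \<forall>k\<in>B r. y k \<le> z k) zs \<and>
    (\<forall>k\<in>B r. mset (map (\<lambda>y. y k) zs) = mset (map (\<lambda>y. y k) (x # ys))) \<and>
    sum_list (map s zs) \<le> s x + sum_list (map s ys)"
  using assms
proof (induction ys arbitrary: x)
  case Nil
  then show ?case by (intro exI[of _ "[x]"]) auto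
next
  case (Cons y ys)
  define hi lo where "hi = (\<lambda>k\<in>B r. max (x k) (y k))" and "lo = (\<lambda>k\<in>B r. min (x k) (y k))"
  have "hi \<in> RB r" by (simp add: hi_def)
  with Cons.IH[of hi] Cons.prems obtain zs where zs: "set zs \<subseteq> RB r"
    "sorted_wrt (\<lambda>y z. \<forall>k\<in>B r. y k \<le> z k) zs"
    "\<forall>k\<in>B r. mset (map (\<lambda>y. y k) zs) = mset (map (\<lambda>y. y k) (hi # ys))"
    "sum_list (map s zs) \<le> s hi + sum_list (map s ys)" by auto
  have "lo k \<le> z k" if z: "z \<in> set zs" and k: "k \<in> B r" for z k
  proof -
    have "set (map (\<lambda>y. y k) zs) = set (map (\<lambda>y. y k) (hi # ys))"
      using zs(3) k mset_eq_setD by blast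
    then have "z k = hi k \<or> (\<exists>y'\<in>set ys. z k = y' k)" using z by auto
    then show ?thesis using Cons.prems(3) k by (auto simp: hi_def lo_def min_le_iff_disj)
  qed
  moreover have "mset (map (\<lambda>y. y k) (lo # zs)) = mset (map (\<lambda>y. y k) (x # y # ys))"
    if "k \<in> B r" for k
    using zs(3) that by (auto simp: hi_def lo_def max_def min_def)
  moreover have "s hi + s lo \<le> s x + s y"
    unfolding hi_def lo_def using Cons.prems by (intro s_submodular) auto
  ultimately show ?case
    using zs by (intro exI[of _ "lo # zs"]) (auto simp: lo_def)
qed

lemma sorted_rearrangement:
  assumes "set xs \<subseteq> RB r"
  shows "\<exists>ys. set ys \<subseteq> RB r \<and> sorted_wrt (\<lambda>y z. \<forall>k\<in>B r. y k \<le> z k) ys \<and>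
    (\<forall>k\<in>B r. mset (map (\<lambda>y. y k) ys) = mset (map (\<lambda>y. y k) xs)) \<and>
    sum_list (map s ys) \<le> sum_list (map s xs)"
  using assms
proof (induction xs)
  case (Cons x xs)
  then obtain ys where ys: "set ys \<subseteq> RB r" "sorted_wrt (\<lambda>y z. \<forall>k\<in>B r. y k \<le> z k) ys"
    "\<forall>k\<in>B r. mset (map (\<lambda>y. y k) ys) = mset (map (\<lambda>y. y k) xs)"
    "sum_list (map s ys) \<le> sum_list (map s xs)" by auto
  have "x \<in> RB r" using Cons.prems by simp
  from insert_into_chain[OF this ys(1,2)] obtain zs where "set zs \<subseteq> RB r"
    "sorted_wrt (\<lambda>y z. \<forall>k\<in>B r. y k \<le> z k) zs"
    "\<forall>k\<in>B r. mset (map (\<lambda>y. y k) zs) = mset (map (\<lambda>y. y k) (x # ys))"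
    "sum_list (map s zs) \<le> s x + sum_list (map s ys)" by auto
  with ys(3,4) show ?case by (intro exI[of _ zs]) auto
qed (intro exI[of _ "[]"], simp)

end

lemma mset_period_window:
  fixes x :: "int \<Rightarrow> 'a"
  assumes "\<And>i. x (i + int p) = x i"
  shows "mset (map (\<lambda>n. x (c + int n)) [0..<p]) = mset (map (\<lambda>n. x (int n)) [0..<p])"
proof -
  define f where "f c = mset (map (\<lambda>n. x (c + int n)) [0..<p])" for c
  have step: "f (c + 1) = f c" for c
  proof -
    have "add_mset (x c) (f (c + 1)) = mset (map (\<lambda>n. x (c + int n)) [0..<Suc p])"
      unfolding f_def
      by (subst upt_conv_Cons, simp, simp only: list.map mset.simps map_Suc_upt [symmetric])
        (simp add: o_def add_ac)
    also have "\<dots> = add_mset (x (c + int p)) (f c)" by (simp add: f_def)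
    finally show ?thesis using assms by simp
  qed
  have "f c = f 0"
  proof (induction c rule: int_induct[where k = 0])
    case (step2 i)
    then show ?case using step[of "i - 1"] by simp
  qed (simp_all add: step)
  then show ?thesis by (simp add: f_def)
qed

locale chain = potential r s C cB
  for r :: nat and s :: "('n::finite lattice \<Rightarrow> real) \<Rightarrow> real" and C cB :: real +
  fixes \<iota> :: 'n and \<alpha> \<beta> :: real
  assumes r_ge_1: "1 \<le> r" and \<alpha>\<beta>: "\<alpha> < \<beta>"
    and c0_le: "c0 r s \<le> S r s 0 (\<lambda>_. x)"
    and c0_\<alpha>: "S r s 0 (\<lambda>_. \<alpha>) = c0 r s" and c0_\<beta>: "S r s 0 (\<lambda>_. \<beta>) = c0 r s"
begin

definition lift :: "(int \<Rightarrow> real) \<Rightarrow> 'n lattice \<Rightarrow> real" where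
  "lift x = (\<lambda>i. x (i $ \<iota>))"

lemma lift_apply [simp]: "lift x j = x (j $ \<iota>)"
  by (simp add: lift_def)

definition e :: "(int \<Rightarrow> real) \<Rightarrow> int \<Rightarrow> real" where
  "e x i = S r s (axis \<iota> i) (lift x) - c0 r s"

definition E :: "(int \<Rightarrow> real) \<Rightarrow> int \<times> int \<Rightarrow> real" where
  "E x = (\<lambda>(m, l). \<Sum>i=m..l. e x i)"

lemma win_lift: "win j (lift x) = (\<lambda>k\<in>B r. x (j $ \<iota> + k $ \<iota>))"
  by (simp add: win_def)

lemma S_lift: "S r s j (lift x) = e x (j $ \<iota>) + c0 r s"
  by (simp add: e_def S_eq win_lift)

lemma win_const: "win j (\<lambda>_. a) = win 0 (\<lambda>_. a)"
  by (simp add: win_def)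

text \<open>
  The windows of a periodic chain over one period have, in each coordinate, the same values in a
  different order.  After sorting they are constant functions, each of energy at least \<open>c0\<close>.
\<close>

lemma periodic_energy:
  assumes per: "\<And>i. x (i + int p) = x i"
  shows "0 \<le> (\<Sum>n<p. e x (a + int n))"
proof -
  define xs where "xs = map (\<lambda>n. win (axis \<iota> (a + int n)) (lift x)) [0..<p]"
  have "set xs \<subseteq> RB r" by (simp add: xs_def image_subset_iff)
  from sorted_rearrangement[OF this] obtain ys where ys: "set ys \<subseteq> RB r"
    "sorted_wrt (\<lambda>y z. \<forall>k\<in>B r. y k \<le> z k) ys"
    and ms: "\<forall>k\<in>B r. mset (map (\<lambda>y. y k) ys) = mset (map (\<lambda>y. y k) xs)"
    and le: "sum_list (map s ys) \<le> sum_list (map s xs)" by blast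
  have same: "map (\<lambda>y. y k) ys = map (\<lambda>y. y 0) ys" if k: "k \<in> B r" for k
  proof -
    have "mset (map (\<lambda>y. y k) xs) = mset (map (\<lambda>n. x (int n)) [0..<p])" if "k \<in> B r" for k
      using mset_period_window[of x p "a + k $ \<iota>", OF per] that
      by (simp add: xs_def o_def win_lift add_ac)
    then have "mset (map (\<lambda>y. y k) ys) = mset (map (\<lambda>y. y 0) ys)"
      using ms k zero_in_B by metis
    moreover have "sorted (map (\<lambda>y. y k) ys)" if "k \<in> B r" for k
      using ys(2) that by (auto simp: sorted_wrt_map intro: sorted_wrt_mono_rel[rotated])
    ultimately show ?thesis
      using k zero_in_B by (metis properties_for_sort)
  qed
  have "c0 r s \<le> s y" if y: "y \<in> set ys" for y
  proof -
    have "y = win 0 (\<lambda>_. y 0)"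
    proof
      fix k
      show "y k = win 0 (\<lambda>_. y 0) k"
      proof (cases "k \<in> B r")
        case True
        with same[OF True] y show ?thesis by simp
      next
        case False
        then show ?thesis using ys(1) y by (auto simp: win_def PiE_iff extensional_def)
      qed
    qed
    then show ?thesis using c0_le[of "y 0"] by (simp add: S_eq)
  qed
  then have "sum_list (map (\<lambda>_. c0 r s) ys) \<le> sum_list (map s ys)"
    by (intro sum_list_mono) auto
  moreover have "length ys = p"
    using mset_eq_length[OF ms[rule_format, OF zero_in_B]] by (simp add: xs_def)
  moreover have "sum_list (map s xs) = (\<Sum>n<p. e x (a + int n) + c0 r s)"
    by (simp add: xs_def o_def interv_sum_list_conv_sum_set_nat e_def S_eq atLeast0LessThan)
  ultimately show ?thesis using le by (simp add: sum_list_triv sum.distrib)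
qed

text \<open>
  Cutting a chain down to a piece whose ends are close to a minimizing constant \<open>a\<close>, and repeating
  the piece periodically with \<open>a\<close> filled in between, shows that the piece cannot have much less
  energy than \<open>a\<close> itself.  The filling has length \<open>2 * r\<close> so that repeated pieces do not interact.
\<close>

definition K :: real where
  "K = dsb \<alpha> \<beta> * cB * (4 * real r)"

lemma K_nonneg: "0 \<le> K"
  using dsb_nonneg cB_ge_1 by (simp add: K_def)

lemma e_lipschitz:
  assumes "\<And>i. \<alpha> \<le> x i \<and> x i \<le> \<beta>" "\<And>i. \<alpha> \<le> y i \<and> y i \<le> \<beta>"
    and "\<And>k. \<bar>k\<bar> \<le> int r \<Longrightarrow> \<bar>y (i + k) - x (i + k)\<bar> \<le> \<delta>"
  shows "\<bar>e y i - e x i\<bar> \<le> dsb \<alpha> \<beta> * cB * \<delta>"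
proof -
  have "\<bar>e y i - e x i\<bar> \<le> dsb \<alpha> \<beta> * (\<Sum>k\<in>B r. \<bar>y (i + k $ \<iota>) - x (i + k $ \<iota>)\<bar>)"
    using S_lipschitz[of \<alpha> "lift x" \<beta> "lift y" "axis \<iota> i"] assms(1,2) by (simp add: e_def)
  also have "(\<Sum>k\<in>B r. \<bar>y (i + k $ \<iota>) - x (i + k $ \<iota>)\<bar>) \<le> (\<Sum>k\<in>(B r :: 'n lattice set). \<delta>)"
  proof (rule sum_mono)
    fix k :: "'n lattice" assume "k \<in> B r"
    then have "\<bar>k $ \<iota>\<bar> \<le> int r" using component_le_l1norm[of k \<iota>] by (simp add: B_def)
    then show "\<bar>y (i + k $ \<iota>) - x (i + k $ \<iota>)\<bar> \<le> \<delta>" by (rule assms(3))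
  qed
  also have "(\<Sum>k\<in>(B r :: 'n lattice set). \<delta>) = cB * \<delta>" by (simp add: cB)
  finally show ?thesis using dsb_nonneg by (simp add: mult_left_mono mult.assoc)
qed

lemma cut_energy:
  assumes x: "\<And>i. \<alpha> \<le> x i \<and> x i \<le> \<beta>"
    and a: "\<alpha> \<le> a" "a \<le> \<beta>" "S r s 0 (\<lambda>_. a) = c0 r s" and ml: "m \<le> l"
    and near: "\<And>i. \<bar>i - m\<bar> \<le> int r \<or> \<bar>i - l\<bar> \<le> int r \<Longrightarrow> \<bar>x i - a\<bar> \<le> \<delta>"
  shows "- K * \<delta> \<le> E x (m, l)"
proof -
  define R where "R = int r"
  define p where "p = nat (l - m + 1 + 2 * R)"
  have p: "int p = l - m + 1 + 2 * R" using ml by (simp add: p_def R_def)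
  define w where "w i = (i - (m - R)) mod int p + (m - R)" for i
  define y where "y i = (if m \<le> w i \<and> w i \<le> l then x (w i) else a)" for i
  have y: "\<alpha> \<le> y i \<and> y i \<le> \<beta>" for i using x a by (simp add: y_def)
  have w_in: "w i = i" if "m - R \<le> i" "i \<le> l + R" for i
    using that p by (simp add: w_def)
  have w_left: "w i = i + int p" if "m - 2 * R \<le> i" "i < m - R" for i
  proof -
    have "(i - (m - R)) mod int p = (i - (m - R) + int p) mod int p" by simp
    also have "\<dots> = i - (m - R) + int p" using that p ml by (intro mod_pos_pos_trivial) auto
    finally show ?thesis by (simp add: w_def)
  qed
  have w_right: "w i = i - int p" if "l + R < i" "i \<le> l + 2 * R" for i
  proof -
    have "(i - (m - R)) mod int p = (i - (m - R) - int p) mod int p" by simp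
    also have "\<dots> = i - (m - R) - int p" using that p ml by (intro mod_pos_pos_trivial) auto
    finally show ?thesis by (simp add: w_def)
  qed
  have y_eq: "y i = (if m \<le> i \<and> i \<le> l then x i else a)" if "m - 2 * R \<le> i" "i \<le> l + 2 * R" for i
  proof -
    consider "i < m - R" | "m - R \<le> i" "i \<le> l + R" | "l + R < i" by linarith
    then show ?thesis
    proof cases
      case 1
      then show ?thesis using w_left[of i] that p by (simp add: y_def R_def)
    next
      case 2
      then show ?thesis using w_in[of i] by (simp add: y_def)
    next
      case 3
      then show ?thesis using w_right[of i] that p by (simp add: y_def R_def)
    qed
  qed
  let ?N = "{m - R..m + R - 1} \<union> {l - R + 1..l + R}"
  let ?c = "dsb \<alpha> \<beta> * cB * \<delta>"
  have \<delta>: "0 \<le> \<delta>" using near[of m] abs_ge_zero[of "x m - a"] by simp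
  have c: "0 \<le> ?c" using \<delta> dsb_nonneg cB_ge_1 by simp
  have termwise: "e y i \<le> (if m \<le> i \<and> i \<le> l then e x i else 0) + (if i \<in> ?N then ?c else 0)"
    if i: "m - R \<le> i" "i \<le> l + R" for i
  proof (cases "m \<le> i \<and> i \<le> l")
    case True
    show ?thesis
    proof (cases "i \<in> ?N")
      case N: True
      have "\<bar>e y i - e x i\<bar> \<le> ?c"
      proof (rule e_lipschitz[OF x y])
        fix k assume k: "\<bar>k\<bar> \<le> int r"
        show "\<bar>y (i + k) - x (i + k)\<bar> \<le> \<delta>"
          using k True y_eq[of "i + k"] near[of "i + k"] \<delta> by (auto simp: R_def abs_minus_commute)
      qed
      then show ?thesis using True N by simp
    next
      case N: False
      have "\<bar>e y i - e x i\<bar> \<le> dsb \<alpha> \<beta> * cB * 0"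
      proof (rule e_lipschitz[OF x y])
        fix k assume k: "\<bar>k\<bar> \<le> int r"
        show "\<bar>y (i + k) - x (i + k)\<bar> \<le> 0"
          using k True N y_eq[of "i + k"] by (auto simp: R_def)
      qed
      then show ?thesis using True c by simp
    qed
  next
    case False
    have "\<bar>e y i - e (\<lambda>_. a) i\<bar> \<le> ?c"
    proof (rule e_lipschitz[OF _ y])
      fix k assume k: "\<bar>k\<bar> \<le> int r"
      show "\<bar>y (i + k) - a\<bar> \<le> \<delta>"
        using k i False y_eq[of "i + k"] near[of "i + k"] \<delta> by (auto simp: R_def)
    qed (use a in simp)
    moreover have "lift (\<lambda>_. a) = (\<lambda>_. a)" by (simp add: lift_def)
    then have "e (\<lambda>_. a) i = 0" using a(3) win_const[of "axis \<iota> i" a] by (simp add: e_def S_eq)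
    ultimately have "e y i \<le> ?c" by linarith
    moreover have "i \<in> ?N" using False i by auto
    ultimately show ?thesis using False by auto
  qed
  have per: "y (i + int p) = y i" for i
  proof -
    have "w (i + int p) = w i"
      using mod_add_self2[of "i - (m - R)" "int p"] by (simp add: w_def algebra_simps)
    then show ?thesis by (simp add: y_def)
  qed
  have "0 \<le> (\<Sum>n<p. e y (m - R + int n))" by (rule periodic_energy[of y p, OF per])
  also have "\<dots> = (\<Sum>i=m-R..l+R. e y i)"
    by (rule sum.reindex_bij_witness[of _ "\<lambda>i. nat (i - (m - R))" "\<lambda>n. m - R + int n"])
      (use p in auto)
  also have "\<dots> \<le> (\<Sum>i=m-R..l+R. (if m \<le> i \<and> i \<le> l then e x i else 0) + (if i \<in> ?N then ?c else 0))"
    by (intro sum_mono termwise) auto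
  also have "\<dots> = (\<Sum>i=m-R..l+R. if i \<in> {m..l} then e x i else 0) + (\<Sum>i=m-R..l+R. if i \<in> ?N then ?c else 0)"
    by (simp add: sum.distrib)
  also have "(\<Sum>i=m-R..l+R. if i \<in> {m..l} then e x i else 0) = E x (m, l)"
  proof -
    have "{m-R..l+R} \<inter> {m..l} = {m..l}" by (auto simp: R_def)
    then show ?thesis by (simp only: E_def prod.case sum.inter_restrict [symmetric] finite_atLeastAtMost_int)
  qed
  also have "(\<Sum>i=m-R..l+R. if i \<in> ?N then ?c else 0) \<le> K * \<delta>"
  proof -
    have "card ({m-R..l+R} \<inter> ?N) \<le> card ?N" by (intro card_mono) auto
    also have "\<dots> \<le> card {m - R..m + R - 1} + card {l - R + 1..l + R}" by (rule card_Un_le)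
    also have "\<dots> = 4 * r" by (simp add: R_def)
    finally have "real (card ({m-R..l+R} \<inter> ?N)) * ?c \<le> real (4 * r) * ?c"
      using c by (intro mult_right_mono) simp_all
    then show ?thesis
      by (subst sum.inter_restrict [symmetric]) (simp_all add: K_def algebra_simps)
  qed
  finally show ?thesis by simp
qed

lemma E_lower_bound:
  assumes x: "\<And>i. \<alpha> \<le> x i \<and> x i \<le> \<beta>"
  shows "- K * (\<beta> - \<alpha>) \<le> E x (m, l)"
proof (cases "m \<le> l")
  case True
  have "\<bar>x i - \<alpha>\<bar> \<le> \<beta> - \<alpha>" for i using x[of i] by linarith
  then show ?thesis using \<alpha>\<beta> c0_\<alpha> x by (intro cut_energy[where a = \<alpha>] True) auto
next
  case False
  then show ?thesis using K_nonneg \<alpha>\<beta> by (simp add: E_def)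
qed

lemma E_split:
  assumes "m' \<le> m" "m \<le> l" "l \<le> l'"
  shows "E x (m', l') = E x (m', m - 1) + E x (m, l) + E x (l + 1, l')"
proof -
  have "{m'..l'} = ({m'..m - 1} \<union> {m..l}) \<union> {l + 1..l'}" using assms by auto
  moreover have "sum (e x) (({m'..m - 1} \<union> {m..l}) \<union> {l + 1..l'})
      = sum (e x) ({m'..m - 1} \<union> {m..l}) + sum (e x) {l + 1..l'}"
    using assms by (intro sum.union_disjoint) auto
  moreover have "sum (e x) ({m'..m - 1} \<union> {m..l}) = sum (e x) {m'..m - 1} + sum (e x) {m..l}"
    by (intro sum.union_disjoint) auto
  ultimately show ?thesis by (simp add: E_def)
qed

end

section \<open>Minimal heteroclinic chains\<close>

lemma eventually_both_ends:
  fixes Q :: "int \<times> int \<Rightarrow> bool"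
  shows "eventually Q (at_bot \<times>\<^sub>F at_top) \<longleftrightarrow> (\<exists>N. \<forall>m l. m \<le> - N \<longrightarrow> N \<le> l \<longrightarrow> Q (m, l))"
proof
  assume "eventually Q (at_bot \<times>\<^sub>F at_top)"
  then obtain A B where AB: "eventually A at_bot" "eventually B at_top" "\<And>m l. A m \<Longrightarrow> B l \<Longrightarrow> Q (m, l)"
    by (auto simp: eventually_prod_filter)
  then obtain a b where "\<forall>m\<le>a. A m" "\<forall>l\<ge>b. B l"
    by (auto simp: eventually_at_bot_linorder eventually_at_top_linorder)
  then show "\<exists>N. \<forall>m l. m \<le> - N \<longrightarrow> N \<le> l \<longrightarrow> Q (m, l)"
    using AB(3) by (intro exI[of _ "max (- a) b"]) auto
next
  assume "\<exists>N. \<forall>m l. m \<le> - N \<longrightarrow> N \<le> l \<longrightarrow> Q (m, l)"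
  then obtain N where "\<forall>m l. m \<le> - N \<longrightarrow> N \<le> l \<longrightarrow> Q (m, l)" by blast
  then show "eventually Q (at_bot \<times>\<^sub>F at_top)"
    unfolding eventually_prod_filter
    by (intro exI[of _ "\<lambda>m. m \<le> - N"] exI[of _ "\<lambda>l. N \<le> l"])
      (auto simp: eventually_le_at_bot eventually_ge_at_top)
qed

abbreviation ends :: "(int \<times> int) filter" where
  "ends \<equiv> at_bot \<times>\<^sub>F at_top"

lemma ends_nontrivial: "ends \<noteq> bot"
  by (simp add: prod_filter_eq_bot)

lemma tendsto_abs_diff_iff: "((\<lambda>i. \<bar>f i - c\<bar>) \<longlongrightarrow> 0) F \<longleftrightarrow> (f \<longlongrightarrow> (c :: real)) F"
  by (simp only: tendsto_rabs_zero_iff LIM_zero_iff)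

context chain
begin

definition het :: "(int \<Rightarrow> real) \<Rightarrow> bool" where
  "het x \<longleftrightarrow> (\<forall>i. \<alpha> \<le> x i \<and> x i \<le> \<beta>) \<and> (x \<longlongrightarrow> \<alpha>) at_bot \<and> (x \<longlongrightarrow> \<beta>) at_top"

lemma Gamma1_eq: "Gamma1 \<iota> (\<lambda>_. \<alpha>) (\<lambda>_. \<beta>) = lift ` {x. het x}"
proof (intro equalityI subsetI)
  fix u assume "u \<in> Gamma1 \<iota> (\<lambda>_. \<alpha>) (\<lambda>_. \<beta>)"
  then have u: "\<And>i j. i $ \<iota> = j $ \<iota> \<Longrightarrow> u i = u j" "\<And>i. \<alpha> \<le> u i" "\<And>i. u i \<le> \<beta>"
    "((\<lambda>i. \<bar>u (axis \<iota> i) - \<alpha>\<bar>) \<longlongrightarrow> 0) at_bot" "((\<lambda>i. \<bar>u (axis \<iota> i) - \<beta>\<bar>) \<longlongrightarrow> 0) at_top"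
    unfolding Gamma1_def le_fun_def by blast+
  let ?x = "\<lambda>i. u (axis \<iota> i)"
  have "u = lift ?x" by (rule ext) (auto simp: lift_def intro: u(1))
  moreover have "het ?x" using u(2,3) u(4,5) [unfolded tendsto_abs_diff_iff] by (simp add: het_def)
  ultimately show "u \<in> lift ` {x. het x}" by blast
next
  fix u assume "u \<in> lift ` {x. het x}"
  then show "u \<in> Gamma1 \<iota> (\<lambda>_. \<alpha>) (\<lambda>_. \<beta>)"
    unfolding Gamma1_def tendsto_abs_diff_iff by (auto simp: het_def le_fun_def)
qed

lemma J1_lift: "J1 r s \<iota> (lift x) = Liminf ends (\<lambda>p. ereal (E x p))"
  by (simp add: J1_def E_def e_def case_prod_unfold)

lemma step_energy_bounded:
  "Liminf ends (\<lambda>p. ereal (E (\<lambda>i. if i < 0 then \<alpha> else \<beta>) p)) < \<infinity>"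
proof -
  let ?x = "\<lambda>i::int. if i < 0 then \<alpha> else \<beta>"
  have comp: "\<bar>k $ \<iota>\<bar> \<le> int r" if "k \<in> B r" for k :: "'n lattice"
    using component_le_l1norm[of k \<iota>] that by (simp add: B_def)
  have zero: "e ?x i = 0" if "\<not> (- int r \<le> i \<and> i \<le> int r)" for i
  proof (cases "i < - int r")
    case True
    have "win (axis \<iota> i) (lift ?x) = win 0 (\<lambda>_. \<alpha>)"
      unfolding win_lift using comp True by (force simp: win_def fun_eq_iff)
    then show ?thesis using c0_\<alpha> by (simp add: e_def S_eq)
  next
    case False
    then have "i > int r" using that by linarith
    then have "win (axis \<iota> i) (lift ?x) = win 0 (\<lambda>_. \<beta>)"
      unfolding win_lift using comp by (force simp: win_def fun_eq_iff)
    then show ?thesis using c0_\<beta> by (simp add: e_def S_eq)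
  qed
  have const: "E ?x (m, l) = E ?x (- int r, int r)" if "m \<le> - int r" "int r \<le> l" for m l
    unfolding E_def prod.case by (rule sum.mono_neutral_right) (use that zero in auto)
  then have "eventually (\<lambda>p. ereal (E ?x p) \<le> ereal (E ?x (- int r, int r))) ends"
    unfolding eventually_both_ends
  proof (intro exI[of _ "int r"] allI impI)
    fix m l assume "m \<le> - int r" "int r \<le> l"
    from const[OF this] show "ereal (E ?x (m, l)) \<le> ereal (E ?x (- int r, int r))" by simp
  qed
  from Liminf_le[OF ends_nontrivial this] show ?thesis
    by (rule le_less_trans) simp
qed

definition cmin :: real where
  "cmin = real_of_ereal (c1 r s \<iota> (\<lambda>_. \<alpha>) (\<lambda>_. \<beta>))"

lemma c1_eq: "c1 r s \<iota> (\<lambda>_. \<alpha>) (\<lambda>_. \<beta>) = ereal cmin"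
proof -
  let ?c = "c1 r s \<iota> (\<lambda>_. \<alpha>) (\<lambda>_. \<beta>)"
  let ?x = "\<lambda>i::int. if i < 0 then \<alpha> else \<beta>"
  have "(?x \<longlongrightarrow> \<alpha>) at_bot"
    by (rule tendsto_eventually) (auto simp: eventually_at_bot_linorder intro!: exI[of _ "-1"])
  moreover have "(?x \<longlongrightarrow> \<beta>) at_top"
    by (rule tendsto_eventually) (auto simp: eventually_at_top_linorder intro!: exI[of _ "0"])
  ultimately have "het ?x" using \<alpha>\<beta> by (simp add: het_def)
  then have "?c \<le> J1 r s \<iota> (lift ?x)" unfolding c1_def Gamma1_eq by (intro INF_lower) auto
  then have "?c < \<infinity>" unfolding J1_lift by (rule le_less_trans[OF _ step_energy_bounded])
  moreover have "ereal (- K * (\<beta> - \<alpha>)) \<le> ?c"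
    unfolding c1_def Gamma1_eq
  proof (intro INF_greatest, clarsimp simp: J1_lift)
    fix x assume "het x"
    then have "\<And>p. - K * (\<beta> - \<alpha>) \<le> E x p" using E_lower_bound[of x] by (auto simp: het_def)
    then show "ereal (- (K * (\<beta> - \<alpha>))) \<le> Liminf ends (\<lambda>p. ereal (E x p))"
      by (intro Liminf_bounded always_eventually) simp
  qed
  then have "- \<infinity> < ?c" by (cases ?c) auto
  ultimately show ?thesis unfolding cmin_def by (cases ?c) auto
qed

lemma cmin_le: "het x \<Longrightarrow> ereal cmin \<le> Liminf ends (\<lambda>p. ereal (E x p))"
  unfolding c1_eq [symmetric] c1_def Gamma1_eq J1_lift [symmetric] by (intro INF_lower) auto

text \<open>Far out, a heteroclinic chain is close to \<open>\<alpha>\<close> or \<open>\<beta>\<close>, so its tails contribute almost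
  nothing negative and the partial sums are almost monotone.\<close>

lemma tails_nonneg:
  assumes x: "het x" and "0 < \<epsilon>"
  shows "\<exists>N. (\<forall>m l. m \<le> l \<longrightarrow> l \<le> - N \<longrightarrow> - \<epsilon> \<le> E x (m, l)) \<and>
    (\<forall>m l. N \<le> m \<longrightarrow> m \<le> l \<longrightarrow> - \<epsilon> \<le> E x (m, l))"
proof -
  define \<delta> where "\<delta> = \<epsilon> / (K + 1)"
  have \<delta>: "0 < \<delta>" "K * \<delta> \<le> \<epsilon>" using K_nonneg \<open>0 < \<epsilon>\<close> by (auto simp: \<delta>_def field_simps)
  have bd: "\<And>i. \<alpha> \<le> x i \<and> x i \<le> \<beta>" using x by (simp add: het_def)
  have "\<forall>\<^sub>F i in at_bot. \<bar>x i - \<alpha>\<bar> < \<delta>" "\<forall>\<^sub>F i in at_top. \<bar>x i - \<beta>\<bar> < \<delta>"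
    using x \<delta>(1) by (auto simp: het_def tendsto_iff dist_real_def)
  then obtain a b where a: "\<And>i. i \<le> a \<Longrightarrow> \<bar>x i - \<alpha>\<bar> < \<delta>" and b: "\<And>i. b \<le> i \<Longrightarrow> \<bar>x i - \<beta>\<bar> < \<delta>"
    by (auto simp: eventually_at_bot_linorder eventually_at_top_linorder)
  define N where "N = max (int r - a) (b + int r)"
  have "- \<epsilon> \<le> E x (m, l)" if "m \<le> l" "l \<le> - N" for m l
  proof -
    have "- K * \<delta> \<le> E x (m, l)"
      using that \<alpha>\<beta> c0_\<alpha> by (intro cut_energy[where a = \<alpha>] bd less_imp_le[OF a]) (auto simp: N_def)
    then show ?thesis using \<delta> by simp
  qed
  moreover have "- \<epsilon> \<le> E x (m, l)" if "N \<le> m" "m \<le> l" for m l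
  proof -
    have "- K * \<delta> \<le> E x (m, l)"
      using that \<alpha>\<beta> c0_\<beta> by (intro cut_energy[where a = \<beta>] bd less_imp_le[OF b]) (auto simp: N_def)
    then show ?thesis using \<delta> by simp
  qed
  ultimately show ?thesis by blast
qed

text \<open>
  A window whose energy is close to the lower limit exists arbitrarily far out.  Shrinking it to a
  prescribed window removes two tails, whose energy is almost nonnegative, so the
  energy of the prescribed window cannot be much larger either.
\<close>

lemma E_tendsto:
  assumes x: "het x" and lim: "Liminf ends (\<lambda>p. ereal (E x p)) = ereal c"
  shows "(E x \<longlongrightarrow> c) ends"
  unfolding tendsto_iff
proof (intro allI impI)
  fix \<epsilon> :: real assume "0 < \<epsilon>"
  then have \<epsilon>: "0 < \<epsilon> / 3" by simp
  have "eventually (\<lambda>p. ereal (c - \<epsilon>) < ereal (E x p)) ends"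
    using lim \<open>0 < \<epsilon>\<close> by (intro less_LiminfD) simp
  then have low: "eventually (\<lambda>p. c - \<epsilon> < E x p) ends" by simp
  obtain N where left: "\<And>m l. m \<le> l \<Longrightarrow> l \<le> - N \<Longrightarrow> - (\<epsilon> / 3) \<le> E x (m, l)"
    and right: "\<And>m l. N \<le> m \<Longrightarrow> m \<le> l \<Longrightarrow> - (\<epsilon> / 3) \<le> E x (m, l)"
    using tails_nonneg[OF x \<epsilon>] by blast
  have "E x (m, l) < c + \<epsilon>" if "m \<le> - max N 0" "max N 0 \<le> l" for m l
  proof -
    have "\<not> eventually (\<lambda>p. c + \<epsilon> / 3 \<le> E x p) ends"
    proof
      assume "eventually (\<lambda>p. c + \<epsilon> / 3 \<le> E x p) ends"
      then have "ereal (c + \<epsilon> / 3) \<le> Liminf ends (\<lambda>p. ereal (E x p))"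
        by (intro Liminf_bounded) simp
      then show False using lim \<epsilon> by simp
    qed
    then have "\<not> (\<forall>m' l'. m' \<le> - max (1 - m) (l + 1) \<longrightarrow> max (1 - m) (l + 1) \<le> l' \<longrightarrow>
        c + \<epsilon> / 3 \<le> E x (m', l'))"
      unfolding eventually_both_ends by blast
    then obtain m' l' where "m' \<le> - max (1 - m) (l + 1)" "max (1 - m) (l + 1) \<le> l'"
      and less: "E x (m', l') < c + \<epsilon> / 3" by (auto simp only: not_all not_imp not_le)
    then have ml': "m' \<le> m - 1" "l + 1 \<le> l'" by auto
    then have "E x (m', l') = E x (m', m - 1) + E x (m, l) + E x (l + 1, l')"
      using that by (intro E_split) auto
    moreover have "- (\<epsilon> / 3) \<le> E x (m', m - 1)" using that ml' by (intro left) auto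
    moreover have "- (\<epsilon> / 3) \<le> E x (l + 1, l')" using that ml' by (intro right) auto
    ultimately show ?thesis using less by linarith
  qed
  then have "eventually (\<lambda>p. E x p < c + \<epsilon>) ends"
    unfolding eventually_both_ends by blast
  with low show "eventually (\<lambda>p. dist (E x p) c < \<epsilon>) ends"
    by eventually_elim (auto simp: dist_real_def)
qed

lemma Liminf_E: "(E x \<longlongrightarrow> c) ends \<Longrightarrow> Liminf ends (\<lambda>p. ereal (E x p)) = ereal c"
  by (intro lim_imp_Liminf ends_nontrivial tendsto_ereal)

definition minimal :: "(int \<Rightarrow> real) \<Rightarrow> bool" where
  "minimal x \<longleftrightarrow> het x \<and> (E x \<longlongrightarrow> cmin) ends"

lemma M1_eq: "M1 r s \<iota> (\<lambda>_. \<alpha>) (\<lambda>_. \<beta>) = lift ` {x. minimal x}"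
proof -
  have "J1 r s \<iota> (lift x) = ereal cmin \<longleftrightarrow> (E x \<longlongrightarrow> cmin) ends" if "het x" for x
    unfolding J1_lift using E_tendsto[OF that] Liminf_E by blast
  then show ?thesis unfolding M1_def Gamma1_eq c1_eq minimal_def by blast
qed

text \<open>Submodularity holds for every partial sum, and the partial sums of minimal chains converge;
  the excess of one of \<open>max\<close>, \<open>min\<close> would have to be compensated by a deficit of the other.\<close>

lemma minimal_max_min:
  assumes x: "minimal x" and y: "minimal y"
  shows "minimal (\<lambda>i. max (x i) (y i))" and "minimal (\<lambda>i. min (x i) (y i))"
proof -
  let ?u = "\<lambda>i. max (x i) (y i)" and ?v = "\<lambda>i. min (x i) (y i)"
  have hx: "het x" and hy: "het y" and Ex: "(E x \<longlongrightarrow> cmin) ends" and Ey: "(E y \<longlongrightarrow> cmin) ends"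
    using x y by (auto simp: minimal_def)
  have hu: "het ?u"
    using hx hy tendsto_max[of x \<alpha> at_bot y \<alpha>] tendsto_max[of x \<beta> at_top y \<beta>]
    by (auto simp: het_def le_max_iff_disj)
  have hv: "het ?v"
    using hx hy tendsto_min[of x \<alpha> at_bot y \<alpha>] tendsto_min[of x \<beta> at_top y \<beta>]
    by (auto simp: het_def min_le_iff_disj)
  have e_sub: "e ?u i + e ?v i \<le> e x i + e y i" for i
    using S_submodular[of "axis \<iota> i" "lift x" "lift y"] by (simp add: e_def lift_def)
  have sub: "E ?u p + E ?v p \<le> E x p + E y p" for p
    using sum_mono[of "{fst p..snd p}", OF e_sub]
    by (simp add: E_def case_prod_unfold sum.distrib)
  have low: "eventually (\<lambda>p. cmin - \<epsilon> < E z p) ends" if "het z" "0 < \<epsilon>" for z \<epsilon>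
  proof -
    have "ereal (cmin - \<epsilon>) < ereal cmin" using that by simp
    also have "\<dots> \<le> Liminf ends (\<lambda>p. ereal (E z p))" by (rule cmin_le[OF that(1)])
    finally show ?thesis using less_LiminfD by fastforce
  qed
  \<comment> \<open>Both are at least almost \<open>cmin\<close>, and their sum is at most almost \<open>2 * cmin\<close>.\<close>
  have sum: "eventually (\<lambda>p. \<bar>E ?u p - cmin\<bar> < \<epsilon> \<and> \<bar>E ?v p - cmin\<bar> < \<epsilon>) ends" if "0 < \<epsilon>" for \<epsilon>
  proof -
    have \<epsilon>: "0 < \<epsilon> / 3" using that by simp
    have "eventually (\<lambda>p. \<bar>E x p - cmin\<bar> < \<epsilon> / 3) ends" "eventually (\<lambda>p. \<bar>E y p - cmin\<bar> < \<epsilon> / 3) ends"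
      using Ex Ey \<epsilon> unfolding tendsto_iff dist_real_def by blast+
    with low[OF hu \<epsilon>] low[OF hv \<epsilon>] show ?thesis
    proof eventually_elim
      case (elim p)
      then show ?case using sub[of p] by linarith
    qed
  qed
  have "(E ?u \<longlongrightarrow> cmin) ends" "(E ?v \<longlongrightarrow> cmin) ends"
    unfolding tendsto_iff dist_real_def using sum by (auto simp: eventually_conj_iff)
  with hu hv show "minimal ?u" "minimal ?v" by (auto simp: minimal_def)
qed

lemma minimal_translate:
  assumes "minimal x"
  shows "minimal (\<lambda>i. x (i + 1))"
proof -
  have e: "e (\<lambda>i. x (i + 1)) i = e x (i + 1)" for i
    by (simp add: e_def S_eq win_lift add_ac)
  have "E (\<lambda>i. x (i + 1)) = (\<lambda>p. E x (fst p + 1, snd p + 1))"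
  proof
    fix p :: "int \<times> int"
    show "E (\<lambda>i. x (i + 1)) p = E x (fst p + 1, snd p + 1)"
      unfolding E_def case_prod_unfold fst_conv snd_conv e
      by (rule sum.reindex_bij_witness[of _ "\<lambda>i. i - 1" "\<lambda>i. i + 1"]) auto
  qed
  moreover have "filterlim (\<lambda>p. (fst p + 1, snd p + 1)) ends ends"
    unfolding filterlim_iff eventually_both_ends
  proof (intro allI impI)
    fix Q :: "int \<times> int \<Rightarrow> bool"
    assume "\<exists>N. \<forall>m l. m \<le> - N \<longrightarrow> N \<le> l \<longrightarrow> Q (m, l)"
    then obtain N where N: "\<And>m l. m \<le> - N \<Longrightarrow> N \<le> l \<Longrightarrow> Q (m, l)" by blast
    show "\<exists>N. \<forall>m l. m \<le> - N \<longrightarrow> N \<le> l \<longrightarrow> Q (fst (m, l) + 1, snd (m, l) + 1)"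
      by (intro exI[of _ "N + 1"]) (auto intro: N)
  qed
  ultimately have "(E (\<lambda>i. x (i + 1)) \<longlongrightarrow> cmin) ends"
    using assms filterlim_compose by (auto simp: minimal_def)
  moreover have "filterlim (\<lambda>i::int. i + 1) at_bot at_bot" "filterlim (\<lambda>i::int. i + 1) at_top at_top"
    unfolding filterlim_at_bot filterlim_at_top eventually_at_bot_linorder eventually_at_top_linorder
    by presburger+
  ultimately show ?thesis
    using assms filterlim_compose by (auto simp: minimal_def het_def)
qed

text \<open>With all transversal periods equal to 1 the cylinder is a line and its energies are chain energies.\<close>

sublocale one: potential_strip r s C cB \<iota> "\<lambda>_. Suc 0"
  by unfold_locales simp

lemma slice_one: "slice \<iota> (\<lambda>_. Suc 0) i = {axis \<iota> i}"
proof -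
  have "j = axis \<iota> i" if "j \<in> slice \<iota> (\<lambda>_. Suc 0) i" for j
  proof -
    have "j $ k = axis \<iota> i $ k" for k
      using that by (cases "k = \<iota>") (force simp: slice_def cylinder_def axis_def)+
    then show ?thesis by (simp add: vec_eq_iff)
  qed
  then show ?thesis using one.axis_in_slice by auto
qed

lemma P_lift: "one.P (lift x) = E x"
  by (simp add: one.P_def E_def e_def slice_one)

lemma grad_lift: "grad (lift x) j = grad (lift x) (axis \<iota> (j $ \<iota>))"
  by (simp add: grad_def win_lift)

lemma periodic_lift: "periodic \<iota> q (lift x)"
  by (simp add: periodic_def axis_def)

text \<open>
  Along constants the derivative of the energy per site is \<open>grad\<close>, by the translation invariance of
  the windows.  Minimality makes the linear term of the expansion vanish.
\<close>

lemma const_solution: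
  assumes a: "S r s 0 (\<lambda>_. a) = c0 r s"
  shows "solution r s (\<lambda>_. a)"
proof -
  define g where "g = (\<Sum>k\<in>B r. ds k (win 0 (\<lambda>_. a)))"
  define M where "M = C * cB * cB"
  have M: "0 \<le> M" using C_nonneg cB_ge_1 by (simp add: M_def)
  have "0 \<le> g * t + M * t\<^sup>2" for t
  proof -
    have "\<bar>S r s 0 (\<lambda>_. a + t) - S r s 0 (\<lambda>_. a) - (\<Sum>k\<in>B r. ds k (win 0 (\<lambda>_. a)) * t)\<bar>
        \<le> C * cB * (\<Sum>k\<in>(B r :: 'n lattice set). t\<^sup>2)"
      unfolding S_eq using s_second_order[OF win_RB win_RB, of 0 "\<lambda>_. a + t" 0 "\<lambda>_. a"] by simp
    then show ?thesis using c0_le[of "a + t"] a by (simp add: g_def M_def sum_distrib_right cB)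
  qed
  note quad = this
  define z where "z = g / (M + 1)"
  have g: "g = z * (M + 1)" using M by (simp add: z_def)
  have "g * (- z) + M * (- z)\<^sup>2 = - z\<^sup>2"
    unfolding g by (simp add: power2_eq_square algebra_simps)
  then have "z = 0" using quad[of "- z"] by simp
  then have "g = 0" by (simp add: g)
  moreover have "grad (\<lambda>_. a) i = g" for i
    unfolding g_def grad_def by (intro sum.cong refl arg_cong[where f = "ds _"] win_const)
  ultimately show ?thesis by (simp add: solution_iff)
qed

text \<open>Moving a single layer of the lattice by one descent step keeps a chain heteroclinic, because
  the step is monotone and fixes the constants \<open>\<alpha>\<close> and \<open>\<beta>\<close>; so a minimal chain has no gradient.\<close>

lemma minimal_solution:
  assumes x: "minimal x"
  shows "solution r s (lift x)"
proof -
  have "grad (lift x) (axis \<iota> i0) = 0" for i0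
  proof (rule ccontr)
    assume g: "grad (lift x) (axis \<iota> i0) \<noteq> 0"
    define t where "t = - \<eta> * grad (lift x) (axis \<iota> i0)"
    have t: "t \<noteq> 0" using g eta_pos by (simp add: t_def)
    define h where "h = lift ((\<lambda>_. 0)(i0 := t))"
    have bd: "\<And>i. \<alpha> \<le> x i \<and> x i \<le> \<beta>" using x by (simp add: minimal_def het_def)
    have h: "h \<in> one.\<Lambda>"
    proof -
      have "(\<lambda>j. \<bar>h j\<bar>) summable_on {axis \<iota> i0}" by simp
      then have "(\<lambda>j. \<bar>h j\<bar>) summable_on one.cyl"
      proof (rule summable_on_cong_neutral[THEN iffD1, rotated -1])
        fix j assume "j \<in> one.cyl - {axis \<iota> i0}"
        then have "j $ \<iota> \<noteq> i0" using slice_one[of i0] by (auto simp: slice_def)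
        then show "\<bar>h j\<bar> = 0" by (simp add: h_def)
      next
        show "\<And>j. j \<in> {axis \<iota> i0} - one.cyl \<Longrightarrow> \<bar>h j\<bar> = 0" by (auto simp: cylinder_def axis_def)
      qed simp
      then show ?thesis by (simp add: one.Lambda_iff h_def periodic_lift)
    qed
    have "one.dE (lift x) h \<le> - (\<Sum>\<^sub>\<infinity>j\<in>one.cyl. (h j)\<^sup>2) / (2 * \<eta>)"
    proof (rule one.descent[OF periodic_lift _ h])
      show "\<alpha> \<le> lift x i \<and> lift x i \<le> \<beta>" for i using bd by simp
      show "h j = 0 \<or> h j = - \<eta> * grad (lift x) j" for j
        using grad_lift[of x j] by (auto simp: h_def t_def)
    qed
    moreover have "0 < (\<Sum>\<^sub>\<infinity>j\<in>one.cyl. (h j)\<^sup>2)"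
    proof -
      have "axis \<iota> i0 \<in> one.cyl" by (auto simp: cylinder_def axis_def)
      from one.square_le_infsum[OF h this] have "t\<^sup>2 \<le> (\<Sum>\<^sub>\<infinity>j\<in>one.cyl. (h j)\<^sup>2)"
        by (simp add: h_def)
      moreover have "0 < t\<^sup>2" using t by simp
      ultimately show ?thesis by (rule less_le_trans[rotated])
    qed
    ultimately have neg: "one.dE (lift x) h < 0"
    proof -
      assume le: "one.dE (lift x) h \<le> - (\<Sum>\<^sub>\<infinity>j\<in>one.cyl. (h j)\<^sup>2) / (2 * \<eta>)"
        and "0 < (\<Sum>\<^sub>\<infinity>j\<in>one.cyl. (h j)\<^sup>2)"
      then have "- (\<Sum>\<^sub>\<infinity>j\<in>one.cyl. (h j)\<^sup>2) / (2 * \<eta>) < 0"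
        using eta_pos by (intro divide_neg_pos) simp_all
      with le show ?thesis by linarith
    qed
    let ?x = "x(i0 := x i0 + t)"
    have lift': "lift ?x = (\<lambda>i. lift x i + h i)" by (auto simp: h_def fun_eq_iff)
    have "(one.P (\<lambda>i. lift x i + h i) \<longlongrightarrow> cmin + one.dE (lift x) h) ends"
      using x bd by (intro one.P_perturbed[OF periodic_lift _ h]) (auto simp: P_lift minimal_def)
    then have "(E ?x \<longlongrightarrow> cmin + one.dE (lift x) h) ends" by (simp only: P_lift lift' [symmetric])
    from Liminf_E[OF this] neg have less: "Liminf ends (\<lambda>p. ereal (E ?x p)) < ereal cmin" by simp
    have "het ?x"
    proof -
      have "solution r s (\<lambda>_. \<alpha>)" "solution r s (\<lambda>_. \<beta>)" using c0_\<alpha> c0_\<beta> const_solution by auto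
      then have "\<alpha> \<le> x i0 + t" "x i0 + t \<le> \<beta>"
        using step_mono[of "\<lambda>_. \<alpha>" "lift x" "axis \<iota> i0"] step_mono[of "lift x" "\<lambda>_. \<beta>" "axis \<iota> i0"] bd
        by (auto simp: le_fun_def t_def solution_iff)
      moreover have "(?x \<longlongrightarrow> \<alpha>) at_bot"
      proof (rule Lim_transform_eventually)
        show "(x \<longlongrightarrow> \<alpha>) at_bot" using x by (simp add: minimal_def het_def)
        show "\<forall>\<^sub>F i in at_bot. x i = ?x i"
          unfolding eventually_at_bot_linorder by (rule exI[of _ "i0 - 1"]) simp
      qed
      moreover have "(?x \<longlongrightarrow> \<beta>) at_top"
      proof (rule Lim_transform_eventually)
        show "(x \<longlongrightarrow> \<beta>) at_top" using x by (simp add: minimal_def het_def)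
        show "\<forall>\<^sub>F i in at_top. x i = ?x i"
          unfolding eventually_at_top_linorder by (rule exI[of _ "i0 + 1"]) simp
      qed
      ultimately show ?thesis using bd by (simp add: het_def)
    qed
    with cmin_le less show False by (simp add: leD)
  qed
  then show ?thesis unfolding solution_iff by (metis grad_lift)
qed

text \<open>
  The maximum of two minimal chains is a solution lying above both; the strong maximum principle
  excludes that it coincides with one of them at some sites only.
\<close>

lemma minimal_ordered:
  assumes x: "minimal x" and y: "minimal y"
  shows "(\<forall>i. x i < y i) \<or> x = y \<or> (\<forall>i. y i < x i)"
proof (cases "\<exists>a. y a \<le> x a")
  case False
  then show ?thesis by (auto simp: not_le)
next
  case True
  then obtain a where a: "y a \<le> x a" by blast
  let ?u = "\<lambda>i. max (x i) (y i)"
  have eq: "lift x = lift ?u"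
    using a by (intro strong_maximum[OF r_ge_1 _ minimal_solution[OF x]
          minimal_solution[OF minimal_max_min(1)[OF x y]], of "axis \<iota> a"]) (auto simp: le_fun_def)
  have "x i = ?u i" for i using fun_cong[OF eq, of "axis \<iota> i"] by simp
  then have le: "y i \<le> x i" for i by (metis max.cobounded2)
  show ?thesis
  proof (cases "\<exists>b. x b = y b")
    case True
    then obtain b where "x b = y b" by blast
    then have eq: "lift y = lift x"
      using le by (intro strong_maximum[OF r_ge_1 _ minimal_solution[OF y] minimal_solution[OF x],
            of "axis \<iota> b"]) (auto simp: le_fun_def)
    have "y i = x i" for i using fun_cong[OF eq, of "axis \<iota> i"] by simp
    then show ?thesis by auto
  next
    case False
    then show ?thesis using le by (metis less_le)
  qed
qed

text \<open>A chain is comparable with its translate, and its limits \<open>\<alpha> < \<beta>\<close> decide which one is larger.\<close>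

lemma minimal_increasing:
  assumes x: "minimal x"
  shows "x i < x (i + 1)"
proof -
  have lim: "(x \<longlongrightarrow> \<alpha>) at_bot" "(x \<longlongrightarrow> \<beta>) at_top" using x by (auto simp: minimal_def het_def)
  have False if le: "\<forall>i. x (i + 1) \<le> x i"
  proof -
    have anti: "x j \<le> x i" if "i \<le> j" for i j
      using that by (induction j rule: int_ge_induct) (use le order_trans in blast)+
    have "x 0 \<le> \<alpha>"
      by (rule tendsto_lowerbound[OF lim(1)])
        (auto simp: eventually_at_bot_linorder intro!: exI[of _ 0] anti)
    moreover have "\<beta> \<le> x 0"
      by (rule tendsto_upperbound[OF lim(2)])
        (auto simp: eventually_at_top_linorder intro!: exI[of _ 0] anti)
    ultimately show False using \<alpha>\<beta> by linarith
  qed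
  moreover have "\<forall>i. x (i + 1) \<le> x i" if "x = (\<lambda>i. x (i + 1))" using fun_cong[OF that] by (metis order_refl)
  ultimately show ?thesis
    using minimal_ordered[OF x minimal_translate[OF x]] by (metis less_imp_le)
qed

end

section \<open>The gap between two adjacent minimal chains\<close>

locale gap = chain r s C cB \<iota> \<alpha> \<beta> + strip \<iota> q
  for r :: nat and s :: "('n::finite lattice \<Rightarrow> real) \<Rightarrow> real" and C cB :: real
    and \<iota> :: 'n and \<alpha> \<beta> :: real and q :: "'n \<Rightarrow> nat" +
  fixes x1 y1 :: "int \<Rightarrow> real"
  assumes x1: "minimal x1" and y1: "minimal y1" and x1_less_y1: "x1 i < y1 i"
    and no_minimal_between: "minimal z \<Longrightarrow> \<exists>i. \<not> (x1 i < z i \<and> z i < y1 i)"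
begin

sublocale potential_strip r s C cB \<iota> q ..

\<comment> \<open>From here on \<open>lift\<close> stays folded, so that facts about whole configurations apply to the two chains.\<close>
declare lift_apply [simp del]

abbreviation v :: "'n lattice \<Rightarrow> real" where "v \<equiv> lift x1"
abbreviation w :: "'n lattice \<Rightarrow> real" where "w \<equiv> lift y1"

definition D :: "'n lattice \<Rightarrow> real" where
  "D = (\<lambda>j. w j - v j)"

abbreviation G :: "('n lattice \<Rightarrow> real) set" where
  "G \<equiv> G1q \<iota> q v w"

abbreviation N :: real where
  "N \<equiv> real (card (slice \<iota> q 0))"

lemma sum_slice_const: "(\<Sum>j\<in>slice \<iota> q i. c) = N * c"
  by (metis card_slice sum_constant)

lemma D_pos: "0 < D j"
  using x1_less_y1 by (simp add: D_def lift_apply)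

lemma v_sol: "solution r s v" and w_sol: "solution r s w"
  using minimal_solution x1 y1 by auto

lemma x1_bounds: "\<alpha> \<le> x1 i \<and> x1 i \<le> \<beta>" and y1_bounds: "\<alpha> \<le> y1 i \<and> y1 i \<le> \<beta>"
  using x1 y1 by (auto simp: minimal_def het_def)

lemma y1_le_translate: "y1 i \<le> x1 (i + 1)"
proof -
  consider "\<forall>i. y1 i < x1 (i + 1)" | "y1 = (\<lambda>i. x1 (i + 1))" | "\<forall>i. x1 (i + 1) < y1 i"
    using minimal_ordered[OF y1 minimal_translate[OF x1]] by blast
  then show ?thesis
  proof cases
    case 3
    then show ?thesis
      using no_minimal_between[OF minimal_translate[OF x1]] minimal_increasing[OF x1] by blast
  qed (auto intro: less_imp_le dest: fun_cong[of _ _ i])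
qed

lemma sum_translate_telescope: "(\<Sum>i=m..l. x1 (i + 1) - x1 i) \<le> \<beta> - \<alpha>"
proof (cases "m \<le> l")
  case True
  then have "(\<Sum>i=m..l. x1 (i + 1) - x1 i) = x1 (l + 1) - x1 m"
  proof (induction l rule: int_ge_induct)
    case (step l)
    have "{m..l + 1} = insert (l + 1) {m..l}" using step by auto
    then show ?case using step by simp
  qed simp
  also have "\<dots> \<le> \<beta> - \<alpha>" using x1_bounds[of "l + 1"] x1_bounds[of m] by linarith
  finally show ?thesis .
qed (use \<alpha>\<beta> in simp)

text \<open>The next minimal chain lies below the translate of \<open>x1\<close>, so the gap is summable by telescoping.
  Summability is what makes the energy continuous for pointwise convergence between the two chains.\<close>

lemma D_Lambda: "D \<in> \<Lambda>"
proof -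
  have "D summable_on cyl"
  proof (rule nonneg_bdd_above_summable_on)
    show "bdd_above (sum D ` {F. F \<subseteq> cyl \<and> finite F})"
    proof (rule bdd_aboveI2)
      fix F assume "F \<in> {F. F \<subseteq> cyl \<and> finite F}"
      then have "\<forall>\<^sub>F p in ends. finite (box p) \<and> F \<subseteq> box p \<and> box p \<subseteq> cyl"
        using filterlim_box by (simp add: filterlim_finite_subsets_at_top)
      from eventually_happens[OF this] obtain p where "finite (box p)" "F \<subseteq> box p"
        using ends_nontrivial by auto
      then obtain m l where "finite (box (m, l))" "F \<subseteq> box (m, l)" by (cases p) auto
      then have "sum D F \<le> sum D (box (m, l))"
        using D_pos by (intro sum_mono2) (auto intro: less_imp_le)
      also have "\<dots> = (\<Sum>i=m..l. \<Sum>j\<in>slice \<iota> q i. y1 i - x1 i)"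
        unfolding sum_box by (intro sum.cong) (auto simp: D_def slice_def lift_apply)
      also have "\<dots> = N * (\<Sum>i=m..l. y1 i - x1 i)"
        by (simp only: sum_slice_const sum_distrib_left)
      also have "\<dots> \<le> N * (\<Sum>i=m..l. x1 (i + 1) - x1 i)"
        using y1_le_translate by (intro mult_left_mono sum_mono) auto
      also have "\<dots> \<le> N * (\<beta> - \<alpha>)"
        using sum_translate_telescope by (intro mult_left_mono) auto
      finally show "sum D F \<le> N * (\<beta> - \<alpha>)" .
    qed
  qed (use D_pos in \<open>auto intro: less_imp_le\<close>)
  then show ?thesis
    using D_pos by (simp add: Lambda_iff less_imp_le periodic_def D_def axis_def lift_apply)
qed

lemma D_summable: "D summable_on cyl"
  using D_Lambda D_pos by (simp add: Lambda_iff less_imp_le)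

lemma G_iff: "u \<in> G \<longleftrightarrow> periodic \<iota> q u \<and> (\<forall>j. 0 \<le> u j \<and> u j \<le> D j)"
proof -
  have "u \<in> \<Lambda>" if "periodic \<iota> q u" "\<forall>j. 0 \<le> u j \<and> u j \<le> D j"
    using that by (intro Lambda_dominated[OF _ D_Lambda]) (auto intro: order_trans)
  then show ?thesis by (auto simp: G1q_def D_def Lambda_iff)
qed

lemma G_Lambda: "u \<in> G \<Longrightarrow> u \<in> \<Lambda>"
  by (simp add: G1q_def)

lemma G_bounds: "u \<in> G \<Longrightarrow> v j \<le> v j + u j \<and> v j + u j \<le> w j"
  by (auto simp: G1q_def algebra_simps)

lemma G_bounds': "u \<in> G \<Longrightarrow> \<alpha> \<le> v j + u j \<and> v j + u j \<le> \<beta>"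
  using G_bounds[of u j] x1_bounds[of "j $ \<iota>"] y1_bounds[of "j $ \<iota>"] by (simp add: lift_apply)

lemma zero_G: "(\<lambda>_. 0) \<in> G" and D_G: "D \<in> G"
  using D_pos D_Lambda by (auto simp: G_iff less_imp_le periodic_def Lambda_iff)

lemma v_plus_D: "(\<lambda>j. v j + D j) = w"
  by (auto simp: D_def)

lemma periodic_v_plus: "periodic \<iota> q u \<Longrightarrow> periodic \<iota> q (\<lambda>j. v j + u j)"
  by (simp add: periodic_def axis_def lift_apply)


subsection \<open>The energy relative to the lower chain\<close>

abbreviation F :: "('n lattice \<Rightarrow> real) \<Rightarrow> real" where
  "F \<equiv> dE v"

lemma P_lift_slices: "P (lift x) p = N * E x p"
proof -
  have "(\<Sum>j\<in>slice \<iota> q i. S r s j (lift x) - c0 r s) = N * e x i" for i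
  proof -
    have "(\<Sum>j\<in>slice \<iota> q i. S r s j (lift x) - c0 r s) = (\<Sum>j\<in>slice \<iota> q i. e x i)"
      by (intro sum.cong) (auto simp: S_lift slice_def)
    then show ?thesis by (simp only: sum_slice_const)
  qed
  then show ?thesis by (simp add: P_def E_def case_prod_unfold sum_distrib_left)
qed

lemma P_lift_tendsto: "(E x \<longlongrightarrow> a) ends \<Longrightarrow> (P (lift x) \<longlongrightarrow> N * a) ends"
  unfolding P_lift_slices [abs_def] by (rule tendsto_mult_left)

lemma P_v: "(P v \<longlongrightarrow> N * cmin) ends" and P_w: "(P w \<longlongrightarrow> N * cmin) ends"
  using x1 y1 by (auto simp: minimal_def intro: P_lift_tendsto)

lemma v_bounds: "\<alpha> \<le> v i \<and> v i \<le> \<beta>"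
  using x1_bounds by (simp add: lift_apply)

lemma P_v_plus: "u \<in> \<Lambda> \<Longrightarrow> (P (\<lambda>j. v j + u j) \<longlongrightarrow> N * cmin + F u) ends"
  by (rule P_perturbed[OF periodic_lift v_bounds _ P_v])

lemma I_eq: "u \<in> \<Lambda> \<Longrightarrow> I1q r s \<iota> q v u = ereal (N * cmin + F u)"
  using Liminf_P[OF P_v_plus] by (simp add: I1q_def P_def case_prod_unfold add.commute)

lemma F_D: "F D = 0"
  using tendsto_unique[OF ends_nontrivial P_w P_v_plus[OF D_Lambda, unfolded v_plus_D]] by simp

lemma F_add:
  "u \<in> G \<Longrightarrow> h \<in> \<Lambda> \<Longrightarrow> F (\<lambda>j. u j + h j) = F u + dE (\<lambda>j. v j + u j) h"
  using dE_add[of v \<alpha> \<beta> u h] periodic_lift v_bounds G_Lambda G_bounds'[of u] by blast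

text \<open>
  The descent step in coordinates relative to \<open>v\<close>.  It maps \<open>G\<close> into itself, since it is monotone and
  fixes both ends of the order interval, so it takes the place of the gradient flow.
\<close>

definition T :: "('n lattice \<Rightarrow> real) \<Rightarrow> 'n lattice \<Rightarrow> real" where
  "T u = (\<lambda>j. u j - \<eta> * grad (\<lambda>i. v i + u i) j)"

lemma T_zero: "T (\<lambda>_. 0) = (\<lambda>_. 0)" and T_D: "T D = D"
  using v_sol w_sol v_plus_D by (auto simp: T_def solution_iff)

lemma T_G:
  assumes u: "u \<in> G"
  shows "T u \<in> G"
proof -
  have per: "periodic \<iota> q u" using u by (simp add: G_iff)
  have "periodic \<iota> q (T u)"
    using per periodic_grad[OF periodic_v_plus[OF per]] by (simp add: periodic_def T_def)
  moreover have "0 \<le> T u j \<and> T u j \<le> D j" for j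
  proof -
    have "v j - \<eta> * grad v j \<le> (v j + u j) - \<eta> * grad (\<lambda>i. v i + u i) j"
      "(v j + u j) - \<eta> * grad (\<lambda>i. v i + u i) j \<le> w j - \<eta> * grad w j"
      using G_bounds[OF u] step_mono[of v "\<lambda>i. v i + u i" j] step_mono[of "\<lambda>i. v i + u i" w j]
      by (auto simp: le_fun_def)
    moreover have "grad v j = 0" "grad w j = 0" using v_sol w_sol by (auto simp: solution_iff)
    ultimately show ?thesis by (simp add: T_def D_def)
  qed
  ultimately show ?thesis by (simp add: G_iff)
qed

lemma T_descent:
  assumes u: "u \<in> G"
  shows "F (T u) \<le> F u - (\<Sum>\<^sub>\<infinity>j\<in>cyl. (T u j - u j)\<^sup>2) / (2 * \<eta>)"
proof -
  let ?h = "\<lambda>j. T u j - u j"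
  have h: "?h \<in> \<Lambda>" using u T_G by (intro Lambda_diff G_Lambda)
  have "periodic \<iota> q u" using u by (simp add: G_iff)
  then have "dE (\<lambda>j. v j + u j) ?h \<le> - (\<Sum>\<^sub>\<infinity>j\<in>cyl. (?h j)\<^sup>2) / (2 * \<eta>)"
    by (intro descent[OF periodic_v_plus G_bounds' h] u) (auto simp: T_def)
  moreover have "F (T u) = F u + dE (\<lambda>j. v j + u j) ?h"
    using F_add[OF u h] by simp
  ultimately show ?thesis by simp
qed

lemma T_le: "u \<in> G \<Longrightarrow> F (T u) \<le> F u"
  using T_descent[of u] eta_pos infsum_nonneg[of cyl "\<lambda>j. (T u j - u j)\<^sup>2"]
  by (smt (verit) divide_nonneg_pos zero_le_power2)

lemma stationary_solution:
  assumes u: "u \<in> G" and "F u \<le> F (T u)"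
  shows "solution r s (\<lambda>j. v j + u j)"
proof -
  let ?b = "\<lambda>j. v j + u j"
  have per: "periodic \<iota> q ?b" using u by (intro periodic_v_plus) (simp add: G_iff)
  have h: "(\<lambda>j. T u j - u j) \<in> \<Lambda>" using u T_G by (intro Lambda_diff G_Lambda)
  have "(\<Sum>\<^sub>\<infinity>j\<in>cyl. (T u j - u j)\<^sup>2) / (2 * \<eta>) \<le> 0"
    using T_descent[OF u] assms(2) by linarith
  then have "(\<Sum>\<^sub>\<infinity>j\<in>cyl. (T u j - u j)\<^sup>2) \<le> 0" using eta_pos by (simp add: divide_le_0_iff)
  then have "(T u j - u j)\<^sup>2 \<le> 0" if "j \<in> cyl" for j
    using square_le_infsum[OF h that] by linarith
  then have zero: "grad ?b j = 0" if "j \<in> cyl" for j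
    using that eta_pos by (simp add: T_def)
  have "grad ?b j = 0" for j
    using zero[OF wrap_in_cyl] periodic_wrap[OF periodic_grad[OF per]] by simp
  then show ?thesis by (simp add: solution_iff)
qed


subsection \<open>Compactness\<close>

text \<open>On \<open>G\<close> the topology of pointwise convergence is used: it makes \<open>G\<close> compact as a closed part of
  a product of intervals, and \<open>F\<close> is continuous because its series is dominated by one in \<open>D\<close>.\<close>

lemma coordinate_continuous: "continuous_on A (\<lambda>u :: 'n lattice \<Rightarrow> real. u i)"
  by (rule continuous_on_subset[OF continuous_on_product_coordinates]) simp

lemma continuous_by_coordinates:
  fixes f :: "('n lattice \<Rightarrow> real) \<Rightarrow> real"
  assumes "finite A"
    and "\<And>u u'. u \<in> U \<Longrightarrow> u' \<in> U \<Longrightarrow> \<bar>f u' - f u\<bar> \<le> M * (\<Sum>k\<in>A. \<bar>u' (\<phi> k) - u (\<phi> k)\<bar>)"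
  shows "continuous_on U f"
  unfolding continuous_on_def
proof
  fix u assume u: "u \<in> U"
  let ?R = "\<lambda>u'. M * (\<Sum>k\<in>A. \<bar>u' (\<phi> k) - u (\<phi> k)\<bar>)"
  have "continuous_on U ?R" by (intro continuous_intros coordinate_continuous)
  then have "(?R \<longlongrightarrow> ?R u) (at u within U)" using u unfolding continuous_on_def by blast
  moreover have R0: "?R u = 0" by simp
  ultimately have "(?R \<longlongrightarrow> 0) (at u within U)" unfolding R0 by blast
  then have "((\<lambda>u'. f u' - f u) \<longlongrightarrow> 0) (at u within U)"
    by (rule Lim_null_comparison[rotated])
      (use assms(2) u in \<open>auto simp: eventually_at_filter intro!: always_eventually\<close>)
  then show "(f \<longlongrightarrow> f u) (at u within U)" by (simp add: LIM_zero_iff)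
qed

lemma compact_G: "compact G"
proof -
  have "compact (Pi\<^sub>E (UNIV :: 'n lattice set) (\<lambda>j. {0..D j}))"
    using compactin_PiE[of "\<lambda>_. euclidean" UNIV "\<lambda>j. {0..D j}"]
    by (simp add: euclidean_product_topology)
  moreover have "closed {u :: 'n lattice \<Rightarrow> real. \<forall>k i. k \<noteq> \<iota> \<longrightarrow> u (i + axis k (int (q k))) = u i}"
    by (intro closed_Collect_all closed_Collect_imp open_Collect_const closed_Collect_eq coordinate_continuous)
  ultimately have "compact (Pi\<^sub>E UNIV (\<lambda>j. {0..D j}) \<inter>
      {u :: 'n lattice \<Rightarrow> real. \<forall>k i. k \<noteq> \<iota> \<longrightarrow> u (i + axis k (int (q k))) = u i})"
    by (rule compact_Int_closed)
  also have "Pi\<^sub>E UNIV (\<lambda>j. {0..D j}) \<inter>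
      {u. \<forall>k i. k \<noteq> \<iota> \<longrightarrow> u (i + axis k (int (q k))) = u i} = G"
    by (auto simp: G_iff periodic_def PiE_iff)
  finally show ?thesis .
qed

lemma S_lipschitz_G:
  assumes "u \<in> G" "u' \<in> G"
  shows "\<bar>S r s j (\<lambda>i. v i + u' i) - S r s j (\<lambda>i. v i + u i)\<bar> \<le> dsb \<alpha> \<beta> * (\<Sum>k\<in>B r. \<bar>u' (j + k) - u (j + k)\<bar>)"
  using S_lipschitz[of \<alpha> "\<lambda>i. v i + u i" \<beta> "\<lambda>i. v i + u' i" j] G_bounds' assms by simp

lemma continuous_F: "continuous_on G F"
proof (rule uniform_limit_theorem)
  let ?f = "\<lambda>j u. S r s j (\<lambda>i. v i + u i) - S r s j v"
  let ?M = "\<lambda>j. dsb \<alpha> \<beta> * (\<Sum>k\<in>B r. D (j + k))"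
  have "(\<lambda>j. \<Sum>k\<in>B r. D (j + k)) summable_on cyl"
    using has_sum_neighbourhoods[OF _ has_sum_infsum[OF D_summable]] D_Lambda
    by (auto simp: Lambda_iff intro: has_sum_imp_summable)
  then have M: "?M summable_on cyl" by (rule summable_on_cmult_right)
  have "norm (?f j u) \<le> ?M j" if u: "u \<in> G" for j u
  proof -
    have "norm (?f j u) \<le> dsb \<alpha> \<beta> * (\<Sum>k\<in>B r. \<bar>u (j + k)\<bar>)"
      using S_lipschitz_G[OF zero_G u, of j] by simp
    also have "\<dots> \<le> ?M j"
      using u dsb_nonneg by (intro mult_left_mono sum_mono) (auto simp: G_iff)
    finally show ?thesis .
  qed
  with M show "uniform_limit G (\<lambda>X u. \<Sum>j\<in>X. ?f j u) F (finite_subsets_at_top cyl)"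
    unfolding dE_def by (intro Weierstrass_m_test_general) auto
  have "continuous_on G (?f j)" for j
    by (rule continuous_by_coordinates[of "B r" G _ "dsb \<alpha> \<beta>" "\<lambda>k. j + k"])
      (use S_lipschitz_G[of _ _ j] in auto)
  then show "\<forall>\<^sub>F X in finite_subsets_at_top cyl. continuous_on G (\<lambda>u. \<Sum>j\<in>X. ?f j u)"
    by (intro always_eventually allI continuous_on_sum)
qed simp

lemma continuous_T: "continuous_on G T"
proof (rule continuous_on_coordinatewise_then_product)
  fix j
  have "continuous_on G (\<lambda>u. grad (\<lambda>i. v i + u i) j)"
    by (rule continuous_by_coordinates[of "B r \<times> B r" G _ C "\<lambda>(k, l). j - k + l"])
      (use grad_lipschitz[of "\<lambda>i. v i + _ i" j "\<lambda>i. v i + _ i"] in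
        \<open>auto simp: sum.cartesian_product case_prod_unfold\<close>)
  then show "continuous_on G (\<lambda>u. T u j)"
    unfolding T_def by (intro continuous_intros coordinate_continuous)
qed

lemma continuous_F_T: "continuous_on G (\<lambda>u. F (T u))"
  by (rule continuous_on_compose2[OF continuous_F continuous_T]) (use T_G in auto)

end

context gap
begin

subsection \<open>The two chains are the only ground states in the gap\<close>

lemma F_translate:
  assumes u: "u \<in> G" and k: "k \<noteq> \<iota>"
  shows "(\<lambda>j. u (j + axis k 1)) \<in> G" and "F (\<lambda>j. u (j + axis k 1)) = F u"
proof -
  let ?a = "axis k 1 :: 'n lattice"
  have lift: "lift x (j + ?a) = lift x j" for x j using k by (simp add: lift_apply axis_def)
  have per: "periodic \<iota> q u" and bd: "\<And>j. 0 \<le> u j \<and> u j \<le> D j" using u by (auto simp: G_iff)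
  show "(\<lambda>j. u (j + ?a)) \<in> G"
    unfolding G_iff
  proof (intro conjI allI)
    show "periodic \<iota> q (\<lambda>j. u (j + ?a))" by (rule periodic_shift[OF per])
    show "0 \<le> u (j + ?a)" for j using bd by blast
    show "u (j + ?a) \<le> D j" for j using bd[of "j + ?a"] lift by (simp add: D_def)
  qed
  let ?f = "\<lambda>j. S r s j (\<lambda>i. v i + u i) - S r s j v"
  have "S r s j (\<lambda>i. v i + u (i + ?a)) - S r s j v = ?f (j + ?a)" for j
    using S_shift[of j "\<lambda>i. v i + u i" ?a] S_shift[of j v ?a] lift by simp
  moreover have "periodic \<iota> q ?f"
    unfolding periodic_def S_eq
    using periodic_win[OF periodic_v_plus[OF per]] periodic_win[OF periodic_lift] by simp
  ultimately show "F (\<lambda>j. u (j + ?a)) = F u"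
    unfolding dE_def using cyl_infsum_shift[of ?f ?a] by simp
qed

lemma F_max_min:
  assumes u: "u \<in> G" and u': "u' \<in> G"
  shows "(\<lambda>j. max (u j) (u' j)) \<in> G" and "(\<lambda>j. min (u j) (u' j)) \<in> G"
    and "F (\<lambda>j. max (u j) (u' j)) + F (\<lambda>j. min (u j) (u' j)) \<le> F u + F u'"
proof -
  let ?M = "\<lambda>j. max (u j) (u' j)" and ?m = "\<lambda>j. min (u j) (u' j)"
  show M: "?M \<in> G" and m: "?m \<in> G"
    using u u' by (auto simp: G_iff periodic_def le_max_iff_disj min_le_iff_disj)
  define f where "f u j = S r s j (\<lambda>i. v i + u i) - S r s j v" for u j
  have sm: "f u summable_on cyl" if "u \<in> G" for u
    unfolding f_def using energy_expansion(1)[OF periodic_lift v_bounds G_Lambda[OF that]] .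
  have F: "F u = infsum (f u) cyl" for u by (simp add: dE_def f_def [abs_def])
  have "f ?M j + f ?m j \<le> f u j + f u' j" for j
    using S_submodular[of j "\<lambda>i. v i + u i" "\<lambda>i. v i + u' i"]
    by (simp add: f_def max_add_distrib_right min_add_distrib_right)
  then have "(\<Sum>\<^sub>\<infinity>j\<in>cyl. f ?M j + f ?m j) \<le> (\<Sum>\<^sub>\<infinity>j\<in>cyl. f u j + f u' j)"
    using M m u u' by (intro infsum_mono summable_on_add sm)
  then show "F ?M + F ?m \<le> F u + F u'"
    unfolding F using M m u u' by (simp add: infsum_add sm)
qed

lemma monotone_periodic_invariant:
  assumes per: "periodic \<iota> q u" and k: "k \<noteq> \<iota>" and mono: "\<And>j. u (j + axis k 1) \<le> u j"
  shows "u (j + axis k 1) = u j"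
proof -
  have step: "u (j + axis k (int (Suc n))) \<le> u (j + axis k 1)" for n
  proof (induction n)
    case (Suc n)
    have "j + axis k (int (Suc (Suc n))) = j + axis k (int (Suc n)) + axis k 1"
      by (simp add: vec_eq_iff axis_def)
    then have "u (j + axis k (int (Suc (Suc n)))) \<le> u (j + axis k (int (Suc n)))"
      using mono by metis
    then show ?case using Suc by linarith
  qed simp
  obtain n where "q k = Suc n" using q_pos[OF k] by (cases "q k") auto
  then have "u (j + axis k (int (q k))) \<le> u (j + axis k 1)" using step[of n] by simp
  moreover have "u (j + axis k (int (q k))) = u j" using per k by (simp add: periodic_def)
  ultimately show ?thesis using mono[of j] by linarith
qed

lemma invariant_is_lift:
  assumes "\<And>k j. k \<noteq> \<iota> \<Longrightarrow> u (j + axis k 1) = u j"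
  shows "u = lift (\<lambda>i. u (axis \<iota> i))"
proof
  fix j
  have "periodic \<iota> (\<lambda>_. Suc 0) u" using assms by (simp add: periodic_def)
  moreover have "one.wrap (- {\<iota>}) j = axis \<iota> (j $ \<iota>)"
    by (auto simp: one.wrap_def axis_def vec_eq_iff)
  ultimately show "u j = lift (\<lambda>i. u (axis \<iota> i)) j"
    using one.periodic_wrap[of u "- {\<iota>}" j] by (simp add: lift_apply)
qed

text \<open>
  A minimizer \<open>u\<close> of \<open>F\<close> is a solution because \<open>T\<close> cannot lower its energy, and so is the maximum
  of \<open>u\<close> and a transversal translate, being a minimizer too.  By the strong maximum principle the
  two are ordered; periodicity makes them equal.  Hence \<open>u\<close> depends on the first coordinate only
  and is one of the chains considered before.
\<close>

lemma minimizer_invariant: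
  assumes u: "u \<in> G" and min: "\<And>u'. u' \<in> G \<Longrightarrow> F u \<le> F u'" and k: "k \<noteq> \<iota>"
  shows "u (j + axis k 1) = u j"
proof -
  let ?u' = "\<lambda>j. u (j + axis k 1)"
  let ?M = "\<lambda>j. max (u j) (?u' j)"
  have per: "periodic \<iota> q u" using u by (simp add: G_iff)
  note u' = F_translate[OF u k]
  note Mm = F_max_min[OF u u'(1)]
  have FM: "F ?M \<le> F u" using Mm(3) min[OF Mm(2)] u'(2) by linarith
  have sol: "solution r s (\<lambda>j. v j + u j)" "solution r s (\<lambda>j. v j + ?M j)"
    using stationary_solution[OF u] stationary_solution[OF Mm(1)] min T_G u Mm(1) FM
    by (blast intro: order_trans)+
  show ?thesis
  proof (cases "\<exists>a. ?u' a \<le> u a")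
    case True
    then obtain a where "?u' a \<le> u a" by blast
    then have eq: "(\<lambda>j. v j + u j) = (\<lambda>j. v j + ?M j)"
      by (intro strong_maximum[OF r_ge_1 _ sol, of a]) (auto simp: le_fun_def)
    have "?u' j \<le> u j" for j using fun_cong[OF eq, of j] by simp
    then show ?thesis by (rule monotone_periodic_invariant[OF per k])
  next
    case False
    have "periodic \<iota> q (\<lambda>j. - u j)" using per by (simp add: periodic_def)
    from monotone_periodic_invariant[OF this k, of j] False show ?thesis
      by (auto simp: not_le less_imp_le)
  qed
qed

lemma minimizer_cases:
  assumes u: "u \<in> G" and min: "\<And>u'. u' \<in> G \<Longrightarrow> F u \<le> F u'"
  shows "F u = 0 \<and> (u = (\<lambda>_. 0) \<or> u = D)"
proof -
  define x where "x i = u (axis \<iota> i)" for i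
  define z where "z i = x1 i + x i" for i
  have ux: "u = lift x"
    unfolding x_def using minimizer_invariant[OF u min] by (rule invariant_is_lift)
  then have vz: "(\<lambda>j. v j + u j) = lift z" by (auto simp: z_def lift_apply)
  have btw: "x1 i \<le> z i \<and> z i \<le> y1 i" for i
    using u by (auto simp: G_iff z_def x_def D_def lift_apply dest: spec[of _ "axis \<iota> i"])
  have "het z"
    unfolding het_def
  proof (intro conjI allI)
    show "\<alpha> \<le> z i" "z i \<le> \<beta>" for i using btw[of i] x1_bounds[of i] y1_bounds[of i] by linarith+
    show "(z \<longlongrightarrow> \<alpha>) at_bot" "(z \<longlongrightarrow> \<beta>) at_top"
      using x1 y1 btw
      by (auto simp: minimal_def het_def intro: tendsto_sandwich[of x1 z _ y1])
  qed
  have "(P (lift z) \<longlongrightarrow> N * cmin + F u) ends"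
    using P_v_plus[OF G_Lambda[OF u]] by (simp only: vz)
  then have "((\<lambda>p. (1 / N) * P (lift z) p) \<longlongrightarrow> (1 / N) * (N * cmin + F u)) ends"
    by (rule tendsto_mult_left)
  moreover have "(1 / N) * P (lift z) p = E z p" for p
    using axis_in_slice[of 0] by (auto simp: P_lift_slices)
  moreover have "(1 / N) * (N * cmin + F u) = cmin + F u / N"
    using axis_in_slice[of 0] by (auto simp: distrib_left)
  ultimately have lim: "(E z \<longlongrightarrow> cmin + F u / N) ends" by simp
  have "cmin \<le> cmin + F u / N" using cmin_le[OF \<open>het z\<close>] Liminf_E[OF lim] by simp
  then have "0 \<le> F u" using axis_in_slice[of 0] by (auto simp: zero_le_divide_iff)
  moreover have "F u \<le> 0" using min[OF zero_G] by simp
  ultimately have F0: "F u = 0" by simp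
  with lim \<open>het z\<close> have z: "minimal z" by (simp add: minimal_def)
  have "x1 = z \<or> (\<forall>i. x1 i < z i)"
    using minimal_ordered[OF x1 z] btw by (meson not_le)
  moreover have "z = y1 \<or> (\<forall>i. z i < y1 i)"
    using minimal_ordered[OF z y1] btw by (meson not_le)
  ultimately have "x1 = z \<or> z = y1" using no_minimal_between[OF z] by blast
  then have "u = (\<lambda>_. 0) \<or> u = D"
  proof
    assume eq: "x1 = z"
    have "x i = 0" for i using fun_cong[OF eq, of i, unfolded z_def] by linarith
    then show ?thesis by (auto simp: ux lift_apply)
  next
    assume eq: "z = y1"
    have "x i = y1 i - x1 i" for i using fun_cong[OF eq, of i, unfolded z_def] by linarith
    then show ?thesis by (auto simp: ux lift_apply D_def)
  qed
  with F0 show ?thesis by simp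
qed

lemma ground_states:
  assumes u: "u \<in> G"
  shows "0 \<le> F u" and "F u = 0 \<Longrightarrow> u = (\<lambda>_. 0) \<or> u = D"
proof -
  obtain u0 where u0: "u0 \<in> G" "\<And>u'. u' \<in> G \<Longrightarrow> F u0 \<le> F u'"
    using continuous_attains_inf[OF compact_G _ continuous_F] zero_G by blast
  have "F u0 = 0" using minimizer_cases[OF u0] by simp
  then show "0 \<le> F u" using u0(2)[OF u] by simp
  show "u = (\<lambda>_. 0) \<or> u = D" if "F u = 0"
    using minimizer_cases[OF u] u0(2) that \<open>F u0 = 0\<close> by auto
qed


subsection \<open>Paths across the gap\<close>

abbreviation H :: "(real \<Rightarrow> 'n lattice \<Rightarrow> real) set" where
  "H \<equiv> H1q \<iota> q v w"

lemma H_iff: "h \<in> H \<longleftrightarrow> (\<forall>\<theta>\<in>{0..1}. h \<theta> \<in> G) \<and>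
    (\<forall>\<theta>\<in>{0..1}. ((\<lambda>t. norm1q \<iota> q (\<lambda>j. h t j - h \<theta> j)) \<longlongrightarrow> 0) (at \<theta> within {0..1})) \<and>
    h 0 = (\<lambda>_. 0) \<and> h 1 = D"
  by (simp add: H1q_def D_def)

text \<open>
  Continuity of \<open>T\<close> in the norm of the path space.  The \<open>l1\<close> part controls the whole norm up to the
  factor \<open>2\<close>, and a perturbation at one site changes \<open>grad\<close> at boundedly many sites.
\<close>

lemma T_norm_lipschitz:
  assumes u: "u \<in> G" and u': "u' \<in> G"
  shows "norm1q \<iota> q (\<lambda>j. T u' j - T u j) \<le> 2 * (1 + \<eta> * (C * cB\<^sup>2)) * norm1q \<iota> q (\<lambda>j. u' j - u j)"
proof -
  let ?d = "\<lambda>j. \<bar>u' j - u j\<bar>"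
  let ?L = "1 + \<eta> * (C * cB\<^sup>2)"
  let ?R = "\<lambda>j. ?d j + \<eta> * (C * (\<Sum>k\<in>B r. \<Sum>l\<in>B r. ?d (j + (l - k))))"
  have dL: "(\<lambda>j. u' j - u j) \<in> \<Lambda>" using u u' by (intro Lambda_diff G_Lambda)
  have TL: "(\<lambda>j. T u' j - T u j) \<in> \<Lambda>" using u u' T_G by (intro Lambda_diff G_Lambda)
  define X where "X = (\<Sum>\<^sub>\<infinity>j\<in>cyl. ?d j)"
  have per: "periodic \<iota> q ?d" and X: "(?d has_sum X) cyl"
    using dL by (auto simp: Lambda_iff X_def periodic_def)
  have "((\<lambda>j. \<Sum>k\<in>B r. \<Sum>l\<in>B r. ?d (j + (l - k))) has_sum
      (\<Sum>k\<in>(B r :: 'n lattice set). \<Sum>l\<in>(B r :: 'n lattice set). X)) cyl"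
    using cyl_has_sum_shift[OF per, THEN iffD2, OF X] by (intro has_sum_sum_real finite_B)
  then have "((\<lambda>j. \<Sum>k\<in>B r. \<Sum>l\<in>B r. ?d (j + (l - k))) has_sum (cB\<^sup>2 * X)) cyl"
    by (simp add: cB power2_eq_square mult.assoc)
  from has_sum_add[OF X has_sum_cmult_right[OF has_sum_cmult_right[OF this, of C], of \<eta>]]
  have R: "(?R has_sum (?L * X)) cyl" by (simp add: algebra_simps)
  have le: "\<bar>T u' j - T u j\<bar> \<le> ?R j" for j
  proof -
    let ?g = "\<lambda>u. grad (\<lambda>i. v i + u i) j"
    have "\<bar>?g u' - ?g u\<bar> \<le> C * (\<Sum>k\<in>B r. \<Sum>l\<in>B r. ?d (j + (l - k)))"
      using grad_lipschitz[of "\<lambda>i. v i + u' i" j "\<lambda>i. v i + u i"] by (simp add: algebra_simps)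
    then have "\<eta> * \<bar>?g u' - ?g u\<bar> \<le> \<eta> * (C * (\<Sum>k\<in>B r. \<Sum>l\<in>B r. ?d (j + (l - k))))"
      using eta_pos by (intro mult_left_mono) auto
    moreover have "T u' j - T u j = (u' j - u j) - \<eta> * (?g u' - ?g u)"
      by (simp add: T_def algebra_simps)
    then have "\<bar>T u' j - T u j\<bar> \<le> ?d j + \<bar>\<eta> * (?g u' - ?g u)\<bar>" by linarith
    moreover have "\<bar>\<eta> * (?g u' - ?g u)\<bar> = \<eta> * \<bar>?g u' - ?g u\<bar>" using eta_pos by (simp add: abs_mult)
    ultimately show ?thesis by linarith
  qed
  have "norm1q \<iota> q (\<lambda>j. T u' j - T u j) \<le> 2 * (\<Sum>\<^sub>\<infinity>j\<in>cyl. \<bar>T u' j - T u j\<bar>)"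
    by (rule norm1q_bounds(2)[OF TL])
  also have "2 * (\<Sum>\<^sub>\<infinity>j\<in>cyl. \<bar>T u' j - T u j\<bar>) \<le> 2 * (?L * X)"
  proof -
    have "(\<Sum>\<^sub>\<infinity>j\<in>cyl. \<bar>T u' j - T u j\<bar>) \<le> infsum ?R cyl"
      using TL has_sum_imp_summable[OF R] le by (intro infsum_mono) (auto simp: Lambda_iff)
    then show ?thesis by (simp only: infsumI[OF R])
  qed
  also have "2 * (?L * X) \<le> 2 * (?L * norm1q \<iota> q (\<lambda>j. u' j - u j))"
  proof (intro mult_left_mono)
    show "X \<le> norm1q \<iota> q (\<lambda>j. u' j - u j)" unfolding X_def by (rule norm1q_bounds(1)[OF dL])
    show "0 \<le> ?L" using eta_pos C_nonneg by simp
  qed simp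
  finally show ?thesis by (simp only: mult.assoc)
qed

lemma T_path:
  assumes h: "h \<in> H"
  shows "(\<lambda>\<theta>. T (h \<theta>)) \<in> H"
  unfolding H_iff
proof (intro conjI ballI)
  have hG: "\<And>\<theta>. \<theta> \<in> {0..1} \<Longrightarrow> h \<theta> \<in> G" using h by (simp add: H_iff)
  show "T (h \<theta>) \<in> G" if "\<theta> \<in> {0..1}" for \<theta> using T_G hG that by blast
  show "T (h 0) = (\<lambda>_. 0)" "T (h 1) = D" using h by (simp_all add: H_iff T_zero T_D)
  fix \<theta> :: real assume \<theta>: "\<theta> \<in> {0..1}"
  let ?K = "2 * (1 + \<eta> * (C * cB\<^sup>2))"
  have "((\<lambda>t. norm1q \<iota> q (\<lambda>j. h t j - h \<theta> j)) \<longlongrightarrow> 0) (at \<theta> within {0..1})"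
    using h \<theta> by (simp add: H_iff)
  then have "((\<lambda>t. ?K * norm1q \<iota> q (\<lambda>j. h t j - h \<theta> j)) \<longlongrightarrow> 0) (at \<theta> within {0..1})"
    by (rule tendsto_mult_right_zero)
  then show "((\<lambda>t. norm1q \<iota> q (\<lambda>j. T (h t) j - T (h \<theta>) j)) \<longlongrightarrow> 0) (at \<theta> within {0..1})"
  proof (rule Lim_null_comparison[rotated])
    have "0 \<le> norm1q \<iota> q f" for f
      unfolding norm1q_def by (intro add_nonneg_nonneg real_sqrt_ge_zero infsum_nonneg) auto
    then show "\<forall>\<^sub>F t in at \<theta> within {0..1}. norm (norm1q \<iota> q (\<lambda>j. T (h t) j - T (h \<theta>) j))
        \<le> ?K * norm1q \<iota> q (\<lambda>j. h t j - h \<theta> j)"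
      using T_norm_lipschitz[OF hG[OF \<theta>] hG] by (simp add: eventually_at_filter)
  qed
qed

lemma path_crosses_middle:
  assumes h: "h \<in> H"
  shows "\<exists>\<theta>\<in>{0..1}. h \<theta> 0 = D 0 / 2"
proof -
  have hG: "\<And>\<theta>. \<theta> \<in> {0..1} \<Longrightarrow> h \<theta> \<in> G" using h by (simp add: H_iff)
  have "continuous_on {0..1} (\<lambda>\<theta>. h \<theta> 0)"
    unfolding continuous_on_def
  proof
    fix \<theta> :: real assume \<theta>: "\<theta> \<in> {0..1}"
    have "((\<lambda>t. h t 0 - h \<theta> 0) \<longlongrightarrow> 0) (at \<theta> within {0..1})"
    proof (rule Lim_null_comparison)
      show "((\<lambda>t. norm1q \<iota> q (\<lambda>j. h t j - h \<theta> j)) \<longlongrightarrow> 0) (at \<theta> within {0..1})"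
        using h \<theta> by (simp add: H_iff)
      have "\<bar>h t 0 - h \<theta> 0\<bar> \<le> norm1q \<iota> q (\<lambda>j. h t j - h \<theta> j)" if t: "t \<in> {0..1}" for t
      proof -
        have d: "(\<lambda>j. h t j - h \<theta> j) \<in> \<Lambda>" using hG t \<theta> by (intro Lambda_diff G_Lambda)
        then show ?thesis
          using abs_le_infsum[OF _ zero_in_cyl, of "\<lambda>j. h t j - h \<theta> j"] norm1q_bounds(1)[OF d]
          by (auto simp: Lambda_iff)
      qed
      then show "\<forall>\<^sub>F t in at \<theta> within {0..1}. norm (h t 0 - h \<theta> 0) \<le> norm1q \<iota> q (\<lambda>j. h t j - h \<theta> j)"
        by (simp add: eventually_at_filter)
    qed
    then show "((\<lambda>\<theta>. h \<theta> 0) \<longlongrightarrow> h \<theta> 0) (at \<theta> within {0..1})" by (simp add: LIM_zero_iff)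
  qed
  moreover have "h 0 0 \<le> D 0 / 2" "D 0 / 2 \<le> h 1 0"
    using h D_pos[of 0] by (simp_all add: H_iff)
  ultimately show ?thesis using IVT'[of "\<lambda>\<theta>. h \<theta> 0" 0 "D 0 / 2" 1] by auto
qed

lemma straight_path: "(\<lambda>\<theta> j. \<theta> * D j) \<in> H"
  unfolding H_iff
proof (intro conjI ballI)
  show "(\<lambda>j. \<theta> * D j) \<in> G" if "\<theta> \<in> {0..1}" for \<theta>
    using that D_G D_pos by (auto simp: G_iff periodic_def mult_left_le_one_le less_imp_le)
  fix \<theta> :: real assume "\<theta> \<in> {0..1}"
  have "norm1q \<iota> q (\<lambda>j. t * D j - \<theta> * D j) = \<bar>t - \<theta>\<bar> * norm1q \<iota> q D" for t
    by (simp add: norm1q_def flip: left_diff_distrib)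
      (simp add: abs_mult power_mult_distrib infsum_cmult_right' real_sqrt_mult distrib_left)
  moreover have "((\<lambda>t. \<bar>t - \<theta>\<bar> * norm1q \<iota> q D) \<longlongrightarrow> \<bar>\<theta> - \<theta>\<bar> * norm1q \<iota> q D) (at \<theta> within {0..1})"
    by (intro tendsto_intros)
  ultimately show "((\<lambda>t. norm1q \<iota> q (\<lambda>j. t * D j - \<theta> * D j)) \<longlongrightarrow> 0) (at \<theta> within {0..1})"
    by simp
qed simp_all


subsection \<open>The mountain pass level\<close>

abbreviation d :: ereal where
  "d \<equiv> d1q r s \<iota> q v w"

lemma d_eq: "d = (INF h\<in>H. SUP \<theta>\<in>{0..1}. ereal (N * cmin + F (h \<theta>)))"
  unfolding d1q_def by (intro INF_cong SUP_cong refl I_eq G_Lambda) (simp add: H_iff)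

text \<open>
  The barrier: on the compact set of functions having half the gap at the origin, which every path
  must meet, \<open>F\<close> is positive and attains its minimum.
\<close>

lemma d_bounds: "\<exists>f>0. d = ereal (N * cmin + f)"
proof -
  let ?A = "{u \<in> G. u 0 = D 0 / 2}"
  have "?A = G \<inter> {u. u 0 = D 0 / 2}" by auto
  moreover have "closed {u :: 'n lattice \<Rightarrow> real. u 0 = D 0 / 2}"
    by (intro closed_Collect_eq coordinate_continuous continuous_on_const)
  ultimately have A: "compact ?A" using compact_Int_closed[OF compact_G] by simp
  have ne: "?A \<noteq> {}" using path_crosses_middle[OF straight_path] straight_path by (auto simp: H_iff)
  have "continuous_on ?A F" by (rule continuous_on_subset[OF continuous_F]) auto
  from continuous_attains_inf[OF A ne this] obtain u0 where
    u0: "u0 \<in> G" "u0 0 = D 0 / 2" and low: "\<And>u. u \<in> G \<Longrightarrow> u 0 = D 0 / 2 \<Longrightarrow> F u0 \<le> F u" by auto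
  have "F u0 \<noteq> 0" using ground_states(2)[OF u0(1)] u0(2) D_pos[of 0] by auto
  then have pos: "0 < F u0" using ground_states(1)[OF u0(1)] by simp
  have "ereal (N * cmin + F u0) \<le> d"
    unfolding d_eq
  proof (rule INF_greatest)
    fix h assume h: "h \<in> H"
    from path_crosses_middle[OF h] obtain \<theta> where \<theta>: "\<theta> \<in> {0..1}" "h \<theta> 0 = D 0 / 2" by blast
    have "h \<theta> \<in> G" using h \<theta>(1) by (simp add: H_iff)
    then have "ereal (N * cmin + F u0) \<le> ereal (N * cmin + F (h \<theta>))" using low \<theta>(2) by simp
    then show "ereal (N * cmin + F u0) \<le> (SUP \<theta>\<in>{0..1}. ereal (N * cmin + F (h \<theta>)))"
      using \<theta>(1) by (rule SUP_upper2[rotated])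
  qed
  moreover obtain u1 where u1: "\<And>u. u \<in> G \<Longrightarrow> F u \<le> F u1"
    using continuous_attains_sup[OF compact_G _ continuous_F] zero_G by blast
  have "d \<le> ereal (N * cmin + F u1)"
    unfolding d_eq
  proof (rule INF_lower2[OF straight_path], rule SUP_least)
    fix \<theta> :: real assume "\<theta> \<in> {0..1}"
    then have "(\<lambda>j. \<theta> * D j) \<in> G" using straight_path by (simp add: H_iff)
    then show "ereal (N * cmin + F (\<lambda>j. \<theta> * D j)) \<le> ereal (N * cmin + F u1)" using u1 by simp
  qed
  ultimately obtain d' where "d = ereal d'" "N * cmin + F u0 \<le> d'" by (cases d) auto
  then show ?thesis using pos by (intro exI[of _ "d' - N * cmin"]) auto
qed

text \<open>
  Applying \<open>T\<close> to a nearly optimal path gives another admissible path.  Where the new path is still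
  nearly as high as \<open>d\<close>, the old point had nearly the energy \<open>d\<close> and lost nearly nothing.  By
  compactness some point of energy \<open>d\<close> loses nothing at all.
\<close>

lemma critical_point_exists:
  assumes f: "d = ereal (N * cmin + f)"
  shows "\<exists>u\<in>G. F u = f \<and> solution r s (\<lambda>j. v j + u j)"
proof -
  \<comment> \<open>The defect \<open>\<psi> \<ge> 0\<close> vanishes exactly at points of energy \<open>d\<close> at which \<open>T\<close> is stationary.\<close>
  define \<psi> where "\<psi> u = \<bar>F u - f\<bar> + (F u - F (T u))" for u
  have "continuous_on G \<psi>"
    unfolding \<psi>_def by (intro continuous_intros continuous_F continuous_F_T)
  then obtain u where u: "u \<in> G" and min: "\<And>u'. u' \<in> G \<Longrightarrow> \<psi> u \<le> \<psi> u'"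
    using continuous_attains_inf[OF compact_G] zero_G by blast
  have "\<psi> u \<le> 0 + \<epsilon>" if "0 < \<epsilon>" for \<epsilon>
  proof -
    define \<delta> where "\<delta> = \<epsilon> / 3"
    have \<delta>: "0 < \<delta>" using that by (simp add: \<delta>_def)
    have "d < ereal (N * cmin + f + \<delta>)" using f \<delta> by simp
    then obtain h where h: "h \<in> H"
      and less: "(SUP \<theta>\<in>{0..1}. ereal (N * cmin + F (h \<theta>))) < ereal (N * cmin + f + \<delta>)"
      unfolding d_eq INF_less_iff by blast
    have "d \<le> (SUP \<theta>\<in>{0..1}. ereal (N * cmin + F (T (h \<theta>))))"
      unfolding d_eq by (rule INF_lower[OF T_path[OF h]])
    moreover have "ereal (N * cmin + f - \<delta>) < d" using f \<delta> by simp
    ultimately have "ereal (N * cmin + f - \<delta>) < (SUP \<theta>\<in>{0..1}. ereal (N * cmin + F (T (h \<theta>))))"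
      by (rule less_le_trans[rotated])
    then obtain \<theta> where \<theta>: "\<theta> \<in> {0..1}" and "ereal (N * cmin + f - \<delta>) < ereal (N * cmin + F (T (h \<theta>)))"
      unfolding less_SUP_iff by blast
    then have high: "f - \<delta> < F (T (h \<theta>))" by simp
    have "ereal (N * cmin + F (h \<theta>)) < ereal (N * cmin + f + \<delta>)"
      using SUP_lessD[OF less \<theta>] .
    then have "F (h \<theta>) < f + \<delta>" by simp
    moreover have hG: "h \<theta> \<in> G" using h \<theta> by (simp add: H_iff)
    ultimately have "\<psi> (h \<theta>) \<le> 3 * \<delta>" using T_le[OF hG] high by (simp add: \<psi>_def)
    then show ?thesis using min[OF hG] by (simp add: \<delta>_def)
  qed
  then have "\<psi> u \<le> 0" by (rule field_le_epsilon)
  then have "F u = f" "F u \<le> F (T u)" using T_le[OF u] by (auto simp: \<psi>_def)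
  with stationary_solution[OF u] u show ?thesis by blast
qed

text \<open>At a solution the energy differences are quadratically small, since their linear part is \<open>grad\<close>.\<close>

lemma critical_frechet:
  assumes u: "u \<in> G" and sol: "solution r s (\<lambda>j. v j + u j)"
  shows "has_frechet_derivative \<Lambda> (norm1q \<iota> q) (I1q r s \<iota> q v) (\<lambda>_. 0) u"
proof -
  define K where "K = C * cB\<^sup>2"
  have K: "0 \<le> K" using C_nonneg by (simp add: K_def)
  have per: "periodic \<iota> q u" using u by (simp add: G_iff)
  have I: "I1q r s \<iota> q v (\<lambda>j. u j + h j) = ereal (N * cmin + F (\<lambda>j. u j + h j))" if "h \<in> \<Lambda>" for h
    using I_eq[OF Lambda_add[OF G_Lambda[OF u] that]] .
  have est: "\<bar>F (\<lambda>j. u j + h j) - F u\<bar> \<le> K * (norm1q \<iota> q h)\<^sup>2" if h: "h \<in> \<Lambda>" for h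
  proof -
    have "\<bar>dE (\<lambda>j. v j + u j) h - (\<Sum>\<^sub>\<infinity>j\<in>cyl. grad (\<lambda>j. v j + u j) j * h j)\<bar> \<le> K * (\<Sum>\<^sub>\<infinity>j\<in>cyl. (h j)\<^sup>2)"
      unfolding K_def by (rule energy_expansion(3)[OF periodic_v_plus[OF per] G_bounds'[OF u] h])
    also have "\<dots> \<le> K * (norm1q \<iota> q h)\<^sup>2" using norm1q_bounds(3)[OF h] K by (rule mult_left_mono)
    finally show ?thesis using sol F_add[OF u h] by (simp add: solution_iff)
  qed
  have small: "\<exists>\<delta>>0. \<forall>h\<in>\<Lambda>. norm1q \<iota> q h < \<delta> \<longrightarrow>
      \<bar>real_of_ereal (I1q r s \<iota> q v (\<lambda>j. u j + h j)) - real_of_ereal (I1q r s \<iota> q v u) - 0\<bar> \<le> \<epsilon> * norm1q \<iota> q h"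
    if "0 < \<epsilon>" for \<epsilon>
  proof (intro exI[of _ "\<epsilon> / (K + 1)"] conjI ballI impI)
    show "0 < \<epsilon> / (K + 1)" using that K by simp
    fix h assume h: "h \<in> \<Lambda>" and lt: "norm1q \<iota> q h < \<epsilon> / (K + 1)"
    have n: "0 \<le> norm1q \<iota> q h"
      using norm1q_bounds(1)[OF h] infsum_nonneg[of cyl "\<lambda>j. \<bar>h j\<bar>"] by simp
    have "K * norm1q \<iota> q h \<le> (K + 1) * norm1q \<iota> q h" using n by (simp add: algebra_simps)
    also have "\<dots> \<le> \<epsilon>" using lt K by (simp add: field_simps)
    finally have "K * norm1q \<iota> q h * norm1q \<iota> q h \<le> \<epsilon> * norm1q \<iota> q h" using n by (rule mult_right_mono)
    then show "\<bar>real_of_ereal (I1q r s \<iota> q v (\<lambda>j. u j + h j)) - real_of_ereal (I1q r s \<iota> q v u) - 0\<bar>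
        \<le> \<epsilon> * norm1q \<iota> q h"
      using est[OF h] I[OF h] I_eq[OF G_Lambda[OF u]] by (simp add: power2_eq_square mult.assoc)
  qed
  show ?thesis
    unfolding has_frechet_derivative_def
  proof (intro conjI)
    show "\<exists>K. \<forall>h\<in>\<Lambda>. \<bar>0\<bar> \<le> K * norm1q \<iota> q h" by (rule exI[of _ 0]) simp
    show "\<exists>\<delta>>0. \<forall>h\<in>\<Lambda>. norm1q \<iota> q h < \<delta> \<longrightarrow> \<bar>I1q r s \<iota> q v (\<lambda>j. u j + h j)\<bar> \<noteq> \<infinity>"
      using I by (intro exI[of _ 1]) simp
  qed (use small in simp_all)
qed

lemma v_Gamma1q: "v \<in> Gamma1q \<iota> q (\<lambda>_. \<alpha>) (\<lambda>_. \<beta>)"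
proof -
  have sl: "(\<Sum>j\<in>slice \<iota> q i. \<bar>v j - a\<bar>) = N * \<bar>x1 i - a\<bar>" for i a
  proof -
    have "(\<Sum>j\<in>slice \<iota> q i. \<bar>v j - a\<bar>) = (\<Sum>j\<in>slice \<iota> q i. \<bar>x1 i - a\<bar>)"
      by (intro sum.cong) (auto simp: slice_def lift_apply)
    then show ?thesis by (simp only: sum_slice_const)
  qed
  have "((\<lambda>i. N * \<bar>x1 i - \<alpha>\<bar>) \<longlongrightarrow> 0) at_bot" "((\<lambda>i. N * \<bar>x1 i - \<beta>\<bar>) \<longlongrightarrow> 0) at_top"
    using x1 by (intro tendsto_mult_right_zero; simp only: tendsto_abs_diff_iff minimal_def het_def)+
  then show ?thesis
    unfolding Gamma1q_def mem_Collect_eq le_fun_def sl using v_bounds periodic_lift by blast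
qed

lemma c1q_le: "c1q r s \<iota> q (\<lambda>_. \<alpha>) (\<lambda>_. \<beta>) \<le> ereal (N * cmin)"
  unfolding c1q_def using INF_lower[OF v_Gamma1q, of "J1q r s \<iota> q"] Liminf_P[OF P_v]
  by (simp add: J1q_eq)

theorem mountain_pass:
  "c1q r s \<iota> q (\<lambda>_. \<alpha>) (\<lambda>_. \<beta>) < d \<and>
    (\<exists>u\<in>G. has_frechet_derivative \<Lambda> (norm1q \<iota> q) (I1q r s \<iota> q v) (\<lambda>_. 0) u \<and>
       I1q r s \<iota> q v u = d \<and> v \<lless> (\<lambda>j. u j + v j) \<and> (\<lambda>j. u j + v j) \<lless> w \<and>
       solution r s (\<lambda>j. u j + v j))"
proof -
  obtain f where f: "0 < f" "d = ereal (N * cmin + f)" using d_bounds by blast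
  obtain u where u: "u \<in> G" "F u = f" and sol: "solution r s (\<lambda>j. v j + u j)"
    using critical_point_exists[OF f(2)] by blast
  have "v a \<noteq> v a + u a" for a
  proof
    assume "v a = v a + u a"
    then have eq: "v = (\<lambda>j. v j + u j)"
      using G_bounds[OF u(1)]
      by (intro strong_maximum[OF r_ge_1 _ v_sol sol, of a]) (auto simp: le_fun_def)
    have "u = (\<lambda>_. 0)" using fun_cong[OF eq] by auto
    then show False using u(2) f(1) by simp
  qed
  moreover have "v a + u a \<noteq> w a" for a
  proof
    assume "v a + u a = w a"
    then have eq: "(\<lambda>j. v j + u j) = w"
      using G_bounds[OF u(1)]
      by (intro strong_maximum[OF r_ge_1 _ sol w_sol, of a]) (auto simp: le_fun_def)
    have "u = D" using fun_cong[OF eq] by (auto simp: D_def algebra_simps)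
    then show False using u(2) f(1) F_D by simp
  qed
  ultimately have "v \<lless> (\<lambda>j. u j + v j)" "(\<lambda>j. u j + v j) \<lless> w"
    using G_bounds[OF u(1)] unfolding pt_less_def by (simp_all add: less_le add.commute)
  moreover have "c1q r s \<iota> q (\<lambda>_. \<alpha>) (\<lambda>_. \<beta>) < d"
    using c1q_le f by (auto intro: le_less_trans)
  moreover have "I1q r s \<iota> q v u = d" using I_eq[OF G_Lambda[OF u(1)]] u(2) f(2) by simp
  moreover have "solution r s (\<lambda>j. u j + v j)" using sol by (simp add: add.commute)
  ultimately show ?thesis using critical_frechet[OF u(1) sol] u(1) by blast
qed

end


section \<open>The mountain pass theorem\<close>

theorem mainTheorem3:
  fixes r :: nat
    and s :: "('n::finite lattice \<Rightarrow> real) \<Rightarrow> real"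
    and \<iota> :: 'n
    and v0 w0 v1 w1 :: "'n lattice \<Rightarrow> real"
    and q :: "'n \<Rightarrow> nat"
  assumes "r \<ge> 1"
    and "C2_RA (B r) s"
    and "S1 r s" and "S2 r s" and "S3 r s" and "S4 r s"
    and "adjacent (M0 r s) v0 w0"
    and "adjacent (M1 r s \<iota> v0 w0) v1 w1"
    and "\<forall>k. k \<noteq> \<iota> \<longrightarrow> q k \<ge> 1"
  shows "d1q r s \<iota> q v1 w1 > c1q r s \<iota> q v0 w0 \<and>
    (\<exists>u \<in> G1q \<iota> q v1 w1.
       has_frechet_derivative (Lambda1q \<iota> q) (norm1q \<iota> q) (I1q r s \<iota> q v1) (\<lambda>_. 0) u \<and>
       I1q r s \<iota> q v1 u = d1q r s \<iota> q v1 w1 \<and>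
       v1 \<lless> (\<lambda>j. u j + v1 j) \<and> (\<lambda>j. u j + v1 j) \<lless> w1 \<and>
       solution r s (\<lambda>j. u j + v1 j))"
proof -
  obtain C where C: "\<And>i k x. i \<in> B r \<Longrightarrow> k \<in> B r \<Longrightarrow> x \<in> RB r \<Longrightarrow> \<bar>pderiv_at i (pderiv_at k s) x\<bar> \<le> C"
    using \<open>S4 r s\<close> unfolding S4_def by blast
  obtain \<alpha> \<beta> where v0: "v0 = (\<lambda>_. \<alpha>)" "S r s 0 (\<lambda>_. \<alpha>) = c0 r s"
    and w0: "w0 = (\<lambda>_. \<beta>)" "S r s 0 (\<lambda>_. \<beta>) = c0 r s" and less: "\<alpha> < \<beta>"
    using \<open>adjacent (M0 r s) v0 w0\<close> by (auto simp: adjacent_def M0_def constants_def pt_less_def)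
  have "bdd_below ((\<lambda>u. S r s 0 u) ` constants)"
    using \<open>S2 r s\<close> unfolding S2_def S_def by (auto elim!: bdd_below_mono)
  then have c0: "c0 r s \<le> S r s 0 (\<lambda>_. x)" for x
    unfolding c0_def by (rule cINF_lower) (auto simp: constants_def)
  interpret chain r s C "real (card (B r :: 'n lattice set))" \<iota> \<alpha> \<beta>
    using assms C less c0 v0(2) w0(2) by unfold_locales auto
  have M1: "M1 r s \<iota> v0 w0 = lift ` {x. minimal x}" unfolding v0(1) w0(1) by (rule M1_eq)
  obtain x1 y1 where x1: "minimal x1" and v1: "v1 = lift x1" and y1: "minimal y1" and w1: "w1 = lift y1"
    and lt: "lift x1 \<lless> lift y1" and gap: "\<And>z. minimal z \<Longrightarrow> \<not> (lift x1 \<lless> lift z \<and> lift z \<lless> lift y1)"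
    using \<open>adjacent (M1 r s \<iota> v0 w0) v1 w1\<close> unfolding adjacent_def M1 by blast
  have lift_less: "lift x \<lless> lift y \<longleftrightarrow> (\<forall>i. x i < y i)" for x y
    unfolding pt_less_def lift_apply by (metis axis_nth)
  interpret gap r s C "real (card (B r :: 'n lattice set))" \<iota> \<alpha> \<beta> q x1 y1
  proof unfold_locales
    show "0 < q k" if "k \<noteq> \<iota>" for k using assms(9) that by force
    show "x1 i < y1 i" for i using lt lift_less by blast
    show "\<exists>i. \<not> (x1 i < z i \<and> z i < y1 i)" if "minimal z" for z
      using gap[OF that] lift_less by blast
  qed (use x1 y1 in auto)
  show ?thesis using mountain_pass unfolding v0(1) w0(1) v1 w1 .
qed

end
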